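(* Let $\omega$ be an arbitrary radial weight on $\mathbb{C}^d$, $d\ge1$. Assume that $g\in\mathcal{H}ol(\mathbb{C}^d)$, $\varphi:\mathbb{C}^d\to\mathbb{C}^d$ is a holomorphic map, $\alpha>0$ and $0<q\le\infty$. Then the following properties are equivalent: (i) $V_g^\varphi:\mathcal{A}^\omega(\mathbb{C}^d)\to\mathcal{F}_\alpha^q(\mathbb{C}^d)$ is a bounded operator; (ii) $$\frac{|\mathcal{R}g(z)|}{(1+|z|)^2}\,e^{-\frac{\alpha}{2}|z|^2}\,\widetilde{\omega}(|\varphi(z)|)\in L^q(\mathbb{C}^d,\nu_d).$$
   Context: $\mathcal{H}ol(\mathbb{C}^d)$ is the space of entire functions on $\mathbb{C}^d$ and $\nu_d$ is Lebesgue measure on $\mathbb{C}^d$. A weight function is a non-decreasing, continuous, unbounded function $\omega:[0,+\infty)\to(0,+\infty)$; it is always assumed in addition that $\lim_{t\to+\infty}t^{-k}\omega(t)=\infty$ for all $k\in\mathbb{N}$. A radial weight on $\mathbb{C}^d$ is the extension $\omega(z)=\omega(|z|)$, $z\in\mathbb{C}^d$, of a weight function. The growth space $\mathcal{A}^\omega(\mathbb{C}^d)$ consists of those $f\in\mathcal{H}ol(\mathbb{C}^d)$ with $\|f\|_{\mathcal{A}^\omega}=\sup_{z\in\mathbb{C}^d}|f(z)|/\omega(z)<\infty$. The associated weight function $\widetilde{\omega}:[0,+\infty)\to(0,+\infty)$ is defined by $\widetilde{\omega}(|z|)=\sup\{|f(z)|: f\in\mathcal{H}ol(\mathbb{C}),\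 |f(w)|\le\omega(|w|)\text{ for all }w\in\mathbb{C}\}$, $z\in\mathbb{C}$ (the supremum depends only on $|z|$; the analogous supremum over $\mathcal{H}ol(\mathbb{C}^d)$ yields the same function for every $d\ge1$). For $0<q<\infty$, the Fock space $\mathcal{F}_\alpha^q(\mathbb{C}^d)$ consists of those $f\in\mathcal{H}ol(\mathbb{C}^d)$ with $\|f\|_{\mathcal{F}_\alpha^q}^q=\left(\frac{\alpha q}{2\pi}\right)^d\int_{\mathbb{C}^d}|f(z)|^q e^{-\frac{\alpha q}{2}|z|^2}\,d\nu_d(z)<\infty$; $\mathcal{F}_\alpha^\infty(\mathbb{C}^d)$ consists of those $f\in\mathcal{H}ol(\mathbb{C}^d)$ with $\|f\|_{\mathcal{F}_\alpha^\infty}=\sup_{z\in\mathbb{C}^d}|f(z)|e^{-\frac{\alpha}{2}|z|^2}<\infty$. The radial derivative is $\mathcal{R}g(z)=\sum_{j=1}^d z_j\frac{\partial g}{\partial z_j}(z)$. The Volterra type operator is $V_g^\varphi f(z)=\int_0^1 f(\varphi(tz))\,\mathcal{R}g(tz)\,\frac{dt}{t}$, $f\in\mathcal{H}ol(\mathbb{C}^d)$, $z\in\mathbb{C}^d$. *)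

theory Defs
  imports "HOL-Analysis.Analysis"
begin

text \<open>
  The space of \<open>d\<close> complex variables is \<^typ>\<open>complex ^ 'n\<close> with \<open>d = CARD('n) \<ge> 1\<close>;
  its library norm is the Euclidean norm, so \<^term>\<open>lebesgue\<close> is the usual Lebesgue measure.
\<close>

section \<open>Entire functions of several complex variables\<close>

text \<open>Complex differentiability: the Frechet derivative exists and is complex linear.\<close>

definition entire :: "(complex ^ 'n \<Rightarrow> complex) \<Rightarrow> bool" where
  "entire f \<longleftrightarrow>
     (\<forall>z. \<exists>D. (f has_derivative D) (at z) \<and> (\<forall>c v. D (c *s v) = c * D v))"

definition entire_map :: "(complex ^ 'n \<Rightarrow> complex ^ 'm) \<Rightarrow> bool" where
  "entire_map \<phi> \<longleftrightarrow> (\<forall>i. entire (\<lambda>z. \<phi> z $ i))"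

definition partial_deriv :: "'n \<Rightarrow> (complex ^ 'n \<Rightarrow> complex) \<Rightarrow> complex ^ 'n \<Rightarrow> complex" where
  "partial_deriv j g z = deriv (\<lambda>w. g (\<chi> i. if i = j then w else z $ i)) (z $ j)"

definition radial_deriv :: "(complex ^ 'n \<Rightarrow> complex) \<Rightarrow> complex ^ 'n \<Rightarrow> complex" where
  "radial_deriv g z = (\<Sum>j\<in>UNIV. z $ j * partial_deriv j g z)"

section \<open>Weights and growth spaces\<close>

text \<open>
  Only the values on \<open>{0..}\<close> matter. The radial weight on \<open>d\<close> complex variables
  is \<open>\<lambda>z. \<omega> (norm z)\<close>.
\<close>

definition weight_function :: "(real \<Rightarrow> real) \<Rightarrow> bool" where
  "weight_function \<omega> \<longleftrightarrow>
     (\<forall>t\<ge>0. \<omega> t > 0) \<and> mono_on {0..} \<omega> \<and> continuous_on {0..} \<omega> \<and>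
     \<not> bdd_above (\<omega> ` {0..}) \<and>
     (\<forall>k::nat. filterlim (\<lambda>t. \<omega> t / t ^ k) at_top at_top)"

definition growth_space :: "(real \<Rightarrow> real) \<Rightarrow> (complex ^ 'n \<Rightarrow> complex) set" where
  "growth_space \<omega> = {f. entire f \<and> bdd_above (range (\<lambda>z. norm (f z) / \<omega> (norm z)))}"

definition growth_norm :: "(real \<Rightarrow> real) \<Rightarrow> (complex ^ 'n \<Rightarrow> complex) \<Rightarrow> real" where
  "growth_norm \<omega> f = (SUP z. norm (f z) / \<omega> (norm z))"

text \<open>
  The supremum over entire functions of one variable is evaluated at the point \<open>r \<ge> 0\<close>
  of the circle of radius \<open>r\<close>; the lemma \<open>assoc_weight_norm\<close> shows that every other point
  of the circle gives the same value.
\<close>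

definition assoc_weight :: "(real \<Rightarrow> real) \<Rightarrow> real \<Rightarrow> real" where
  "assoc_weight \<omega> r =
     Sup {norm (f (complex_of_real r)) | f. f holomorphic_on UNIV \<and> (\<forall>w. norm (f w) \<le> \<omega> (norm w))}"

lemma assoc_weight_norm:
  "assoc_weight \<omega> (norm (z::complex)) =
     Sup {norm (f z) | f. f holomorphic_on UNIV \<and> (\<forall>w. norm (f w) \<le> \<omega> (norm w))}"
proof -
  have sub: "{norm (f x) | f. f holomorphic_on UNIV \<and> (\<forall>w. norm (f w) \<le> \<omega> (norm w))}
      \<subseteq> {norm (f y) | f. f holomorphic_on UNIV \<and> (\<forall>w. norm (f w) \<le> \<omega> (norm w))}"
    if xy: "norm x = norm y" for x y :: complex
  proof clarify
    fix f assume f: "f holomorphic_on UNIV" "\<forall>w. norm (f w) \<le> \<omega> (norm w)"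
    obtain c where c: "norm c = 1" "c * y = x"
    proof (cases "y = 0")
      case True
      then show thesis using xy that[of 1] by simp
    next
      case False
      then show thesis using xy that[of "x / y"] by (simp add: norm_divide)
    qed
    have "(f \<circ> (\<lambda>w. c * w)) holomorphic_on UNIV"
      by (rule holomorphic_on_compose_gen[OF _ f(1)]) (auto intro!: holomorphic_intros)
    moreover have "norm ((f \<circ> (\<lambda>w. c * w)) w) \<le> \<omega> (norm w)" for w
      using f(2)[rule_format, of "c * w"] c(1) by (simp add: norm_mult)
    ultimately show "\<exists>h. norm (f x) = norm (h y) \<and> h holomorphic_on UNIV \<and>
        (\<forall>w. norm (h w) \<le> \<omega> (norm w))"
      using c(2) by (intro exI[of _ "f \<circ> (\<lambda>w. c * w)"]) simp
  qed
  have "norm (complex_of_real (norm z)) = norm z" by simp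
  from sub[OF this] sub[OF this[symmetric]] show ?thesis
    unfolding assoc_weight_def by (simp add: subset_antisym)
qed

section \<open>Lebesgue and Fock spaces\<close>

definition Lq_space :: "ennreal \<Rightarrow> (complex ^ 'n \<Rightarrow> real) set" where
  "Lq_space q = {F \<in> borel_measurable lebesgue.
     if q = \<infinity> then (\<exists>C. AE z in lebesgue. \<bar>F z\<bar> \<le> C)
     else (\<integral>\<^sup>+ z. ennreal (\<bar>F z\<bar> powr enn2real q) \<partial>lebesgue) < \<infinity>}"

text \<open>
  The \<open>q\<close>-th power of the Fock norm for finite exponent \<open>q\<close>, as an extended nonnegative real.
\<close>

definition fock_integral :: "real \<Rightarrow> real \<Rightarrow> (complex ^ 'n \<Rightarrow> complex) \<Rightarrow> ennreal" where
  "fock_integral \<alpha> q f =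
     ennreal ((\<alpha> * q / (2 * pi)) ^ CARD('n)) *
     (\<integral>\<^sup>+ z. ennreal (norm (f z) powr q * exp (- (\<alpha> * q / 2) * (norm z)\<^sup>2)) \<partial>lebesgue)"

definition fock_space :: "real \<Rightarrow> ennreal \<Rightarrow> (complex ^ 'n \<Rightarrow> complex) set" where
  "fock_space \<alpha> q = {f. entire f \<and>
     (if q = \<infinity> then bdd_above (range (\<lambda>z. norm (f z) * exp (- (\<alpha> / 2) * (norm z)\<^sup>2)))
      else fock_integral \<alpha> (enn2real q) f < \<infinity>)}"

definition fock_norm :: "real \<Rightarrow> ennreal \<Rightarrow> (complex ^ 'n \<Rightarrow> complex) \<Rightarrow> real" where
  "fock_norm \<alpha> q f =
     (if q = \<infinity> then (SUP z. norm (f z) * exp (- (\<alpha> / 2) * (norm z)\<^sup>2))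
      else enn2real (fock_integral \<alpha> (enn2real q) f) powr (1 / enn2real q))"

section \<open>Volterra type operators and boundedness\<close>

text \<open>
  The integrand is bounded on \<open>{0<..1}\<close> for entire data, as the radial derivative vanishes at
  the origin; its value at \<open>t = 0\<close> (where division by zero yields \<open>0\<close>) does not affect the integral.
\<close>

definition volterra ::
  "(complex ^ 'n \<Rightarrow> complex) \<Rightarrow> (complex ^ 'n \<Rightarrow> complex ^ 'n) \<Rightarrow>
   (complex ^ 'n \<Rightarrow> complex) \<Rightarrow> complex ^ 'n \<Rightarrow> complex" where
  "volterra g \<phi> f z =
     integral {0..1} (\<lambda>t. f (\<phi> (t *\<^sub>R z)) * radial_deriv g (t *\<^sub>R z) / complex_of_real t)"

text \<open>
  A bounded linear operator between function spaces with explicitly given (quasi-)norms.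
  For exponents \<open>q < 1\<close> the Fock space is only quasi-normed.
\<close>

definition bounded_operator ::
  "('a \<Rightarrow> complex) set \<Rightarrow> (('a \<Rightarrow> complex) \<Rightarrow> real) \<Rightarrow>
   ('b \<Rightarrow> complex) set \<Rightarrow> (('b \<Rightarrow> complex) \<Rightarrow> real) \<Rightarrow>
   (('a \<Rightarrow> complex) \<Rightarrow> ('b \<Rightarrow> complex)) \<Rightarrow> bool" where
  "bounded_operator X normX Y normY T \<longleftrightarrow>
     (\<forall>f\<in>X. T f \<in> Y) \<and>
     (\<forall>f\<in>X. \<forall>h\<in>X. \<forall>a b. T (\<lambda>z. a * f z + b * h z) = (\<lambda>z. a * T f z + b * T h z)) \<and>
     (\<exists>C. \<forall>f\<in>X. normY (T f) \<le> C * normX f)"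

end

theory Submission imports Defs "HOL-Complex_Analysis.Complex_Analysis" begin

text \<open>
  Put \<open>F = V f\<close> and \<open>G z = f (\<phi> z) \<cdot> \<R> g z\<close>. Then \<open>\<R> F = G\<close>, and \<open>F\<close> is in the Fock space iff
  \<open>G z (1 + |z|)\<^sup>-\<^sup>2 exp (- \<alpha> |z|\<^sup>2 / 2)\<close> is in \<open>L\<^sup>q\<close>, with comparable norms. Both directions use that
  \<open>1 / (1 + |z|)\<close> is the scale on which the Gaussian weight is constant up to a factor: Cauchy's
  estimate on such balls bounds \<open>\<R> F\<close>, and integrating \<open>G\<close> along rays gives back \<open>F\<close>.
  Since \<open>|f|\<close> is at most the norm of \<open>f\<close> times the associated weight, (ii) implies (i).

  For the converse a family of test functions is needed whose averages dominate the associated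
  weight. Among the monomials lying just below \<open>\<omega>\<close> a sparse set has a bounded sum relative to \<open>\<omega>\<close>
  and still a maximum comparable with the associated weight. Replacing \<open>t\<^sup>n\<close> by the functions
  \<open>\<langle>z, x\<rangle>\<^sup>n\<close>, with \<open>x\<close> in a maximal separated subset of the sphere at the scale \<open>n\<^sup>-\<^sup>1\<^sup>/\<^sup>2\<close>, gives
  functions of which all partial sums are bounded by \<open>\<omega>\<close>, and an average over partial sums
  replaces Khinchine's inequality.
\<close>

section \<open>Radial weights and monomials\<close>

text \<open>Beyond superpolynomial growth nothing regular is known of \<omega>, so every comparison
  with monomials has to carry an absolute constant. Cauchy's estimates bound each Taylor coefficient
  by that of a tangent monomial, but arbitrarily many terms may be comparable at one radius. The
  power series is therefore summed only where consecutive tangency radii leave room; elsewhere the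
  maximum principle for \<open>f w / w ^ n\<close> takes over. Exponents below 1 rule out
  Minkowski's inequality for the integral along a ray. The ray is replaced by the point where
  \<open>G\<close>, weighted with half of the Gaussian exponent, is largest, and a mean value over a
  small ball there brings back an integral. The other half of the exponent pays for all
  \<open>z\<close> whose ray meets that ball, which is the role of \<open>shadow\<close>. The lower
  bound for averages of subsums is elementary: of two subsums that differ in one term, one is at
  least half of that term.\<close>

lemma weight_function_pos: "weight_function \<omega> \<Longrightarrow> 0 \<le> t \<Longrightarrow> 0 < \<omega> t"
  by (auto simp: weight_function_def)

lemma weight_function_mono: "weight_function \<omega> \<Longrightarrow> 0 \<le> s \<Longrightarrow> s \<le> t \<Longrightarrow> \<omega> s \<le> \<omega> t"
  by (auto simp: weight_function_def mono_on_def)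

lemma weight_function_superpoly:
  "weight_function \<omega> \<Longrightarrow> filterlim (\<lambda>t. \<omega> t / t ^ k) at_top at_top"
  by (auto simp: weight_function_def)

text \<open>Minimise \<omega> t / t ^ n over t > 0: \<open>u\<close> is the minimum and
  \<open>r\<close> a point where it is attained. Superpolynomial growth makes the quotient large at
  infinity, and \<omega> 0 > 0 makes it large near 0. For n = 0 monotonicity puts the contact point
  at 0.\<close>

lemma tangent_monomial_exists:
  assumes w: "weight_function \<omega>"
  shows "\<exists>u r. 0 < u \<and> 0 \<le> r \<and> (n = 0 \<longrightarrow> r = 0) \<and> (n > 0 \<longrightarrow> r > 0) \<and>
           (\<forall>t\<ge>0. u * t ^ n \<le> \<omega> t) \<and> u * r ^ n = \<omega> r"
proof (cases "n = 0")
  case True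
  then show ?thesis
    using weight_function_pos[OF w, of 0] weight_function_mono[OF w, of 0]
    by (intro exI[of _ "\<omega> 0"] exI[of _ 0]) auto
next
  case False
  define F where "F = (\<lambda>t. \<omega> t / t ^ n)"
  have w1: "\<omega> 1 > 0" "\<omega> 0 > 0" using weight_function_pos[OF w] by auto
  have "eventually (\<lambda>t. F t \<ge> \<omega> 1) at_top"
    using weight_function_superpoly[OF w, of n] by (auto simp: filterlim_at_top F_def)
  then obtain B where B: "\<And>t. t \<ge> B \<Longrightarrow> F t \<ge> \<omega> 1" by (auto simp: eventually_at_top_linorder)
  \<comment> \<open>Outside \<open>{a..b}\<close> the quotient is at least \<omega> 1, its value at
    the point 1 of the interval, so a minimum over the interval is global. The choice of
    \<open>a\<close> works because t ^ n * \<omega> 1 \<le> t * \<omega> 1 \<le> \<omega> 0 \<le>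
    \<omega> t for 0 < t < a.\<close>
  define b where "b = max B 1"
  define a where "a = min 1 (\<omega> 0 / \<omega> 1)"
  have a: "0 < a" "a \<le> 1" "a * \<omega> 1 \<le> \<omega> 0" using w1 by (auto simp: a_def min_def field_simps)
  have b: "1 \<le> b" by (auto simp: b_def)
  have small: "F t \<ge> \<omega> 1" if "0 < t" "t < a" for t
  proof -
    have "t ^ n \<le> t" using that a False by (simp add: power_le_one_iff power_decreasing[of 1 n t, simplified])
    then have "\<omega> 1 * t ^ n \<le> \<omega> 1 * a" using w1 that by (intro mult_left_mono) auto
    also have "\<dots> \<le> \<omega> 0" using a by (simp add: mult.commute)
    also have "\<dots> \<le> \<omega> t" using weight_function_mono[OF w] that by simp
    finally show ?thesis using that by (simp add: F_def field_simps)
  qed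
  have "continuous_on {a..b} F" unfolding F_def
    using w a by (auto simp: weight_function_def intro!: continuous_intros intro: continuous_on_subset)
  then obtain r where r: "r \<in> {a..b}" "\<And>t. t \<in> {a..b} \<Longrightarrow> F r \<le> F t"
    using continuous_attains_inf[of "{a..b}" F] a b by auto
  have "F r \<le> F 1" using r a b by auto
  then have F1: "F r \<le> \<omega> 1" by (simp add: F_def)
  have min: "F r \<le> F t" if "t > 0" for t
  proof -
    consider "t < a" | "t \<in> {a..b}" | "t > b" by fastforce
    then show ?thesis
    proof cases
      case 1 then show ?thesis using small[of t] F1 that by simp
    next
      case 2 then show ?thesis using r by simp
    next
      case 3 then show ?thesis using B[of t] F1 by (simp add: b_def)
    qed
  qed
  have rpos: "r > 0" using r a by auto
  have "F r * t ^ n \<le> \<omega> t" if "t \<ge> 0" for t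
  proof (cases "t = 0")
    case True then show ?thesis using False w1 by (simp add: zero_power)
  next
    case nz: False then show ?thesis using min[of t] that by (simp add: F_def field_simps)
  qed
  moreover have "F r > 0" using rpos weight_function_pos[OF w, of r] by (simp add: F_def)
  ultimately show ?thesis using rpos False by (intro exI[of _ "F r"] exI[of _ r]) (auto simp: F_def)
qed

text \<open>In logarithmic coordinates the monomials are lines of slope n supporting the graph of
  \<omega> from below, and \<open>r n\<close> is one chosen abscissa of contact. Thus
  \<open>u\<close> is a discrete Legendre transform of \<omega>, which itself need not be
  logarithmically convex.\<close>

locale tangent_monomials =
  fixes \<omega> :: "real \<Rightarrow> real" and u r :: "nat \<Rightarrow> real"
  assumes w: "weight_function \<omega>"
    and u_pos: "u n > 0"
    and r0: "r 0 = 0"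
    and r_pos: "n > 0 \<Longrightarrow> r n > 0"
    and below: "t \<ge> 0 \<Longrightarrow> u n * t ^ n \<le> \<omega> t"
    and touch: "u n * r n ^ n = \<omega> (r n)"
begin

lemma r_nonneg: "r n \<ge> 0"
  using r0 r_pos[of n] by (cases "n = 0") auto

lemma monomial_nonneg: "t \<ge> 0 \<Longrightarrow> 0 \<le> u n * t ^ n"
  using u_pos[of n] by simp

text \<open>Steeper supporting lines touch further to the right: comparing the two monomials at both
  contact points squeezes \<open>u n\<close> between \<open>u m * r n ^ k\<close> and
  \<open>u m * r m ^ k\<close>.\<close>

lemma mono_step:
  assumes "n \<le> m"
  shows "r n \<le> r m"
proof (cases "n = m \<or> n = 0")
  case True then show ?thesis using r0 r_nonneg by auto
next
  case False
  then have nm: "n < m" "n > 0" "m > 0" using assms by auto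
  define k where "k = m - n"
  have m: "m = n + k" "k > 0" using nm by (auto simp: k_def)
  have rn: "r n > 0" and rm: "r m > 0" using r_pos nm by auto
  have "u n * r m ^ n \<le> u m * r m ^ m" using below[of "r m" n] touch[of m] rm by simp
  then have 1: "u n \<le> u m * r m ^ k" using rm by (simp add: m(1) power_add)
  have "u m * r n ^ m \<le> u n * r n ^ n" using below[of "r n" m] touch[of n] rn by simp
  then have 2: "u m * r n ^ k \<le> u n" using rn by (simp add: m(1) power_add)
  have "u m * r n ^ k \<le> u m * r m ^ k" using 1 2 by simp
  then have "r n ^ k \<le> r m ^ k" using u_pos[of m] by simp
  then show ?thesis using power_le_imp_le_base[of "r n" "k - 1" "r m"] rm m(2) by simp
qed

text \<open>The quotient of two monomials is monotone, so a comparison at one point propagates.\<close>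

lemma propagate_right:
  assumes "n \<le> m" "0 \<le> s" "s \<le> t" "0 \<le> c" "c * (u n * s ^ n) \<le> u m * s ^ m" "s > 0 \<or> n = 0"
  shows "c * (u n * t ^ n) \<le> u m * t ^ m"
proof -
  define k where "k = m - n"
  have m: "m = n + k" using assms by (auto simp: k_def)
  have "s ^ n > 0" using assms(6) by auto
  then have "c * u n \<le> u m * s ^ k" using assms(5) by (simp add: m power_add)
  also have "\<dots> \<le> u m * t ^ k" using assms u_pos[of m] by (intro mult_left_mono power_mono) auto
  finally have "(c * u n) * t ^ n \<le> (u m * t ^ k) * t ^ n" using assms by (intro mult_right_mono) auto
  then show ?thesis by (simp add: m power_add mult_ac)
qed

lemma propagate_left:
  assumes "n \<le> m" "0 \<le> t" "t \<le> s" "0 \<le> c" "c * (u m * s ^ m) \<le> u n * s ^ n"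
  shows "c * (u m * t ^ m) \<le> u n * t ^ n"
proof (cases "s = 0")
  case True then show ?thesis using assms by simp
next
  case False
  define k where "k = m - n"
  have m: "m = n + k" using assms by (auto simp: k_def)
  have "s ^ n > 0" using False assms by auto
  then have *: "c * u m * s ^ k \<le> u n" using assms(5) by (simp add: m power_add)
  have "c * u m * t ^ k \<le> c * u m * s ^ k"
    using assms u_pos[of m] by (intro mult_left_mono power_mono) auto
  also note *
  finally have "(c * u m * t ^ k) * t ^ n \<le> u n * t ^ n" using assms by (intro mult_right_mono) auto
  then show ?thesis by (simp add: m power_add mult_ac)
qed

text \<open>At its own contact point a monomial equals \<omega> and so exceeds all others. Against
  lower degrees this persists to the right, and against higher degrees, in
  \<open>dominate_left\<close>, to the left.\<close>

lemma dominate_right: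
  assumes "n \<le> m" "r m \<le> t"
  shows "u n * t ^ n \<le> u m * t ^ m"
  using propagate_right[of n m "r m" t 1] assms below[of "r m" n] touch[of m] r_nonneg[of m] r_pos[of m]
  by (cases "m = 0") auto

lemma dominate_left:
  assumes "n \<le> m" "0 \<le> t" "t \<le> r n"
  shows "u m * t ^ m \<le> u n * t ^ n"
  using propagate_left[of n m t "r n" 1] assms below[of "r n" m] touch[of n] r_nonneg[of n] by auto

text \<open>If all contact points were at most R, touching would force u n * R ^ n \<ge> \<omega> 0,
  and at 2 * R the monomials would grow like 2 ^ n although \<omega> (2 * R) bounds them.\<close>

lemma r_tendsto: "\<exists>n. B < r n"
proof (rule ccontr)
  assume "\<nexists>n. B < r n"
  then have le: "\<And>n. r n \<le> B" by (auto simp: not_less)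
  define R where "R = max B 1"
  have R: "R \<ge> 1" "\<And>n. r n \<le> R" using le by (auto simp: R_def max.coboundedI1)
  have "\<omega> 0 * 2 ^ n \<le> \<omega> (2 * R)" for n
  proof -
    have "\<omega> 0 * 2 ^ n \<le> \<omega> (r n) * 2 ^ n"
      using weight_function_mono[OF w, of 0 "r n"] r_nonneg[of n] by simp
    also have "\<dots> = u n * r n ^ n * 2 ^ n" using touch by simp
    also have "\<dots> \<le> u n * R ^ n * 2 ^ n"
      using R r_nonneg[of n] u_pos[of n] by (intro mult_right_mono mult_left_mono power_mono) auto
    also have "\<dots> = u n * (2 * R) ^ n" by (simp add: power_mult_distrib)
    also have "\<dots> \<le> \<omega> (2 * R)" using R by (intro below) auto
    finally show ?thesis .
  qed
  then have "2 ^ n \<le> \<omega> (2 * R) / \<omega> 0" for n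
    using weight_function_pos[OF w, of 0] by (simp add: field_simps)
  moreover obtain n where "\<omega> (2 * R) / \<omega> 0 < 2 ^ n"
    using real_arch_pow[of 2 "\<omega> (2 * R) / \<omega> 0"] by auto
  ultimately show False by (meson not_less)
qed

text \<open>Stated for a subsequence because it serves both the full sequence of degrees and the
  sparse one \<open>sel\<close>. Since r 0 = 0, starting at degree 0 leaves no gap near the
  origin.\<close>

lemma r_bracket:
  fixes \<sigma> :: "nat \<Rightarrow> nat"
  assumes "strict_mono \<sigma>" "\<sigma> 0 = 0" "t \<ge> 0"
  obtains j where "r (\<sigma> j) \<le> t" "t \<le> r (\<sigma> (Suc j))"
proof -
  obtain n where n: "t < r n" using r_tendsto by blast
  have "r n \<le> r (\<sigma> n)" using assms(1) by (intro mono_step) (rule strict_mono_imp_increasing)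
  then have ex: "t < r (\<sigma> n)" using n by simp
  define m where "m = (LEAST m. t < r (\<sigma> m))"
  have m: "t < r (\<sigma> m)" unfolding m_def using ex by (rule LeastI)
  then have "m \<noteq> 0" using assms r0 by (metis not_less)
  then obtain j where j: "m = Suc j" by (cases m) auto
  have "\<not> t < r (\<sigma> j)" using not_less_Least[of j "\<lambda>m. t < r (\<sigma> m)"] j m_def by auto
  then show thesis using that[of j] m j by auto
qed

subsection \<open>The associated weight is comparable with the largest monomial\<close>

context
  fixes f :: "complex \<Rightarrow> complex"
  assumes hol: "f holomorphic_on UNIV" and bd: "\<And>w. norm (f w) \<le> \<omega> (norm w)"
begin

text \<open>Cauchy's inequality at the radius \<open>r n\<close>, where \<omega> equals the monomial
  and the powers of the radius cancel.\<close>

lemma coeff_bound: "norm ((deriv ^^ n) f 0 / fact n) \<le> u n"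
proof (cases "n = 0")
  case True
  then show ?thesis using bd[of 0] touch[of 0] r0 by simp
next
  case False
  then have r: "r n > 0" using r_pos by simp
  have "norm ((deriv ^^ n) f 0) \<le> fact n * \<omega> (r n) / r n ^ n"
    by (rule Cauchy_inequality)
       (use hol bd r in \<open>auto intro!: holomorphic_on_imp_continuous_on intro: holomorphic_on_subset\<close>,
         metis bd)
  also have "\<omega> (r n) = u n * r n ^ n" using touch by simp
  finally show ?thesis using r by (simp add: norm_divide field_simps)
qed

text \<open>At distance a factor 2 from both neighbouring contact points the terms of the power
  series decay geometrically with ratio 1/2, downwards from degree n and upwards from degree Suc n.
  Each half sums to at most twice its leading term.\<close>

lemma norm_f_le_split:
  assumes "norm z = t" "2 * r n \<le> t" "2 * t \<le> r (Suc n)" "t > 0"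
  shows "norm (f z) \<le> 2 * (u n * t ^ n) + 2 * (u (Suc n) * t ^ Suc n)"
proof -
  define a where "a m = (deriv ^^ m) f 0 / fact m" for m
  have "((\<lambda>m. a m * (z - 0) ^ m) sums f z)"
    unfolding a_def
    by (rule holomorphic_power_series[of f 0 "norm z + 1"])
       (use hol in \<open>auto intro: holomorphic_on_subset\<close>)
  then have s: "(\<lambda>m. a m * z ^ m) sums f z" by simp
  define c where "c m = (if m \<le> n then u n * t ^ n * (1/2) ^ (n - m)
                     else u (Suc n) * t ^ Suc n * (1/2) ^ (m - Suc n))" for m
  have tb: "t \<ge> 0" using assms by simp
  have tb2: "norm (a m * z ^ m) \<le> c m" for m
  proof -
    have 1: "norm (a m * z ^ m) \<le> u m * t ^ m"
      using coeff_bound[of m] assms tb unfolding a_def[symmetric] norm_mult norm_power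
      by (auto intro!: mult_right_mono)
    show ?thesis
    proof (cases "m \<le> n")
      case True
      show ?thesis
      proof (cases "m = n")
        case True then show ?thesis using 1 by (simp add: c_def)
      next
        case False
        then have rn: "r n > 0" using True r_pos[of n] by auto
        \<comment> \<open>At \<open>r n\<close> the term of degree n equals \<omega> and dominates
          the one of degree m; doubling the radius gains a factor 2 for each of the n - m missing
          degrees.\<close>
        have "u m * (2 * r n) ^ m \<le> 2 ^ m * (u n * r n ^ n)"
          using below[of "r n" m] touch[of n] r_nonneg[of n] by (simp add: power_mult_distrib)
        also have "\<dots> = (1/2) ^ (n - m) * (u n * (2 * r n) ^ n)"
        proof -
          have "(2::real) ^ n = 2 ^ m * 2 ^ (n - m)" using True by (simp flip: power_add)
          then show ?thesis by (simp add: power_mult_distrib power_divide)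
        qed
        finally have "2 ^ (n - m) * (u m * (2 * r n) ^ m) \<le> u n * (2 * r n) ^ n"
          by (simp add: power_divide field_simps)
        then have "2 ^ (n - m) * (u m * t ^ m) \<le> u n * t ^ n"
          using propagate_right[of m n "2 * r n" t "2 ^ (n - m)"] True rn assms by auto
        then have "u m * t ^ m \<le> c m" using True by (simp add: c_def power_divide field_simps)
        then show ?thesis using 1 by simp
      qed
    next
      case False
      \<comment> \<open>The mirror image: at the larger contact radius degree Suc n dominates, and
        halving the radius costs a factor 2 per excess degree.\<close>
      define R where "R = r (Suc n)"
      define N where "N = Suc n"
      have R: "R > 0" using r_pos[of "Suc n"] by (simp add: R_def)
      have N: "N \<le> m" using False by (simp add: N_def)
      have "u m * R ^ m \<le> u N * R ^ N"
        using below[of R m] touch[of N] R by (simp add: R_def N_def)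
      then have "(1/2) ^ m * (u m * R ^ m) \<le> (1/2) ^ m * (u N * R ^ N)" by (intro mult_left_mono) auto
      also have "\<dots> = (1/2) ^ (m - N) * ((1/2) ^ N * (u N * R ^ N))"
        using N by (simp flip: power_add mult.assoc)
      finally have "u m * (R/2) ^ m \<le> (1/2) ^ (m - N) * (u N * (R/2) ^ N)"
        by (simp add: power_divide field_simps)
      then have "2 ^ (m - N) * (u m * (R/2) ^ m) \<le> u N * (R/2) ^ N"
        by (simp add: power_divide field_simps)
      then have "2 ^ (m - N) * (u m * t ^ m) \<le> u N * t ^ N"
        using propagate_left[of N m t "R/2" "2 ^ (m - N)"] N tb assms by (auto simp: R_def)
      then have "u m * t ^ m \<le> c m" using False by (simp add: c_def N_def power_divide field_simps)
      then show ?thesis using 1 by simp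
    qed
  qed
  have "c sums (2 * (u (Suc n) * t ^ Suc n) + (\<Sum>m<Suc n. c m))"
  proof -
    have "(\<lambda>m. u (Suc n) * t ^ Suc n * (1/2) ^ m) sums (u (Suc n) * t ^ Suc n * (1 / (1 - 1/2)))"
      by (intro sums_mult geometric_sums) auto
    moreover have "c (m + Suc n) = u (Suc n) * t ^ Suc n * (1/2) ^ m" for m by (simp add: c_def)
    ultimately have "(\<lambda>m. c (m + Suc n)) sums (2 * (u (Suc n) * t ^ Suc n))"
      by (simp add: mult_ac)
    then show ?thesis by (subst (asm) sums_iff_shift) simp
  qed
  moreover have "(\<Sum>m<Suc n. c m) \<le> 2 * (u n * t ^ n)"
  proof -
    have "(\<Sum>m<Suc n. c m) = (\<Sum>m<Suc n. u n * t ^ n * (1/2) ^ (n - m))"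
      by (intro sum.cong) (auto simp: c_def)
    also have "\<dots> = u n * t ^ n * (\<Sum>m<Suc n. (1/2) ^ (n - m))" by (rule sum_distrib_left[symmetric])
    also have "(\<Sum>m<Suc n. (1/2::real) ^ (n - m)) = (\<Sum>m<Suc n. (1/2) ^ m)"
      using sum.nat_diff_reindex[of "\<lambda>m. (1/2::real) ^ m" "Suc n"] by simp
    also have "\<dots> = 2 - 2 * (1/2) ^ Suc n" by (subst sum_gp_strict) (auto simp: field_simps)
    also have "u n * t ^ n * (2 - 2 * (1/2) ^ Suc n) \<le> u n * t ^ n * 2"
      using monomial_nonneg[OF tb, of n] by (intro mult_left_mono) auto
    finally show ?thesis by simp
  qed
  moreover have "norm (f z) \<le> suminf c"
  proof -
    have "summable c" using calculation(1) sums_summable by blast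
    then have "norm (\<Sum>m. a m * z ^ m) \<le> suminf c" using tb2 using norm_suminf_le[of "\<lambda>m. a m * z ^ m" c] by blast
    then show ?thesis using s sums_unique by metis
  qed
  ultimately show ?thesis using sums_unique by fastforce
qed

text \<open>The maximum principle for \<open>f w / w ^ n\<close>, which is holomorphic on an annulus
  avoiding 0. It covers the radii close to a contact point, where no geometric decay of the power
  series is available.\<close>

lemma norm_f_le_annulus:
  assumes "0 < a" "a \<le> b" "a \<le> norm z" "norm z \<le> b"
    and A: "\<And>w. norm w = a \<Longrightarrow> norm (f w) \<le> B * a ^ n"
    and B: "\<And>w. norm w = b \<Longrightarrow> norm (f w) \<le> B * b ^ n"
  shows "norm (f z) \<le> B * norm z ^ n"
proof -
  define S where "S = {w::complex. a \<le> norm w \<and> norm w \<le> b}"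
  have cl: "closed S" unfolding S_def
    by (intro closed_Collect_conj closed_Collect_le continuous_intros)
  have nz: "w \<noteq> 0" if "w \<in> S" for w using that assms by (auto simp: S_def)
  have hS: "(\<lambda>w. f w / w ^ n) holomorphic_on S"
    using nz hol by (auto intro!: holomorphic_intros intro: holomorphic_on_subset)
  have "norm (f z / z ^ n) \<le> B"
  proof (rule maximum_modulus_frontier[where S = S and f = "\<lambda>w. f w / w ^ n" and \<xi> = z])
    show "(\<lambda>w. f w / w ^ n) holomorphic_on interior S"
      by (rule holomorphic_on_subset[OF hS interior_subset])
    show "continuous_on (closure S) (\<lambda>w. f w / w ^ n)"
      using hS cl by (simp add: holomorphic_on_imp_continuous_on)
    show "bounded S" by (rule bounded_subset[of "cball 0 b"]) (auto simp: S_def)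
    show "z \<in> S" using assms by (simp add: S_def)
    fix w assume w: "w \<in> frontier S"
    have "{w. a < norm w \<and> norm w < b} \<subseteq> interior S"
      by (rule interior_maximal)
         (auto simp: S_def intro!: open_Collect_conj open_Collect_less continuous_intros)
    then have "w \<in> S" "\<not> (a < norm w \<and> norm w < b)"
      using w cl by (auto simp: frontier_def)
    then have "norm w = a \<or> norm w = b" by (auto simp: S_def)
    then have "norm (f w) \<le> B * norm w ^ n" using A B by auto
    then show "norm (f w / w ^ n) \<le> B"
      using nz[OF \<open>w \<in> S\<close>] by (simp add: norm_divide norm_power field_simps)
  qed
  moreover have "z \<noteq> 0" using assms by auto
  ultimately show ?thesis by (simp add: norm_divide norm_power field_simps)
qed

text \<open>Between consecutive contact radii a and b two competing monomials are enough, of degrees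
  n and Suc n. The constant 6 = 2 + 2 * 2 arises at radius 2 * a (and likewise at b / 2): there
  \<open>norm_f_le_split\<close> gives twice the sum of both monomials, and one of them is at most
  twice the other.\<close>

lemma norm_f_le_monomial:
  "\<exists>n. norm (f z) \<le> 6 * (u n * norm z ^ n)"
proof -
  define t where "t = norm z"
  have t0: "t \<ge> 0" by (simp add: t_def)
  obtain n where n: "r n \<le> t" "t \<le> r (Suc n)"
    using r_bracket[of "\<lambda>n. n" t] t0 by (auto simp: strict_mono_def)
  define a b where "a = r n" and "b = r (Suc n)"
  have b: "b > 0" using r_pos by (simp add: b_def)
  have a: "a \<ge> 0" using r_nonneg by (simp add: a_def)
  have ab: "a \<le> t" "t \<le> b" using n by (auto simp: a_def b_def)
  have fa: "norm (f w) \<le> u n * a ^ n" if "norm w = a" for w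
    using bd[of w] that touch[of n] by (simp add: a_def)
  have fb: "norm (f w) \<le> u (Suc n) * b ^ Suc n" if "norm w = b" for w
    using bd[of w] that touch[of "Suc n"] by (simp add: b_def)
  have u: "u n > 0" "u (Suc n) > 0" using u_pos by auto
  \<comment> \<open>Comparison at the two contact radii shows that the quotient of the coefficients,
    u n / u (Suc n), lies between a and b.\<close>
  have ua: "u (Suc n) * a \<le> u n" if "a > 0"
  proof -
    have "u (Suc n) * a ^ Suc n \<le> u n * a ^ n" using below[OF a, of "Suc n"] touch[of n] by (simp add: a_def)
    then show ?thesis using that by simp
  qed
  have ub: "u n \<le> u (Suc n) * b"
  proof -
    have "u n * b ^ n \<le> u (Suc n) * b ^ Suc n"
      using below[of b n] b touch[of "Suc n"] by (simp add: b_def)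
    then show ?thesis using b by simp
  qed
  have mid_bd: "norm (f w) \<le> 2 * (u n * s ^ n) + 2 * (u (Suc n) * s ^ Suc n)"
    if "norm w = s" "2 * a \<le> s" "2 * s \<le> b" "s > 0" for w s
    using norm_f_le_split[of w s n] that by (simp add: a_def b_def)
  \<comment> \<open>If b \<le> 4 * a, the maximum principle works on the whole annulus. Otherwise 2
    * a and b / 2 both lie in the range of \<open>mid_bd\<close>, which supplies the inner boundary
    value for \<open>right\<close> and the outer one for \<open>left\<close>.\<close>
  consider (zero) "t = 0" | (narrow) "t > 0" "b \<le> 4 * a" | (left) "4 * a < b" "t \<le> 2 * a" "a > 0"
    | (mid) "t > 0" "4 * a < b" "2 * a \<le> t" "2 * t \<le> b"
    | (right) "t > 0" "4 * a < b" "b \<le> 2 * t"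
    using a ab b t0 by (smt (verit))
  then show ?thesis
  proof cases
    case zero
    then show ?thesis using bd[of z] touch[of 0] r0 monomial_nonneg[of 0 0]
      by (intro exI[of _ 0]) (auto simp: t_def)
  next
    case narrow
    have a0: "a > 0" using narrow b by auto
    have "norm (f z) \<le> (4 * u n) * norm z ^ n"
    proof (rule norm_f_le_annulus[of a b])
      show "norm (f w) \<le> 4 * u n * a ^ n" if "norm w = a" for w
        using fa[OF that] monomial_nonneg[OF a, of n] by simp
      have "u (Suc n) * b \<le> 4 * (u (Suc n) * a)" using narrow u by simp
      also have "\<dots> \<le> 4 * u n" using ua[OF a0] by simp
      finally have "u (Suc n) * b * b ^ n \<le> 4 * u n * b ^ n" using b by (intro mult_right_mono) auto
      then show "norm (f w) \<le> 4 * u n * b ^ n" if "norm w = b" for w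
        using fb[OF that] by (simp add: mult_ac)
    qed (use a0 ab in \<open>auto simp: t_def\<close>)
    then show ?thesis using monomial_nonneg[of "norm z" n] by (intro exI[of _ n]) simp
  next
    case left
    have "norm (f z) \<le> (6 * u n) * norm z ^ n"
    proof (rule norm_f_le_annulus[of a "2 * a"])
      show "norm (f w) \<le> 6 * u n * a ^ n" if "norm w = a" for w
        using fa[OF that] monomial_nonneg[OF a, of n] by simp
      show "norm (f w) \<le> 6 * u n * (2 * a) ^ n" if "norm w = 2 * a" for w
      proof -
        have "norm (f w) \<le> 2 * (u n * (2 * a) ^ n) + 2 * (u (Suc n) * (2 * a) ^ Suc n)"
          using mid_bd[OF that] left by simp
        also have "u (Suc n) * (2 * a) ^ Suc n = 2 * (u (Suc n) * a) * (2 * a) ^ n" by simp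
        also have "\<dots> \<le> 2 * u n * (2 * a) ^ n" using ua left by (intro mult_right_mono) auto
        finally show ?thesis by (simp add: mult_ac power_mult_distrib)
      qed
    qed (use left ab in \<open>auto simp: t_def\<close>)
    then show ?thesis by (intro exI[of _ n]) simp
  next
    case mid
    then have *: "norm (f z) \<le> 2 * (u n * t ^ n) + 2 * (u (Suc n) * t ^ Suc n)"
      by (intro mid_bd) (auto simp: t_def)
    show ?thesis
    proof (cases "u n * t ^ n \<le> u (Suc n) * t ^ Suc n")
      case True
      then show ?thesis using * monomial_nonneg[OF t0, of n] unfolding t_def[symmetric]
        by (intro exI[of _ "Suc n"]) linarith
    next
      case False
      then show ?thesis using * monomial_nonneg[OF t0, of "Suc n"] unfolding t_def[symmetric]
        by (intro exI[of _ n]) linarith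
    qed
  next
    case right
    have "norm (f z) \<le> (6 * u (Suc n)) * norm z ^ Suc n"
    proof (rule norm_f_le_annulus[of "b / 2" b])
      show "norm (f w) \<le> 6 * u (Suc n) * b ^ Suc n" if "norm w = b" for w
        using fb[OF that] monomial_nonneg[of b "Suc n"] b by simp
      show "norm (f w) \<le> 6 * u (Suc n) * (b / 2) ^ Suc n" if "norm w = b / 2" for w
      proof -
        have "norm (f w) \<le> 2 * (u n * (b / 2) ^ n) + 2 * (u (Suc n) * (b / 2) ^ Suc n)"
          using mid_bd[OF that] right b by simp
        moreover have "u n * (b / 2) ^ n \<le> (u (Suc n) * b) * (b / 2) ^ n"
          using ub b by (intro mult_right_mono) auto
        moreover have "\<dots> = 2 * (u (Suc n) * (b / 2) ^ Suc n)" by simp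
        ultimately show ?thesis by linarith
      qed
    qed (use right ab b in \<open>auto simp: t_def\<close>)
    then show ?thesis by (intro exI[of _ "Suc n"]) simp
  qed
qed

end

text \<open>An admissible function reaches more than half of the supremum, which doubles the
  constant 6 of \<open>norm_f_le_monomial\<close>.\<close>

lemma assoc_weight_le_monomial:
  assumes "t \<ge> 0"
  shows "\<exists>n. assoc_weight \<omega> t \<le> 12 * (u n * t ^ n)"
proof -
  let ?S = "{norm (f (complex_of_real t)) | f. f holomorphic_on UNIV \<and> (\<forall>w. norm (f w) \<le> \<omega> (norm w))}"
  have zero: "0 \<in> ?S"
    using weight_function_pos[OF w] by (intro CollectI exI[of _ "\<lambda>_. 0"]) (auto intro: less_imp_le)
  \<comment> \<open>The admissible constant \<open>u 0\<close> makes the supremum positive, so that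
    half of it is strictly smaller.\<close>
  have u0: "u 0 \<in> ?S"
    using below[of _ 0] u_pos[of 0] by (intro CollectI exI[of _ "\<lambda>_. of_real (u 0)"]) auto
  have "bdd_above ?S" using assms by (intro bdd_aboveI[of _ "\<omega> t"]) (auto, metis abs_of_nonneg norm_of_real)
  then have pos: "assoc_weight \<omega> t > 0"
    using cSup_upper[OF u0] u_pos[of 0] unfolding assoc_weight_def by linarith
  then have "assoc_weight \<omega> t / 2 < Sup ?S" unfolding assoc_weight_def by linarith
  then obtain x where x: "x \<in> ?S" "assoc_weight \<omega> t / 2 < x" using zero less_cSupE[of _ ?S] by (metis (no_types, lifting) empty_iff)
  then obtain f where f: "f holomorphic_on UNIV" "\<And>w. norm (f w) \<le> \<omega> (norm w)"
    "x = norm (f (of_real t))" by auto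
  obtain n where "norm (f (of_real t)) \<le> 6 * (u n * norm (of_real t :: complex) ^ n)"
    using norm_f_le_monomial[OF f(1,2)] by blast
  then show ?thesis using x f assms by (intro exI[of _ n]) auto
qed

subsection \<open>Selection of well separated monomials\<close>

text \<open>A lead by a factor 2 at both contact points persists, by monotonicity of quotients, on
  the outer side of each. Along a chain of separated degrees this becomes geometric decay.\<close>

definition separated :: "nat \<Rightarrow> nat \<Rightarrow> bool" where
  "separated n m \<longleftrightarrow> n < m \<and> 2 * (u n * r m ^ n) \<le> u m * r m ^ m \<and>
     2 * (u m * r n ^ m) \<le> u n * r n ^ n"

text \<open>The first inequality at \<open>r m\<close> holds for large m since \<omega> beats 2 * u
  n * t ^ n and r m tends to infinity. The second holds since u m * r n ^ m \<le> \<omega> (2 * r n)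
  / 2 ^ m; for n = 0 its left side vanishes with r 0.\<close>

lemma separated_exists: "\<exists>m. separated n m"
proof -
  have "eventually (\<lambda>t. \<omega> t / t ^ n \<ge> 2 * u n) at_top"
    using weight_function_superpoly[OF w, of n] by (auto simp: filterlim_at_top)
  then obtain B where B: "\<And>t. t \<ge> B \<Longrightarrow> \<omega> t / t ^ n \<ge> 2 * u n" by (auto simp: eventually_at_top_linorder)
  obtain m0 where m0: "r m0 > max B 0" using r_tendsto by blast
  obtain k where k: "\<omega> (2 * r n) / (u n * r n ^ n) * 2 < 2 ^ k"
    using real_arch_pow[of 2] by fastforce
  define m where "m = m0 + k + n + 1"
  have rm: "r m > max B 0" using m0 mono_step[of m0 m] by (simp add: m_def)
  have "2 * (u n * r m ^ n) \<le> u m * r m ^ m"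
    using B[of "r m"] rm touch[of m] by (simp add: field_simps)
  moreover have "2 * (u m * r n ^ m) \<le> u n * r n ^ n"
  proof (cases "n = 0")
    case True
    then show ?thesis using r0 u_pos[of 0] by (simp add: m_def)
  next
    case False
    then have p: "u n * r n ^ n > 0" using u_pos[of n] r_pos[of n] by simp
    have "u m * r n ^ m * 2 ^ m \<le> \<omega> (2 * r n)"
      using below[of "2 * r n" m] r_nonneg[of n] by (simp add: power_mult_distrib mult_ac)
    then have "2 * (u m * r n ^ m) * 2 ^ m \<le> \<omega> (2 * r n) * 2" by simp
    also have "\<dots> \<le> (u n * r n ^ n) * 2 ^ k" using k p by (simp add: field_simps)
    also have "\<dots> \<le> (u n * r n ^ n) * 2 ^ m"
      using p by (intro mult_left_mono power_increasing) (auto simp: m_def)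
    finally show ?thesis by simp
  qed
  ultimately show ?thesis by (intro exI[of _ m]) (auto simp: separated_def m_def)
qed

text \<open>A greedy choice: minimality of the next degree is what controls the skipped degrees,
  none of which is separated from the previous choice.\<close>

primrec sel :: "nat \<Rightarrow> nat" where
  "sel 0 = 0"
| "sel (Suc k) = (LEAST m. separated (sel k) m)"

declare sel.simps(2) [simp del]

lemma separated_sel: "separated (sel k) (sel (Suc k))"
  using LeastI_ex[OF separated_exists] by (simp add: sel.simps(2))

lemma not_separated_below_sel: "m < sel (Suc k) \<Longrightarrow> \<not> separated (sel k) m"
  using not_less_Least[of m "separated (sel k)"] by (simp add: sel.simps(2))

lemma strict_mono_sel: "strict_mono sel"
  using separated_sel by (intro strict_mono_Suc_iff[THEN iffD2]) (auto simp: separated_def)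

text \<open>The degrees \<open>sel k\<close> alone may lose too much in the gaps. Adding the
  predecessor of each next choice repairs this, because a predecessor that differs from
  \<open>sel k\<close> is still not separated from it.\<close>

definition selected :: "nat set" where
  "selected = range sel \<union> range (\<lambda>k. sel (Suc k) - 1)"

text \<open>Only degrees n with p < n \<le> m need work. As m is not separated from p, one of the
  two inequalities fails. If it fails at \<open>r m\<close>, there \<omega> is below twice the
  monomial of p, which then covers n to the left of \<open>r m\<close>, while m covers n to the
  right. If it fails at \<open>r p\<close>, there \<omega> is below twice the monomial of m, which
  covers n to the right of \<open>r p\<close>.\<close>

lemma selected_covers:
  assumes t: "t \<ge> 0"
  shows "\<exists>s\<in>selected. u n * t ^ n \<le> 2 * (u s * t ^ s)"
proof -
  obtain j where j: "r (sel j) \<le> t" "t \<le> r (sel (Suc j))"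
    using r_bracket[OF strict_mono_sel _ t] by auto
  define p where "p = sel j"
  define m where "m = sel (Suc j) - 1"
  have pm: "p \<le> m" "m < sel (Suc j)" "Suc m = sel (Suc j)"
    using strict_mono_sel by (auto simp: p_def m_def strict_mono_Suc_iff)
       (use strict_mono_less[OF strict_mono_sel, of j "Suc j"] in linarith)+
  have inS: "p \<in> selected" "m \<in> selected" "sel (Suc j) \<in> selected"
    by (auto simp: selected_def p_def m_def)
  have enough: ?thesis if "u n * t ^ n \<le> 2 * (u s * t ^ s)" "s \<in> selected" for s using that by blast
  have nn: "u s * t ^ s \<ge> 0" for s using monomial_nonneg[OF t] .
  consider "n \<le> p" | "n \<ge> Suc m" | "p < n" "n \<le> m" by linarith
  then show ?thesis
  proof cases
    case 1
    then show ?thesis using dominate_right[of n p t] j nn[of p] inS by (intro enough[of p]) (auto simp: p_def)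
  next
    case 2
    then show ?thesis using dominate_left[of "Suc m" n t] j t nn[of "Suc m"] inS pm
      by (intro enough[of "Suc m"]) auto
  next
    case 3
    then have "\<not> separated p m" using not_separated_below_sel pm by (simp add: p_def)
    then consider (A) "u m * r m ^ m < 2 * (u p * r m ^ p)" | (B) "u p * r p ^ p < 2 * (u m * r p ^ m)"
      using 3 by (auto simp: separated_def)
    then show ?thesis
    proof cases
      case A
      show ?thesis
      proof (cases "r m \<le> t")
        case True
        then show ?thesis using dominate_right[of n m t] 3 nn[of m] inS by (intro enough[of m]) auto
      next
        case False
        have "u n * r m ^ n \<le> 2 * (u p * r m ^ p)"
          using A below[OF r_nonneg, of n m] touch[of m] by simp
        then have "(1/2) * (u n * t ^ n) \<le> u p * t ^ p"
          using False 3 t by (intro propagate_left[of p n t "r m"]) auto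
        then show ?thesis using inS by (intro enough[of p]) auto
      qed
    next
      case B
      have "u n * r p ^ n \<le> 2 * (u m * r p ^ m)"
        using B below[OF r_nonneg, of n p] touch[of p] by simp
      \<comment> \<open>At a contact point 0 nothing could be propagated; but p = 0 would make the
        right side of B vanish.\<close>
      moreover have "r p > 0 \<or> n = 0"
      proof (rule ccontr)
        assume "\<not> ?thesis"
        then have "p = 0" "r p = 0" using r_pos[of p] r_nonneg[of p] by auto
        then show False using B 3 u_pos[of 0] by (simp add: zero_power)
      qed
      ultimately have "(1/2) * (u n * t ^ n) \<le> u m * t ^ m"
        using j 3 r_nonneg by (intro propagate_right[of n m "r p" t]) (auto simp: p_def)
      then show ?thesis using inS by (intro enough[of m]) auto
    qed
  qed
qed

text \<open>Each step down the chain halves the value, since t lies to the right of all contact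
  points involved. \<open>sel_decay_left\<close> is the analogue for steps upwards.\<close>

lemma sel_decay_right:
  assumes "r (sel j) \<le> t" "i \<le> j"
  shows "2 ^ i * (u (sel (j - i)) * t ^ sel (j - i)) \<le> u (sel j) * t ^ sel j"
  using assms(2)
proof (induction i)
  case (Suc i)
  define k where "k = j - Suc i"
  have k: "j - i = Suc k" "Suc k \<le> j" using Suc.prems by (auto simp: k_def)
  have s: "separated (sel k) (sel (Suc k))" by (rule separated_sel)
  have "r (sel (Suc k)) \<le> t"
    using mono_step[of "sel (Suc k)" "sel j"] k strict_mono_sel assms(1)
    by (simp add: strict_mono_less_eq)
  then have "2 * (u (sel k) * t ^ sel k) \<le> u (sel (Suc k)) * t ^ sel (Suc k)"
    using propagate_right[of "sel k" "sel (Suc k)" "r (sel (Suc k))" t 2] s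
      r_nonneg[of "sel (Suc k)"] r_pos[of "sel (Suc k)"] by (simp add: separated_def)
  then have "2 ^ i * (2 * (u (sel k) * t ^ sel k)) \<le> 2 ^ i * (u (sel (Suc k)) * t ^ sel (Suc k))"
    by (intro mult_left_mono) auto
  also have "\<dots> \<le> u (sel j) * t ^ sel j" using Suc k by simp
  finally show ?case by (simp add: k_def mult_ac)
qed simp

lemma sel_decay_left:
  assumes "t \<le> r (sel j)" "t \<ge> 0"
  shows "2 ^ i * (u (sel (j + i)) * t ^ sel (j + i)) \<le> u (sel j) * t ^ sel j"
proof (induction i)
  case (Suc i)
  have s: "separated (sel (j + i)) (sel (Suc (j + i)))" by (rule separated_sel)
  have "t \<le> r (sel (j + i))"
    using mono_step[of "sel j" "sel (j + i)"] strict_mono_sel assms(1)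
    by (simp add: strict_mono_less_eq)
  then have "2 * (u (sel (Suc (j + i))) * t ^ sel (Suc (j + i))) \<le> u (sel (j + i)) * t ^ sel (j + i)"
    using s assms by (intro propagate_left[of _ _ t "r (sel (j + i))"]) (auto simp: separated_def)
  then have "2 ^ i * (2 * (u (sel (Suc (j + i))) * t ^ sel (Suc (j + i))))
      \<le> 2 ^ i * (u (sel (j + i)) * t ^ sel (j + i))"
    by (intro mult_left_mono) auto
  also note Suc
  finally show ?case by (simp add: mult_ac)
qed simp

lemma sum_pow_half_le: "(\<Sum>k<N. (1/2::real) ^ k) \<le> 2"
  by (subst sum_gp_strict) auto

text \<open>Two geometric series, downwards from j and upwards from Suc j, each with sum at most 2 *
  \<omega> t.\<close>

lemma sum_sel_le:
  assumes t: "t \<ge> 0" and j: "r (sel j) \<le> t" "t \<le> r (sel (Suc j))"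
  shows "(\<Sum>k<N. u (sel k) * t ^ sel k) \<le> 4 * \<omega> t"
proof -
  let ?l = "\<lambda>k. u (sel k) * t ^ sel k"
  have wpos: "\<omega> t > 0" using weight_function_pos[OF w t] .
  have nn: "?l k \<ge> 0" for k using monomial_nonneg[OF t] .
  have "(\<Sum>k<N. ?l k) \<le> (\<Sum>k<Suc j + N. ?l k)" using nn by (intro sum_mono2) auto
  also have "\<dots> = (\<Sum>k<Suc j. ?l k) + (\<Sum>k<N. ?l (Suc j + k))"
    by (induction N) (simp_all add: add.assoc)
  also have "(\<Sum>k<Suc j. ?l k) = (\<Sum>k<Suc j. ?l (j - k))"
    using sum.nat_diff_reindex[of ?l "Suc j"] by simp
  also have "\<dots> \<le> (\<Sum>k<Suc j. \<omega> t * (1/2) ^ k)"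
  proof (rule sum_mono)
    fix k assume "k \<in> {..<Suc j}"
    then have "2 ^ k * ?l (j - k) \<le> ?l j" using sel_decay_right[OF j(1), of k] by simp
    also have "\<dots> \<le> \<omega> t" using below[OF t] .
    finally show "?l (j - k) \<le> \<omega> t * (1/2) ^ k" by (simp add: power_divide field_simps)
  qed
  also have "(\<Sum>k<N. ?l (Suc j + k)) \<le> (\<Sum>k<N. \<omega> t * (1/2) ^ k)"
  proof (rule sum_mono)
    fix k
    have "2 ^ k * ?l (Suc j + k) \<le> ?l (Suc j)" using sel_decay_left[OF j(2) t, of k] .
    also have "\<dots> \<le> \<omega> t" using below[OF t] .
    finally show "?l (Suc j + k) \<le> \<omega> t * (1/2) ^ k" by (simp add: power_divide field_simps)
  qed
  also have "(\<Sum>k<Suc j. \<omega> t * (1/2) ^ k) + (\<Sum>k<N. \<omega> t * (1/2) ^ k) \<le> \<omega> t * 2 + \<omega> t * 2"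
    unfolding sum_distrib_left[symmetric]
    using wpos by (intro add_mono mult_left_mono sum_pow_half_le) auto
  finally show ?thesis by simp
qed

text \<open>The constant is 13 = 4 + 3 * 3: the degrees \<open>sel k\<close> contribute 4, and the
  predecessors contribute 4 + 4 + 1, by comparison with the chosen degree above, with the one below,
  and once with \<omega> itself.\<close>

lemma sum_selected_le:
  assumes t: "t \<ge> 0" and A: "finite A" "A \<subseteq> selected"
  shows "(\<Sum>n\<in>A. u n * t ^ n) \<le> 13 * \<omega> t"
proof -
  let ?l = "\<lambda>n. u n * t ^ n"
  have nn: "?l n \<ge> 0" for n using monomial_nonneg[OF t] .
  obtain j where j: "r (sel j) \<le> t" "t \<le> r (sel (Suc j))"
    using r_bracket[OF strict_mono_sel _ t] by auto
  let ?p = "\<lambda>k. sel (Suc k) - 1"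
  have "\<exists>N. A \<subseteq> sel ` {..<N} \<union> ?p ` {..<N}"
    using A
  proof (induction A rule: finite_induct)
    case (insert x A)
    then obtain N where N: "A \<subseteq> sel ` {..<N} \<union> ?p ` {..<N}" by auto
    obtain k where k: "x = sel k \<or> x = ?p k" using insert.prems by (auto simp: selected_def)
    have "insert x A \<subseteq> sel ` {..<max N (Suc k)} \<union> ?p ` {..<max N (Suc k)}"
    proof -
      have "sel ` {..<N} \<subseteq> sel ` {..<max N (Suc k)}" "?p ` {..<N} \<subseteq> ?p ` {..<max N (Suc k)}"
        by (intro image_mono; simp)+
      then have "A \<subseteq> sel ` {..<max N (Suc k)} \<union> ?p ` {..<max N (Suc k)}"
        by (intro subset_trans[OF N] Un_mono)
      moreover have "x \<in> sel ` {..<max N (Suc k)} \<union> ?p ` {..<max N (Suc k)}"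
        using k by auto
      ultimately show ?thesis by (rule insert_subsetI[rotated])
    qed
    then show ?case by blast
  qed simp
  then obtain N where N: "A \<subseteq> sel ` {..<N} \<union> ?p ` {..<N}" by blast
  have "(\<Sum>n\<in>A. ?l n) \<le> (\<Sum>n\<in>sel ` {..<N} \<union> ?p ` {..<N}. ?l n)"
    using N nn by (intro sum_mono2) auto
  also have "\<dots> \<le> (\<Sum>n\<in>sel ` {..<N}. ?l n) + (\<Sum>n\<in>?p ` {..<N}. ?l n)"
    using nn by (subst sum.union_inter[symmetric]) (auto intro!: sum_nonneg)
  also have "(\<Sum>n\<in>sel ` {..<N}. ?l n) \<le> (\<Sum>k<N. ?l (sel k))"
    using nn by (intro order_trans[OF sum_image_le]) auto
  also have "(\<Sum>n\<in>?p ` {..<N}. ?l n) \<le> (\<Sum>k<N. ?l (?p k))"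
    using nn by (intro order_trans[OF sum_image_le]) (auto)
  \<comment> \<open>Left of the bracket (k < j) a predecessor is dominated by its successor, right
    of it (k > j) by \<open>sel k\<close>. In the bracket neither comparison is available, and the
    single term is bounded by \<omega> t.\<close>
  also have "(\<Sum>k<N. ?l (?p k)) \<le> (\<Sum>k<N. ?l (sel (Suc k)) + ?l (sel k) + (if k = j then \<omega> t else 0))"
  proof (rule sum_mono)
    fix k
    have sk: "sel k \<le> ?p k" "?p k \<le> sel (Suc k)"
      using strict_mono_less[OF strict_mono_sel, of k "Suc k"] by (auto)
    consider "k < j" | "k = j" | "k > j" by linarith
    then show "?l (?p k) \<le> ?l (sel (Suc k)) + ?l (sel k) + (if k = j then \<omega> t else 0)"
    proof cases
      case 1
      then have "r (sel (Suc k)) \<le> t" using j mono_step[of "sel (Suc k)" "sel j"] strict_mono_sel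
        by (simp add: strict_mono_less_eq)
      then have "?l (?p k) \<le> ?l (sel (Suc k))" using sk(2) by (intro dominate_right) auto
      then show ?thesis using nn[of "sel k"] 1 by simp
    next
      case 2
      then show ?thesis using below[OF t, of "?p k"] nn[of "sel k"] nn[of "sel (Suc k)"]
        by simp
    next
      case 3
      then have "t \<le> r (sel k)" using j mono_step[of "sel (Suc j)" "sel k"] strict_mono_sel
        by (simp add: strict_mono_less_eq)
      then have "?l (?p k) \<le> ?l (sel k)" using sk(1) t by (intro dominate_left) auto
      then show ?thesis using nn[of "sel (Suc k)"] 3 by simp
    qed
  qed
  also have "\<dots> = (\<Sum>k<N. ?l (sel (Suc k))) + (\<Sum>k<N. ?l (sel k)) + (\<Sum>k<N. if k = j then \<omega> t else 0)"
    by (simp add: sum.distrib)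
  also have "(\<Sum>k<N. ?l (sel (Suc k))) \<le> (\<Sum>k<Suc N. ?l (sel k))"
    using nn[of "sel 0"] by (subst sum.lessThan_Suc_shift) (auto)
  also have "(\<Sum>k<N. if k = j then \<omega> t else 0) \<le> \<omega> t"
    using weight_function_pos[OF w t] by (simp add: sum.delta)
  finally show ?thesis
    using sum_sel_le[OF t j, of N] sum_sel_le[OF t j, of "Suc N"] by linarith
qed

end

text \<open>The factor 24 is 12 from \<open>assoc_weight_le_monomial\<close> times 2 from
  \<open>selected_covers\<close>.\<close>

proposition weight_monomial_family:
  assumes w: "weight_function \<omega>"
  shows "\<exists>u T. (\<forall>n. 0 < u n) \<and>
           (\<forall>t\<ge>0. \<forall>A. finite A \<and> A \<subseteq> T \<longrightarrow> (\<Sum>n\<in>A. u n * t ^ n) \<le> 13 * \<omega> t) \<and>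
           (\<forall>t\<ge>0. \<exists>n\<in>T. assoc_weight \<omega> t \<le> 24 * (u n * t ^ n))"
proof -
  obtain u r where ur: "\<And>n. 0 < u n \<and> 0 \<le> r n \<and> (n = 0 \<longrightarrow> r n = 0) \<and> (n > 0 \<longrightarrow> r n > 0) \<and>
           (\<forall>t\<ge>0. u n * t ^ n \<le> \<omega> t) \<and> u n * r n ^ n = \<omega> (r n)"
    using tangent_monomial_exists[OF w] by metis
  then interpret tangent_monomials \<omega> u r
    by unfold_locales (use w in auto)
  have "\<exists>n\<in>selected. assoc_weight \<omega> t \<le> 24 * (u n * t ^ n)" if t: "t \<ge> 0" for t
  proof -
    obtain n where n: "assoc_weight \<omega> t \<le> 12 * (u n * t ^ n)"
      using assoc_weight_le_monomial[OF t] by blast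
    obtain s where "s \<in> selected" "u n * t ^ n \<le> 2 * (u s * t ^ s)"
      using selected_covers[OF t] by blast
    then show ?thesis using n by (intro bexI[of _ s]) auto
  qed
  then show ?thesis using sum_selected_le u_pos by (intro exI[of _ u] exI[of _ selected]) auto
qed

section \<open>Entire functions of several variables\<close>

lemma bounded_linear_scale_vec: "bounded_linear (\<lambda>c::complex. c *s (v::complex^'n))"
  by (auto simp: linear_conv_bounded_linear[symmetric] linear_iff vec_eq_iff algebra_simps)

lemma bounded_linear_vec_scale: "bounded_linear (\<lambda>v::complex^'n. c *s v)"
  by (auto simp: linear_conv_bounded_linear[symmetric] linear_iff vec_eq_iff algebra_simps)

lemma norm_vec_scale: "norm (c *s (v::complex^'n)) = norm c * norm v"
  by (simp add: norm_vec_def norm_mult L2_set_right_distrib)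

lemma of_real_scale_vec: "complex_of_real t *s v = t *\<^sub>R (v::complex^'n)"
  unfolding vec_eq_iff vector_smult_component vector_scaleR_component
  by (simp add: scaleR_conv_of_real)

abbreviation cderiv :: "(complex^'n \<Rightarrow> complex) \<Rightarrow> complex^'n \<Rightarrow> complex^'n \<Rightarrow> complex" where
  "cderiv f z \<equiv> frechet_derivative f (at z)"

lemma entire_has_derivative: "entire f \<Longrightarrow> (f has_derivative cderiv f z) (at z)"
  unfolding entire_def by (metis frechet_derivative_works differentiable_def)

lemma entireI:
  assumes "\<And>z. (f has_derivative D z) (at z)" "\<And>z c v. D z (c *s v) = c * D z v"
  shows "entire f"
  using assms unfolding entire_def by blast

lemma cderiv_eqI: "(f has_derivative D) (at z) \<Longrightarrow> cderiv f z = D"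
  by (metis frechet_derivative_at)

lemma cderiv_scale: "entire f \<Longrightarrow> cderiv f z (c *s v) = c * cderiv f z v"
  unfolding entire_def by (metis frechet_derivative_at)

lemma bounded_linear_cderiv: "entire f \<Longrightarrow> bounded_linear (cderiv f z)"
  using entire_has_derivative has_derivative_bounded_linear by blast

lemma entire_continuous_on: "entire f \<Longrightarrow> continuous_on S f"
  by (intro continuous_at_imp_continuous_on ballI has_derivative_continuous)
     (rule entire_has_derivative)

lemma has_derivative_complex_linear_mult:
  assumes "(f has_derivative D) (at (z::complex))" "\<And>c. D (c * 1) = c * D 1"
  shows "(f has_field_derivative D 1) (at z)"
proof -
  have "D = (*) (D 1)"
  proof
    show "D c = D 1 * c" for c using assms(2)[of c] by (simp add: mult.commute[of _ c])
  qed
  then show ?thesis using assms(1) unfolding has_field_derivative_def by metis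
qed

lemma entire_slice_derivative:
  assumes "entire f"
  shows "((\<lambda>c. f (z + c *s v)) has_field_derivative cderiv f (z + c *s v) v) (at c)"
proof -
  have "((\<lambda>c. z + c *s v) has_derivative (\<lambda>h. h *s v)) (at c)"
    using bounded_linear_imp_has_derivative[OF bounded_linear_scale_vec[of v]]
    by (auto intro!: derivative_eq_intros)
  from has_derivative_compose[OF this entire_has_derivative[OF assms]]
  have "((\<lambda>c. f (z + c *s v)) has_derivative (\<lambda>h. cderiv f (z + c *s v) (h *s v))) (at c)" .
  from has_derivative_complex_linear_mult[OF this]
  show ?thesis by (simp add: cderiv_scale[OF assms])
qed

lemma entire_slice_holomorphic:
  assumes "entire f"
  shows "(\<lambda>c. f (z + c *s v)) holomorphic_on S"
  using entire_slice_derivative[OF assms] holomorphic_on_def field_differentiable_def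
    has_field_derivative_at_within by metis

lemma entire_line_holomorphic:
  assumes "entire f"
  shows "(\<lambda>c. f (c *s v)) holomorphic_on S"
  using entire_slice_holomorphic[OF assms, of 0] by simp

text \<open>The one-variable Cauchy inequality for the slice c \<mapsto> f (z + c v) on the circle
  of radius s / |v|.\<close>

lemma cderiv_norm_le:
  fixes f :: "complex^'n \<Rightarrow> complex"
  assumes f: "entire f" and s: "0 < s" and M: "\<And>w. dist z w \<le> s \<Longrightarrow> norm (f w) \<le> M"
  shows "norm (cderiv f z v) \<le> M * norm v / s"
proof (cases "v = 0")
  case True
  then show ?thesis using linear_0[OF bounded_linear.linear[OF bounded_linear_cderiv[OF f]]] by simp
next
  case False
  define h where "h = (\<lambda>c. f (z + c *s v))"
  have hol: "h holomorphic_on S" for S unfolding h_def by (rule entire_slice_holomorphic[OF f])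
  have "norm ((deriv ^^ 1) h 0) \<le> fact 1 * M / (s / norm v) ^ 1"
  proof (rule Cauchy_inequality)
    show "norm (h c) \<le> M" if "norm (0 - c) = s / norm v" for c
      unfolding h_def using that False by (intro M) (simp add: dist_norm norm_vec_scale)
  qed (use hol False s holomorphic_on_imp_continuous_on in auto)
  moreover have "deriv h 0 = cderiv f z v"
    using DERIV_imp_deriv[OF entire_slice_derivative[OF f, of z v 0]] by (simp add: h_def)
  ultimately show ?thesis by simp
qed

section \<open>Continuity of the derivative and differentiation under the integral sign\<close>

lemma entire_shift:
  assumes "entire f"
  shows "((\<lambda>w. f (w + a)) has_derivative cderiv f (z + a)) (at z)"
proof -
  have "((\<lambda>w. w + a) has_derivative (\<lambda>h. h)) (at z)"
    by (auto intro!: derivative_eq_intros)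
  from has_derivative_compose[OF this entire_has_derivative[OF assms]] show ?thesis .
qed

text \<open>The Leibniz rule asks for continuity of the derivative as an operator-valued map, hence
  the bundled form.\<close>

definition cderiv_blinfun :: "(complex^'n \<Rightarrow> complex) \<Rightarrow> complex^'n \<Rightarrow> (complex^'n) \<Rightarrow>\<^sub>L complex" where
  "cderiv_blinfun f z = Blinfun (cderiv f z)"

lemma cderiv_blinfun_apply: "entire f \<Longrightarrow> blinfun_apply (cderiv_blinfun f z) = cderiv f z"
  unfolding cderiv_blinfun_def by (intro bounded_linear_Blinfun_apply bounded_linear_cderiv)

text \<open>Cauchy's estimate on a unit ball applied to the difference f (w + a) - f w, which is
  uniformly small there by uniform continuity of \<open>f\<close>. Thus no second derivative
  enters.\<close>

lemma continuous_cderiv_blinfun: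
  fixes f :: "complex^'n \<Rightarrow> complex"
  assumes f: "entire f"
  shows "continuous_on UNIV (cderiv_blinfun f)"
proof (rule continuous_at_imp_continuous_on, rule ballI, unfold continuous_at_eps_delta, intro allI impI)
  fix z :: "complex^'n" and e :: real
  assume e: "e > 0"
  \<comment> \<open>Radius 2 leaves room for the unit ball around z shifted by a vector of norm
    below 1.\<close>
  have "uniformly_continuous_on (cball z 2) f"
    by (intro compact_uniformly_continuous entire_continuous_on f compact_cball)
  then obtain d where d: "d > 0"
    "\<And>x y. x \<in> cball z 2 \<Longrightarrow> y \<in> cball z 2 \<Longrightarrow> dist y x < d \<Longrightarrow> dist (f y) (f x) < e / 2"
    unfolding uniformly_continuous_on_def using e by (metis half_gt_zero)
  have "dist (cderiv_blinfun f z') (cderiv_blinfun f z) < e" if z': "dist z' z < min d 1" for z'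
  proof -
    define a where "a = z' - z"
    have h: "((\<lambda>w. f (w + a) - f w) has_derivative (\<lambda>v. cderiv f (x + a) v - cderiv f x v)) (at x)" for x
      by (intro has_derivative_diff entire_shift entire_has_derivative f)
    have eh: "entire (\<lambda>w. f (w + a) - f w)"
      by (rule entireI[OF h]) (simp add: cderiv_scale[OF f] algebra_simps)
    have "norm (cderiv f z' v - cderiv f z v) \<le> e / 2 * norm v / 1" for v
    proof -
      have "norm (f (w + a) - f w) \<le> e / 2" if "dist z w \<le> 1" for w
      proof -
        have a: "norm a < d" "norm a < 1" using z' by (auto simp: a_def dist_norm)
        have "dist z (w + a) \<le> dist z w + dist w (w + a)" by (rule dist_triangle)
        then have "dist z (w + a) \<le> 2" using a that by (simp add: dist_norm)
        then have "dist (f (w + a)) (f w) < e / 2"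
          using a that by (intro d(2)) (auto simp: dist_norm)
        then show ?thesis by (simp add: dist_norm)
      qed
      from cderiv_norm_le[OF eh, of 1 z "e/2" v, OF _ this] show ?thesis
        using cderiv_eqI[OF h, of z] by (simp add: a_def)
    qed
    then have "norm (cderiv_blinfun f z' - cderiv_blinfun f z) \<le> e / 2"
      using e by (intro norm_blinfun_bound) (auto simp: blinfun.diff_left cderiv_blinfun_apply f)
    then show ?thesis using e by (simp add: dist_norm)
  qed
  then show "\<exists>d>0. \<forall>x'. dist x' z < d \<longrightarrow> dist (cderiv_blinfun f x') (cderiv_blinfun f z) < e"
    using d(1) by (intro exI[of _ "min d 1"]) auto
qed

text \<open>
  Only the derivative of the integrand has to be given by the formula at every \<open>t\<close>, which leaves
  room for kernels like \<open>m t = 1\<close>, \<open>h z t = f (t z) / t\<close>.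
\<close>

lemma entire_integral:
  fixes f :: "complex^'n \<Rightarrow> complex" and c m :: "real \<Rightarrow> complex"
  assumes f: "entire f" and c: "continuous_on {0..1} c" and m: "continuous_on {0..1} m"
    and h: "\<And>z t. t \<in> {0..1} \<Longrightarrow> ((\<lambda>z. h z t) has_derivative (\<lambda>v. m t * cderiv f (c t *s z) v)) (at z)"
    and int: "\<And>z. h z integrable_on {0..1}"
  shows "((\<lambda>z. integral {0..1} (h z)) has_derivative
           (\<lambda>v. integral {0..1} (\<lambda>t. m t * cderiv f (c t *s z) v))) (at z)"
    and "entire (\<lambda>z. integral {0..1} (h z))"
proof -
  define B where "B z t = blinfun_mult_right (m t) o\<^sub>L cderiv_blinfun f (c t *s z)" for z t
  have B: "blinfun_apply (B z t) = (\<lambda>v. m t * cderiv f (c t *s z) v)" for z t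
    by (auto simp: B_def cderiv_blinfun_apply f)
  have cB: "continuous_on (UNIV \<times> {0..1}) (\<lambda>(z, t). B z t)"
  proof -
    have 1: "continuous_on (UNIV \<times> {0..1}) (\<lambda>p. c (snd p) *s (fst p :: complex^'n))"
      unfolding vector_scalar_mult_def
      by (intro continuous_intros continuous_on_compose2[OF c]) auto
    have 2: "continuous_on (UNIV \<times> {0..1}) (\<lambda>p. cderiv_blinfun f (c (snd p) *s (fst p :: complex^'n)))"
      by (rule continuous_on_compose2[OF continuous_cderiv_blinfun[OF f] 1]) auto
    have 3: "continuous_on (UNIV \<times> {0..1}) (\<lambda>p::(complex^'n) \<times> real. blinfun_mult_right (m (snd p)))"
      by (intro bounded_linear.continuous_on[OF bounded_linear_blinfun_mult_right]
            continuous_on_compose2[OF m] continuous_intros) auto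
    show ?thesis unfolding B_def case_prod_unfold
      by (intro bounded_bilinear.continuous_on[OF bounded_bilinear_blinfun_compose] 2 3)
  qed
  have D: "((\<lambda>z. integral {0..1} (h z)) has_derivative integral {0..1} (B z)) (at z)" for z
    using leibniz_rule[of UNIV 0 1 h B z] h int cB by (simp add: B)
  have Bint: "B z integrable_on {0..1}" for z
  proof -
    have "continuous_on {0..1} (\<lambda>t. (\<lambda>(z, t). B z t) (z, t))"
      by (rule continuous_on_compose2[OF cB]) (auto intro!: continuous_intros)
    then show ?thesis by (intro integrable_continuous_real) simp
  qed
  have ap: "blinfun_apply (integral {0..1} (B z)) v = integral {0..1} (\<lambda>t. m t * cderiv f (c t *s z) v)"
    for z v
    using blinfun_apply_integral[OF Bint, of z v] by (simp add: B)
  show D': "((\<lambda>z. integral {0..1} (h z)) has_derivative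
           (\<lambda>v. integral {0..1} (\<lambda>t. m t * cderiv f (c t *s z) v))) (at z)" for z
    using D[of z] by (simp add: ap[abs_def, symmetric])
  show "entire (\<lambda>z. integral {0..1} (h z))"
    by (rule entireI[OF D']) (simp add: cderiv_scale[OF f] mult.left_commute)
qed

section \<open>The radial derivative as an entire function\<close>

lemma radial_deriv_eq:
  fixes g :: "complex^'n \<Rightarrow> complex"
  assumes g: "entire g"
  shows "radial_deriv g z = cderiv g z z"
proof -
  have "partial_deriv j g z = cderiv g z (axis j 1)" for j
  proof -
    have "(\<chi> i. if i = j then w else z $ i) = z + (w - z $ j) *s axis j 1" for w
      by (auto simp: vec_eq_iff axis_def)
    then have "partial_deriv j g z = deriv (\<lambda>w. g (z + (w - z $ j) *s axis j 1)) (z $ j)"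
      by (simp add: partial_deriv_def)
    also have "\<dots> = cderiv g z (axis j 1)"
    proof (rule DERIV_imp_deriv)
      have "((\<lambda>c. g (z + c *s axis j 1)) has_field_derivative cderiv g z (axis j 1)) (at (z $ j - z $ j))"
        using entire_slice_derivative[OF g, of z "axis j 1" 0] by simp
      moreover have "((\<lambda>w. w - z $ j) has_field_derivative 1) (at (z $ j))"
        by (auto intro!: derivative_eq_intros)
      ultimately have "((\<lambda>w. g (z + (w - z $ j) *s axis j 1)) has_field_derivative cderiv g z (axis j 1) * 1) (at (z $ j))"
        by (rule DERIV_chain2[where f = "\<lambda>c. g (z + c *s axis j 1)" and g = "\<lambda>w. w - z $ j"])
      then show "((\<lambda>w. g (z + (w - z $ j) *s axis j 1)) has_field_derivative cderiv g z (axis j 1)) (at (z $ j))"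
        by (simp only: mult_1_right)
    qed
    finally show ?thesis .
  qed
  then have "radial_deriv g z = (\<Sum>j\<in>UNIV. cderiv g z (z $ j *s axis j 1))"
    by (simp add: radial_deriv_def cderiv_scale[OF g])
  also have "\<dots> = cderiv g z (\<Sum>j\<in>UNIV. z $ j *s axis j 1)"
    using linear_sum[OF bounded_linear.linear[OF bounded_linear_cderiv[OF g]]] by metis
  also have "(\<Sum>j\<in>UNIV. z $ j *s axis j 1) = z"
    by (simp add: basis_expansion)
  finally show ?thesis .
qed

text \<open>Being entire only provides one derivative, so the radial derivative is rewritten without
  derivatives: it is the derivative at u = 1 of u \<mapsto> g (u z), and Cauchy's formula on the
  circle of radius 1 around 1 turns it into an integral of values of \<open>g\<close>, which can be
  differentiated in z.\<close>

lemma entire_radial_deriv: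
  fixes g :: "complex^'n \<Rightarrow> complex"
  assumes g: "entire g"
  shows "entire (radial_deriv g)"
proof -
  \<comment> \<open>\<open>c\<close> parametrises the circle and \<open>e\<close> is its offset from
    the centre; the factor from dz cancels one of the two powers of \<open>e\<close> in Cauchy's
    kernel.\<close>
  define e where "e t = exp (2 * of_real pi * \<i> * of_real t)" for t :: real
  define c where "c t = 1 + e t" for t
  have ec: "continuous_on S e" "continuous_on S c" for S
    by (auto simp: e_def[abs_def] c_def[abs_def] intro!: continuous_intros)
  have ne: "e t \<noteq> 0" for t by (simp add: e_def)
  let ?h = "\<lambda>z t. g (c t *s z) / e t"
  have eq: "radial_deriv g z = integral {0..1} (?h z)" for z
  proof -
    let ?s = "\<lambda>u. g (u *s z)"
    have hol: "?s holomorphic_on S" for S by (rule entire_line_holomorphic[OF g])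
    have d: "(?s has_field_derivative
       (1 / (2 * of_real pi * \<i>) * contour_integral (circlepath 1 1) (\<lambda>u. ?s u / (u - 1)^2))) (at 1)"
      by (rule Cauchy_derivative_integral_circlepath(2))
         (auto intro: hol holomorphic_on_imp_continuous_on)
    have "(?s has_field_derivative cderiv g z z) (at 1)"
      using entire_slice_derivative[OF g, of 0 z 1] by simp
    then have "radial_deriv g z = 1 / (2 * of_real pi * \<i>) *
        contour_integral (circlepath 1 1) (\<lambda>u. ?s u / (u - 1)^2)"
      unfolding radial_deriv_eq[OF g] by (rule DERIV_unique[OF _ d])
    also have "contour_integral (circlepath 1 1) (\<lambda>u. ?s u / (u - 1)^2) =
        integral {0..1} (\<lambda>t. (2 * of_real pi * \<i>) * ?h z t)"
      unfolding contour_integral_integral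
    proof (intro integral_cong)
      fix t :: real
      have p: "circlepath 1 1 t = c t" by (simp add: circlepath c_def e_def)
      have v: "vector_derivative (circlepath 1 1) (at t) = 2 * of_real pi * \<i> * e t"
        by (simp add: vector_derivative_circlepath e_def)
      have "c t - 1 = e t" by (simp add: c_def)
      then show "g (circlepath 1 1 t *s z) / (circlepath 1 1 t - 1)\<^sup>2 * vector_derivative (circlepath 1 1) (at t) =
          2 * of_real pi * \<i> * ?h z t"
        unfolding p v using ne[of t] by (simp only: power2_eq_square) (simp add: field_simps)
    qed
    also have "\<dots> = (2 * of_real pi * \<i>) * integral {0..1} (?h z)" by (rule integral_mult_right)
    finally show ?thesis by simp
  qed
  have "entire (\<lambda>z. integral {0..1} (?h z))"
  proof (rule entire_integral(2)[OF g, where c = c and m = "\<lambda>t. c t / e t"])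
    show "continuous_on {0..1} (\<lambda>t. c t / e t)" using ec ne by (intro continuous_intros) auto
    show "((\<lambda>z. ?h z t) has_derivative (\<lambda>v. c t / e t * cderiv g (c t *s z) v)) (at z)" for z t
    proof -
      have "((\<lambda>z. g (c t *s z)) has_derivative (\<lambda>v. cderiv g (c t *s z) (c t *s v))) (at z)"
        by (rule has_derivative_compose[OF bounded_linear_imp_has_derivative[OF bounded_linear_vec_scale]
              entire_has_derivative[OF g]])
      then have "((\<lambda>z. g (c t *s z) / e t) has_derivative (\<lambda>v. cderiv g (c t *s z) (c t *s v) / e t)) (at z)"
        by (rule bounded_linear.has_derivative[OF bounded_linear_divide])
      then show ?thesis by (simp add: cderiv_scale[OF g])
    qed
    show "?h z integrable_on {0..1}" for z
    proof (intro integrable_continuous_real continuous_intros)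
      have "continuous_on {0..1} (\<lambda>t. c t *s z)"
        using bounded_linear.continuous_on[OF bounded_linear_scale_vec ec(2)] .
      then show "continuous_on {0..1} (\<lambda>t. g (c t *s z))"
        by (rule continuous_on_compose2[OF entire_continuous_on[OF g, of UNIV]]) auto
    qed (use ec ne in auto)
  qed (rule ec)
  then show ?thesis using eq by presburger
qed

section \<open>Closure properties of entire functions\<close>

lemma entire_mult:
  assumes "entire f" "entire g" shows "entire (\<lambda>z. f z * g z)"
  by (rule entireI[OF has_derivative_mult[OF entire_has_derivative[OF assms(1)] entire_has_derivative[OF assms(2)]]])
     (simp add: cderiv_scale assms algebra_simps)

lemma entire_add:
  assumes "entire f" "entire g" shows "entire (\<lambda>z. f z + g z)"
  by (rule entireI[OF has_derivative_add[OF entire_has_derivative[OF assms(1)] entire_has_derivative[OF assms(2)]]])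
     (simp add: cderiv_scale assms algebra_simps)

lemma entire_const: "entire (\<lambda>z. c)"
  by (rule entireI[OF has_derivative_const]) simp

lemma entire_sum: "(\<And>i. i \<in> I \<Longrightarrow> entire (f i)) \<Longrightarrow> entire (\<lambda>z. \<Sum>i\<in>I. f i z)"
  by (induction I rule: infinite_finite_induct) (auto intro: entire_add entire_const)

lemma entire_power: "entire f \<Longrightarrow> entire (\<lambda>z. f z ^ n)"
  by (induction n) (auto intro: entire_mult entire_const)

lemma entire_nth: "entire (\<lambda>z. z $ i)"
  by (rule entireI[OF bounded_linear_imp_has_derivative[OF bounded_linear_vec_nth]]) simp

lemma entire_compose:
  fixes f :: "complex^'n \<Rightarrow> complex" and \<phi> :: "complex^'m \<Rightarrow> complex^'n"
  assumes f: "entire f" and p: "entire_map \<phi>"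
  shows "entire (\<lambda>z. f (\<phi> z))"
proof (rule entireI)
  fix z
  let ?D = "\<lambda>v. \<chi> i. cderiv (\<lambda>z. \<phi> z $ i) z v"
  have p': "entire (\<lambda>z. \<phi> z $ i)" for i using p by (simp add: entire_map_def)
  have "(\<phi> has_derivative ?D) (at z)"
    by (subst has_derivative_componentwise_within)
       (auto simp: Basis_vec_def inner_axis inner_commute[of _ "axis _ _"] inner_axis'
         intro!: bounded_linear.has_derivative[OF bounded_linear_inner_left] bounded_linear.has_derivative[OF bounded_linear_inner_right] entire_has_derivative p')
  from has_derivative_compose[OF this entire_has_derivative[OF f]]
  show "((\<lambda>z. f (\<phi> z)) has_derivative (\<lambda>v. cderiv f (\<phi> z) (?D v))) (at z)" .
  fix c v
  have "?D (c *s v) = c *s ?D v" using cderiv_scale[OF p'] by (simp add: vec_eq_iff)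
  then show "cderiv f (\<phi> z) (?D (c *s v)) = c * cderiv f (\<phi> z) (?D v)"
    by (simp add: cderiv_scale[OF f])
qed

lemma entire_map_continuous_on:
  assumes "entire_map \<phi>" shows "continuous_on S \<phi>"
proof -
  have "continuous_on S (\<lambda>z. \<chi> i. \<phi> z $ i)"
    using assms by (intro continuous_on_vec_lambda entire_continuous_on) (simp add: entire_map_def)
  then show ?thesis by simp
qed

subsection \<open>Radial primitives\<close>

lemma has_vector_derivative_ray:
  fixes G :: "complex^'n \<Rightarrow> complex"
  assumes "entire G"
  shows "((\<lambda>t. G (t *\<^sub>R z)) has_vector_derivative cderiv G (t *\<^sub>R z) z) (at t within S)"
proof -
  have "((\<lambda>t. t *\<^sub>R z) has_derivative (\<lambda>h. h *\<^sub>R z)) (at t)"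
    by (auto intro!: derivative_eq_intros)
  from has_derivative_compose[OF this entire_has_derivative[OF assms]]
  have "((\<lambda>t. G (t *\<^sub>R z)) has_derivative (\<lambda>h. cderiv G (t *\<^sub>R z) (h *\<^sub>R z))) (at t)" .
  moreover have "cderiv G (t *\<^sub>R z) (h *\<^sub>R z) = h *\<^sub>R cderiv G (t *\<^sub>R z) z" for h
    by (rule linear_scale[OF bounded_linear.linear[OF bounded_linear_cderiv[OF assms]]])
  ultimately show ?thesis
    unfolding has_vector_derivative_def using has_derivative_at_withinI by fastforce
qed

text \<open>Because G 0 = 0, the integrand extends continuously to t = 0 by the derivative of
  \<open>G\<close> at 0 in direction z.\<close>

lemma radial_primitive_integrable:
  fixes G :: "complex^'n \<Rightarrow> complex"
  assumes G: "entire G" and G0: "G 0 = 0"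
  shows "(\<lambda>t. G (t *\<^sub>R z) / of_real t) integrable_on {0..1}"
proof -
  define k where "k = (\<lambda>t. if t = 0 then cderiv G 0 z else G (t *\<^sub>R z) / of_real t)"
  have "continuous_on {0..1} k"
  proof (rule continuous_at_imp_continuous_on, rule ballI)
    fix t :: real
    show "isCont k t"
    proof (cases "t = 0")
      case True
      have "((\<lambda>c. G (c *s z) / c) \<longlongrightarrow> cderiv G 0 z) (at 0)"
        using entire_slice_derivative[OF G, of 0 z 0] G0 by (simp add: DERIV_def)
      moreover have "filterlim complex_of_real (at 0) (at 0)"
        by (auto simp: filterlim_at eventually_at_filter intro!: tendsto_eq_intros)
      ultimately have "((\<lambda>t. G (complex_of_real t *s z) / of_real t) \<longlongrightarrow> cderiv G 0 z) (at 0)"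
        by (rule filterlim_compose)
      then have "(k \<longlongrightarrow> cderiv G 0 z) (at 0)"
        by (rule Lim_transform_eventually)
           (auto simp: k_def eventually_at_filter of_real_scale_vec)
      then show ?thesis using True by (simp add: isCont_def k_def)
    next
      case False
      have "isCont (\<lambda>t. G (t *\<^sub>R z) / of_real t) t"
        using False has_vector_derivative_continuous[OF has_vector_derivative_ray[OF G, of z t UNIV]]
        by (intro continuous_intros) auto
      moreover have "\<forall>\<^sub>F s in nhds t. G (s *\<^sub>R z) / of_real s = k s"
        using t1_space_nhds[OF False] by eventually_elim (simp add: k_def)
      ultimately show ?thesis using isCont_cong by metis
    qed
  qed
  then have "k integrable_on {0..1}" by (rule integrable_continuous_real)
  then show ?thesis by (rule integrable_spike[of _ _ "{0}"]) (auto simp: k_def)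
qed

text \<open>Differentiating G (t z) / t in z cancels the singular factor 1 / t, so the Leibniz rule
  applies with kernel 1. In direction z the differentiated integrand is the t-derivative of G (t z),
  and the integral telescopes to G z - G 0.\<close>

lemma radial_primitive:
  fixes G :: "complex^'n \<Rightarrow> complex"
  assumes G: "entire G" and G0: "G 0 = 0"
  defines "F \<equiv> \<lambda>z. integral {0..1} (\<lambda>t. G (t *\<^sub>R z) / of_real t)"
  shows "entire F" and "cderiv F z z = G z"
proof -
  define h where "h = (\<lambda>z t. if t = 0 then cderiv G 0 z else G (t *\<^sub>R z) / of_real t)"
  have Fh: "F = (\<lambda>z. integral {0..1} (h z))"
    unfolding F_def by (intro ext integral_spike[of "{0}"]) (auto simp: h_def)
  have c: "continuous_on {0..1} (\<lambda>t::real. complex_of_real t)" by (intro continuous_intros)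
  have m: "continuous_on {0..1} (\<lambda>t::real. 1::complex)" by (intro continuous_intros)
  have der: "((\<lambda>z. h z t) has_derivative (\<lambda>v. 1 * cderiv G (of_real t *s z) v)) (at z)" for z t
  proof (cases "t = 0")
    case True
    then show ?thesis
      using bounded_linear_imp_has_derivative[OF bounded_linear_cderiv[OF G]] by (simp add: h_def)
  next
    case False
    have "((\<lambda>z. G (of_real t *s z)) has_derivative (\<lambda>v. cderiv G (of_real t *s z) (of_real t *s v))) (at z)"
      by (rule has_derivative_compose[OF bounded_linear_imp_has_derivative[OF bounded_linear_vec_scale]
            entire_has_derivative[OF G]])
    then have "((\<lambda>z. G (of_real t *s z) / of_real t) has_derivative
        (\<lambda>v. cderiv G (of_real t *s z) (of_real t *s v) / of_real t)) (at z)"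
      by (rule bounded_linear.has_derivative[OF bounded_linear_divide])
    then show ?thesis using False unfolding cderiv_scale[OF G] by (simp add: h_def of_real_scale_vec)
  qed
  have int: "h z integrable_on {0..1}" for z
    using radial_primitive_integrable[OF G G0, of z]
    by (rule integrable_spike[of _ _ "{0}"]) (auto simp: h_def)
  show "entire F" unfolding Fh by (rule entire_integral(2)[OF G c m der int])
  have "cderiv F z = (\<lambda>v. integral {0..1} (\<lambda>t. 1 * cderiv G (of_real t *s z) v))"
    unfolding Fh by (intro cderiv_eqI entire_integral(1)[OF G c m der int])
  then have "cderiv F z z = integral {0..1} (\<lambda>t. cderiv G (t *\<^sub>R z) z)"
    by (simp add: of_real_scale_vec)
  also have "\<dots> = G (1 *\<^sub>R z) - G (0 *\<^sub>R z)"
    by (intro integral_unique fundamental_theorem_of_calculus has_vector_derivative_ray[OF G]) auto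
  finally show "cderiv F z z = G z" using G0 by simp
qed

section \<open>Homogeneous peak functions on the sphere\<close>

lemma power_le_fact_exp:
  assumes "0 \<le> x"
  shows "x ^ n \<le> fact n * exp (x::real)"
proof -
  have "x ^ n / fact n \<le> (\<Sum>k. x ^ k /\<^sub>R fact k)"
  proof -
    have "(\<Sum>k\<in>{n}. x ^ k /\<^sub>R fact k) \<le> (\<Sum>k. x ^ k /\<^sub>R fact k)"
      by (rule sum_le_suminf) (use assms summable_exp_generic[of x] in auto)
    then show ?thesis by (simp add: divide_inverse mult.commute)
  qed
  then show ?thesis by (simp add: exp_def field_simps)
qed

text \<open>Half of the exponential decay absorbs the polynomial, leaving a geometric series of
  ratio exp (- c / 2).\<close>

lemma summable_poly_times_exp:
  fixes a b c :: real
  assumes "0 < a" "0 \<le> b" "0 < c"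
  shows "summable (\<lambda>k. (a * real k + b) ^ D * exp (- c * real k))"
proof (rule summable_comparison_test)
  define M where "M = (2 * a / c) ^ D * (fact D * exp (c * b / (2 * a)))"
  have "norm ((a * real k + b) ^ D * exp (- c * real k)) \<le> M * exp (- c / 2) ^ k" for k
  proof -
    \<comment> \<open>Chosen proportional to a * k + b and with slope c / 2 in k, so that exp x uses
      up exactly half of the decay.\<close>
    define x where "x = c / 2 * real k + c * b / (2 * a)"
    have x: "x \<ge> 0" "a * real k + b = 2 * a / c * x"
      using assms by (auto simp: x_def field_simps)
    have "(a * real k + b) ^ D * exp (- c * real k) = (2 * a / c) ^ D * (x ^ D * exp (- c * real k))"
      unfolding x(2) power_mult_distrib by simp
    also have "\<dots> \<le> (2 * a / c) ^ D * ((fact D * exp x) * exp (- c * real k))"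
      using assms by (intro mult_left_mono mult_right_mono power_le_fact_exp x) auto
    also have "exp x = exp (c * b / (2 * a)) * exp (c / 2 * real k)"
      by (simp add: x_def exp_add)
    also have "(2 * a / c) ^ D * ((fact D * (exp (c * b / (2 * a)) * exp (c / 2 * real k))) * exp (- c * real k))
        = M * (exp (c / 2 * real k) * exp (- c * real k))"
      by (simp add: M_def)
    also have "exp (c / 2 * real k) * exp (- c * real k) = exp (- c / 2) ^ k"
      by (simp flip: exp_add exp_of_nat_mult add: field_simps)
    finally show ?thesis using assms by simp
  qed
  then show "\<exists>N. \<forall>n\<ge>N. norm ((a * real n + b) ^ D * exp (- c * real n)) \<le> M * exp (- c / 2) ^ n"
    by blast
  show "summable (\<lambda>n. M * exp (- c / 2) ^ n)"
    using assms by (intro summable_mult summable_geometric) auto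
qed

text \<open>Volume comparison: the balls of radius d / 2 around the points are disjoint and lie in
  the ball of radius R + d / 2.\<close>

lemma card_separated_le:
  fixes S :: "'a::euclidean_space set"
  assumes S: "finite S" "S \<subseteq> cball a R" "R \<ge> 0" and d: "d > 0"
    and sep: "\<And>x y. x \<in> S \<Longrightarrow> y \<in> S \<Longrightarrow> x \<noteq> y \<Longrightarrow> d \<le> dist x y"
  shows "real (card S) \<le> (1 + 2 * R / d) ^ DIM('a)"
proof -
  define v where "v = unit_ball_vol (real DIM('a))"
  have v: "v > 0" by (simp add: v_def)
  have "measure lebesgue (\<Union>x\<in>S. ball x (d/2)) = (\<Sum>x\<in>S. measure lebesgue (ball x (d/2)))"
  proof (rule measure_UNION'[OF S(1)])
    show "pairwise (\<lambda>x y. disjnt (ball x (d/2)) (ball y (d/2))) S"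
    proof (rule pairwiseI)
      fix x y assume "x \<in> S" "y \<in> S" "x \<noteq> y"
      then have "d \<le> dist x y" by (rule sep)
      then show "disjnt (ball x (d/2)) (ball y (d/2))"
        using disjoint_ballI[of "d/2" "d/2" x y] by (simp add: disjnt_def)
    qed
  qed auto
  also have "\<dots> = real (card S) * (v * (d/2) ^ DIM('a))"
    using d by (simp add: content_ball v_def)
  finally have "real (card S) * (v * (d/2) ^ DIM('a)) = measure lebesgue (\<Union>x\<in>S. ball x (d/2))" by simp
  also have "\<dots> \<le> measure lebesgue (ball a (R + d/2))"
  proof (rule measure_mono_fmeasurable)
    show "(\<Union>x\<in>S. ball x (d/2)) \<subseteq> ball a (R + d/2)"
    proof
      fix y assume "y \<in> (\<Union>x\<in>S. ball x (d/2))"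
      then obtain x where "x \<in> S" "dist x y < d/2" by auto
      then have "dist a x \<le> R" using S by auto
      then show "y \<in> ball a (R + d/2)" using dist_triangle[of a y x] \<open>dist x y < d/2\<close> by simp
    qed
  qed (use S(1) in \<open>auto intro!: sets.finite_UN\<close>)
  also have "\<dots> = v * (R + d/2) ^ DIM('a)"
    using S d by (simp add: content_ball v_def)
  finally have "real (card S) * (d/2) ^ DIM('a) \<le> (R + d/2) ^ DIM('a)"
    using v by (simp add: mult.left_commute)
  then have "real (card S) \<le> (R + d/2) ^ DIM('a) / (d/2) ^ DIM('a)"
    using d by (subst pos_le_divide_eq) auto
  also have "\<dots> = ((R + d/2) / (d/2)) ^ DIM('a)" by (rule power_divide[symmetric])
  also have "(R + d/2) / (d/2) = 1 + 2 * R / d" using d by (simp add: field_simps)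
  finally show ?thesis .
qed

text \<open>The Hermitian product, linear in the first argument; its real part is the real inner
  product \<open>inner\<close>.\<close>

definition herm :: "complex^'n \<Rightarrow> complex^'n \<Rightarrow> complex" where
  "herm z w = (\<Sum>i\<in>UNIV. z $ i * cnj (w $ i))"

lemma entire_herm: "entire (\<lambda>z. herm z w)"
  unfolding herm_def by (intro entire_sum entire_mult entire_nth entire_const)

lemma herm_scale_right: "herm z (c *s w) = cnj c * herm z w"
  by (simp add: herm_def sum_distrib_left mult_ac)

lemma herm_scale_left: "herm (c *s z) w = c * herm z w"
  by (simp add: herm_def sum_distrib_left mult_ac)

lemma herm_commute: "herm w z = cnj (herm z w)"
  by (simp add: herm_def mult.commute)

lemma Re_herm: "Re (herm z w) = inner z w"
  by (simp add: herm_def inner_vec_def inner_complex_def)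

lemma herm_self: "herm z z = of_real ((norm z)\<^sup>2)"
proof -
  have "Im (herm z z) = 0" by (simp add: herm_def)
  then show ?thesis using Re_herm[of z z] by (simp add: complex_eq_iff power2_norm_eq_inner)
qed

text \<open>A rotation of w by a phase turns the modulus of the Hermitian product into a real inner
  product, which on the sphere is read off from a distance.\<close>

lemma phase_exists: "\<exists>c. norm c = 1 \<and> herm z (c *s w) = of_real (norm (herm z w))"
proof (cases "herm z w = 0")
  case True
  then show ?thesis by (intro exI[of _ 1]) (simp add: herm_scale_right)
next
  case False
  define h where "h = herm z w"
  have "cnj h * h = of_real (norm h) * of_real (norm h)"
    using complex_norm_square[of h] by (simp add: power2_eq_square mult.commute)
  then show ?thesis using False
    by (intro exI[of _ "h / of_real (norm h)"]) (simp add: herm_scale_right h_def norm_divide)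
qed

lemma norm_herm_le: "norm (herm z w) \<le> norm z * norm w"
proof -
  obtain c where c: "norm c = 1" "herm z (c *s w) = of_real (norm (herm z w))"
    using phase_exists by blast
  have "norm (herm z w) = inner z (c *s w)" using c(2) Re_herm[of z "c *s w"] by simp
  also have "\<dots> \<le> norm z * norm (c *s w)" by (rule norm_cauchy_schwarz)
  finally show ?thesis using c by (simp add: norm_vec_scale)
qed

lemma dist_unit_sq:
  assumes "norm z = 1" "norm w = 1"
  shows "(dist z w)\<^sup>2 = 2 - 2 * Re (herm z w)"
  using assms dot_norm_neg[of z w] by (simp add: Re_herm dist_norm field_simps)

text \<open>Separation is measured by the peak functions themselves: it ignores unimodular factors,
  and where it fails for a new point z, the lower bound 1/2 for some
  \<open>norm (herm z x) ^ n\<close> is immediate.\<close>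

definition peak_separated :: "nat \<Rightarrow> (complex^'n) set \<Rightarrow> bool" where
  "peak_separated n J \<longleftrightarrow> finite J \<and> (\<forall>x\<in>J. norm x = 1) \<and>
     (\<forall>x\<in>J. \<forall>y\<in>J. x \<noteq> y \<longrightarrow> norm (herm x y) ^ n \<le> 1/2)"

text \<open>For s = |<x, y>| Bernoulli's inequality gives 1 - n * (1 - s) \<le> s ^ n \<le> 1/2, so
  2 * (1 - s) \<ge> 1 / n, and the squared distance of unit vectors is at least 2 * (1 - s).\<close>

lemma peak_separated_dist:
  assumes n: "n > 0" and u: "norm x = 1" "norm y = 1" and h: "norm (herm x y) ^ n \<le> 1/2"
  shows "1 / sqrt (real n) \<le> dist x y"
proof -
  define s where "s = norm (herm x y)"
  have s: "0 \<le> s" "s \<le> 1" using norm_herm_le[of x y] u by (auto simp: s_def)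
  have "1 + real n * (s - 1) \<le> (1 + (s - 1)) ^ n" using s by (intro Bernoulli_inequality) auto
  then have "real n * (1 - s) \<ge> 1/2" using h by (simp add: s_def algebra_simps)
  moreover have "(dist x y)\<^sup>2 \<ge> 2 * (1 - s)"
    using dist_unit_sq[OF u] complex_Re_le_cmod[of "herm x y"] by (simp add: s_def)
  moreover have "1 / real n \<le> 2 * (1 - s)" using calculation(1) n by (simp add: field_simps)
  ultimately have "1 / real n \<le> (dist x y)\<^sup>2" by linarith
  then have "sqrt (1 / real n) \<le> dist x y" by (intro real_le_lsqrt) auto
  then show ?thesis by (simp add: real_sqrt_divide)
qed

text \<open>The bound depends on n and only serves to guarantee a separated set of largest
  cardinality.\<close>

lemma peak_separated_card:
  fixes J :: "(complex^'n) set"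
  assumes n: "n > 0" and J: "peak_separated n J"
  shows "real (card J) \<le> (1 + 2 * sqrt n) ^ DIM(complex^'n)"
proof -
  have "real (card J) \<le> (1 + 2 * 1 / (1 / sqrt (real n))) ^ DIM(complex^'n)"
    using J n by (intro card_separated_le[of J 0]) (auto simp: peak_separated_def intro!: peak_separated_dist)
  then show ?thesis by simp
qed

text \<open>After rotating each x to \<open>p x\<close> with nonnegative product with z, the n-th
  power is at most exp (- n * dist ^ 2 / 2). In the shell where n * dist ^ 2 / 2 has integer part k,
  packing at separation 1 / sqrt n leaves polynomially many points in k, with no dependence on
  n.\<close>

lemma peak_separated_sum:
  fixes J :: "(complex^'n) set" and z :: "complex^'n"
  assumes n: "n > 0" and J: "peak_separated n J" and z: "norm z = 1"
  shows "(\<Sum>x\<in>J. norm (herm z x) ^ n) \<le> (\<Sum>k. (4 * real k + 5) ^ DIM(complex^'n) * exp (- 1 * real k))"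
proof -
  let ?D = "DIM(complex^'n)"
  have fin: "finite J" and unit: "\<And>x. x \<in> J \<Longrightarrow> norm x = 1" using J by (auto simp: peak_separated_def)
  obtain c where c: "\<And>x. norm (c x) = 1" "\<And>x. herm z (c x *s x) = of_real (norm (herm z x))"
    using phase_exists[of z] by metis
  define p where "p x = c x *s x" for x
  have pu: "norm (p x) = 1" if "x \<in> J" for x using that unit c by (simp add: p_def norm_vec_scale)
  \<comment> \<open>Separation depends on moduli only, so the rotated points keep their mutual
    distance.\<close>
  have pd: "1 / sqrt n \<le> dist (p x) (p y)" if "x \<in> J" "y \<in> J" "x \<noteq> y" for x y
  proof (rule peak_separated_dist[OF n pu pu])
    have "norm (herm (p x) (p y)) = norm (herm x y)"
      by (simp add: p_def herm_scale_left herm_scale_right norm_mult c)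
    then show "norm (herm (p x) (p y)) ^ n \<le> 1/2" using J that by (simp add: peak_separated_def)
  qed (use that in auto)
  have injp: "inj_on p J"
  proof (rule inj_onI, rule ccontr)
    fix x y assume xy: "x \<in> J" "y \<in> J" "p x = p y" "x \<noteq> y"
    then have "1 / sqrt n \<le> 0" using pd[of x y] by simp
    then show False using n by simp
  qed
  have hx: "norm (herm z x) = 1 - (dist z (p x))\<^sup>2 / 2" if "x \<in> J" for x
    using dist_unit_sq[OF z pu[OF that]] c(2)[of x] by (simp add: p_def diff_divide_distrib)
  define k where "k x = nat \<lfloor>real n * (dist z (p x))\<^sup>2 / 2\<rfloor>" for x
  have kx: "real (k x) \<le> real n * (dist z (p x))\<^sup>2 / 2" "real n * (dist z (p x))\<^sup>2 / 2 < real (k x) + 1" for x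
  proof -
    have "0 \<le> \<lfloor>real n * (dist z (p x))\<^sup>2 / 2\<rfloor>" by simp
    then have "real (k x) = of_int \<lfloor>real n * (dist z (p x))\<^sup>2 / 2\<rfloor>" unfolding k_def by (rule of_nat_nat)
    then show "real (k x) \<le> real n * (dist z (p x))\<^sup>2 / 2" "real n * (dist z (p x))\<^sup>2 / 2 < real (k x) + 1"
      using floor_correct[of "real n * (dist z (p x))\<^sup>2 / 2"] by linarith+
  qed
  have tm: "norm (herm z x) ^ n \<le> exp (- 1 * real (k x))" if "x \<in> J" for x
  proof -
    have "norm (herm z x) \<le> exp (- ((dist z (p x))\<^sup>2 / 2))"
      using hx[OF that] exp_ge_add_one_self[of "- ((dist z (p x))\<^sup>2 / 2)"] by simp
    then have "norm (herm z x) ^ n \<le> exp (- ((dist z (p x))\<^sup>2 / 2)) ^ n" by (intro power_mono) auto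
    also have "\<dots> = exp (- (real n * (dist z (p x))\<^sup>2 / 2))" by (simp flip: exp_of_nat_mult)
    also have "\<dots> \<le> exp (- 1 * real (k x))" using kx(1)[of x] by simp
    finally show ?thesis .
  qed
  have cardk: "real (card {x\<in>J. k x = j}) \<le> (4 * real j + 5) ^ ?D" for j
  proof -
    let ?S = "p ` {x\<in>J. k x = j}"
    define R where "R = sqrt (2 * (real j + 1) / n)"
    have "real (card ?S) \<le> (1 + 2 * R / (1 / sqrt (real n))) ^ ?D"
    proof (rule card_separated_le[of ?S z])
      show "?S \<subseteq> cball z R"
      proof clarify
        fix x assume "x \<in> J" "j = k x"
        then have "(dist z (p x))\<^sup>2 \<le> 2 * (real j + 1) / n" using kx(2)[of x] n by (simp add: field_simps)
        then show "p x \<in> cball z R" by (auto simp: R_def intro: real_le_rsqrt)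
      qed
    qed (use fin pd n in \<open>auto simp: R_def\<close>)
    also have "card ?S = card {x\<in>J. k x = j}"
      by (rule card_image) (rule inj_on_subset[OF injp], auto)
    also have "2 * R / (1 / sqrt (real n)) = 2 * sqrt (2 * (real j + 1))"
      using n by (simp add: R_def real_sqrt_divide)
    also have "(1 + 2 * sqrt (2 * (real j + 1))) ^ ?D \<le> (4 * real j + 5) ^ ?D"
    proof (rule power_mono)
      have "sqrt (2 * (real j + 1)) \<le> 2 * (real j + 1)"
        by (rule real_le_lsqrt) (auto simp: power2_eq_square)
      then show "1 + 2 * sqrt (2 * (real j + 1)) \<le> 4 * real j + 5" by simp
    qed auto
    finally show ?thesis .
  qed
  have "(\<Sum>x\<in>J. norm (herm z x) ^ n) = (\<Sum>j\<in>k ` J. \<Sum>x\<in>{x\<in>J. k x = j}. norm (herm z x) ^ n)"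
    by (rule sum.image_gen[OF fin])
  also have "\<dots> \<le> (\<Sum>j\<in>k ` J. (4 * real j + 5) ^ ?D * exp (- 1 * real j))"
  proof (rule sum_mono)
    fix j
    have "(\<Sum>x\<in>{x\<in>J. k x = j}. norm (herm z x) ^ n) \<le> (\<Sum>x\<in>{x\<in>J. k x = j}. exp (- 1 * real j))"
      using tm by (intro sum_mono) auto
    also have "\<dots> = real (card {x\<in>J. k x = j}) * exp (- 1 * real j)" by simp
    also have "\<dots> \<le> (4 * real j + 5) ^ ?D * exp (- 1 * real j)" by (intro mult_right_mono cardk) auto
    finally show "(\<Sum>x\<in>{x\<in>J. k x = j}. norm (herm z x) ^ n) \<le> (4 * real j + 5) ^ ?D * exp (- 1 * real j)" .
  qed
  also have "\<dots> \<le> (\<Sum>k. (4 * real k + 5) ^ ?D * exp (- 1 * real k))"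
    using fin by (intro sum_le_suminf summable_poly_times_exp) auto
  finally show ?thesis .
qed

lemma exists_unit: "\<exists>x::complex^'n. norm x = 1"
  using vector_choose_size[of 1] by auto

text \<open>
  A maximal separated subset of the sphere: the powers \<open>\<langle>z, x\<rangle>\<^sup>n\<close> decay like Gaussians of width
  \<open>n\<^sup>-\<^sup>1\<^sup>/\<^sup>2\<close>, which is also the separation of the points, so only boundedly many of them interact.
\<close>

proposition peak_family:
  "\<exists>C>0. \<forall>n. \<exists>J::(complex^'n) set. finite J \<and>
     (\<forall>z. \<exists>x\<in>J. norm z ^ n \<le> 2 * norm (herm z x) ^ n) \<and>
     (\<forall>z. (\<Sum>x\<in>J. norm (herm z x) ^ n) \<le> C * norm z ^ n)"
proof -
  define C where "C = (\<Sum>k. (4 * real k + 5) ^ DIM(complex^'n) * exp (- 1 * real k)) + 1"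
  have C0: "(\<Sum>k. (4 * real k + 5) ^ DIM(complex^'n) * exp (- 1 * real k)) \<ge> 0"
    by (intro suminf_nonneg summable_poly_times_exp) auto
  have "\<exists>J::(complex^'n) set. finite J \<and>
     (\<forall>z. \<exists>x\<in>J. norm z ^ n \<le> 2 * norm (herm z x) ^ n) \<and>
     (\<forall>z. (\<Sum>x\<in>J. norm (herm z x) ^ n) \<le> C * norm z ^ n)" for n
  proof (cases "n = 0")
    \<comment> \<open>For n = 0 all powers are 1 and any single point will do; separation could not
      hold for two distinct points.\<close>
    case True
    then show ?thesis using C0 by (intro exI[of _ "{undefined}"]) (auto simp: C_def)
  next
    case False
    then have n: "n > 0" by simp
    have bound: "\<forall>J::(complex^'n) set. peak_separated n J \<longrightarrow>
        card J < Suc (nat \<lfloor>(1 + 2 * sqrt n) ^ DIM(complex^'n)\<rfloor>)"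
      using peak_separated_card[OF n] by (auto intro: le_nat_floor simp: less_Suc_eq_le)
    have empty: "peak_separated n ({} :: (complex^'n) set)" by (auto simp: peak_separated_def)
    obtain J :: "(complex^'n) set" where
      J0: "peak_separated n J \<and> (\<forall>K::(complex^'n) set. peak_separated n K \<longrightarrow> card K \<le> card J)"
      using ex_has_greatest_nat[where f = card, OF empty bound] by (elim exE) (rule that)
    note J = conjunct1[OF J0] conjunct2[OF J0, rule_format]
    have fin: "finite J" using J by (simp add: peak_separated_def)
    have max: "\<exists>x\<in>J. 1 \<le> 2 * norm (herm z x) ^ n" if z: "norm z = 1" for z
    proof (cases "z \<in> J")
      case True
      then show ?thesis using z by (intro bexI[of _ z]) (auto simp: herm_self)
    next
      case False
      \<comment> \<open>If every peak function were small at z, adding z would give a larger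
        separated set.\<close>
      show ?thesis
      proof (rule ccontr)
        assume "\<not> ?thesis"
        then have "\<And>x. x \<in> J \<Longrightarrow> norm (herm z x) ^ n \<le> 1/2" by (auto simp: not_le)
        moreover have "norm (herm x z) = norm (herm z x)" for x by (subst herm_commute) simp
        ultimately have "peak_separated n (insert z J)"
          using J(1) z unfolding peak_separated_def by (metis finite_insert insert_iff)
        then have "card (insert z J) \<le> card J" by (rule J(2))
        then show False using False fin by simp
      qed
    qed
    have ne: "J \<noteq> {}" using max exists_unit by blast
    have scale: "norm (herm z x) ^ n = norm z ^ n * norm (herm ((1 / norm z) *\<^sub>R z) x) ^ n" if "z \<noteq> 0" for z x
      using that by (simp add: of_real_scale_vec[symmetric] herm_scale_left norm_mult norm_divide power_divide)
    have z0: "herm 0 x = 0" for x by (simp add: herm_def)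
    have "\<exists>x\<in>J. norm z ^ n \<le> 2 * norm (herm z x) ^ n" for z
    proof (cases "z = 0")
      case True
      then show ?thesis using ne n by (auto simp: zero_power)
    next
      case False
      then obtain x where x: "x \<in> J" "1 \<le> 2 * norm (herm ((1 / norm z) *\<^sub>R z) x) ^ n"
        using max[of "(1 / norm z) *\<^sub>R z"] by auto
      then have "norm z ^ n * 1 \<le> norm z ^ n * (2 * norm (herm ((1 / norm z) *\<^sub>R z) x) ^ n)"
        by (intro mult_left_mono) auto
      then show ?thesis using x scale[OF False, of x] by (intro bexI[of _ x]) auto
    qed
    moreover have "(\<Sum>x\<in>J. norm (herm z x) ^ n) \<le> C * norm z ^ n" for z
    proof (cases "z = 0")
      case True
      then show ?thesis using n by (simp add: z0 zero_power)
    next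
      case False
      have "(\<Sum>x\<in>J. norm (herm z x) ^ n) = norm z ^ n * (\<Sum>x\<in>J. norm (herm ((1 / norm z) *\<^sub>R z) x) ^ n)"
        using scale[OF False] by (simp add: sum_distrib_left)
      also have "\<dots> \<le> norm z ^ n * C"
        using peak_separated_sum[OF n J(1), of "(1 / norm z) *\<^sub>R z"] False
        by (intro mult_left_mono) (auto simp: C_def)
      finally show ?thesis by (simp add: mult.commute)
    qed
    ultimately show ?thesis using fin by blast
  qed
  then show ?thesis using C0 by (intro exI[of _ C]) (auto simp: C_def)
qed

text \<open>The bound concerns sums of moduli, so each member and each subsum lies in the growth
  space with norm at most C. Finite, increasing index sets prepare a monotone limit. The constant 13
  * C + 48 serves both estimates: 13 * C from the two summations, 48 = 24 * 2 from the weight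
  comparison and the peak.\<close>

proposition growth_test_family:
  assumes w: "weight_function \<omega>"
  shows "\<exists>(h :: nat \<times> (complex^'n) \<Rightarrow> complex^'n \<Rightarrow> complex) I C. C > 0 \<and> (\<forall>p. entire (h p)) \<and>
     (\<forall>N::nat. finite (I N) \<and> I N \<subseteq> I (Suc N)) \<and>
     (\<forall>N z. (\<Sum>p\<in>I N. norm (h p z)) \<le> C * \<omega> (norm z)) \<and>
     (\<forall>z. \<exists>N. \<exists>p\<in>I N. assoc_weight \<omega> (norm z) \<le> C * norm (h p z))"
proof -
  obtain u T where uT': "\<forall>n. 0 < u n"
    "\<forall>t\<ge>0. \<forall>A. finite A \<and> A \<subseteq> T \<longrightarrow> (\<Sum>n\<in>A. u n * t ^ n) \<le> 13 * \<omega> t"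
    "\<forall>t\<ge>0. \<exists>n\<in>T. assoc_weight \<omega> t \<le> 24 * (u n * t ^ n)"
    using weight_monomial_family[OF w] by (elim exE conjE) (rule that)
  note uT = uT'(1)[rule_format] uT'(2)[rule_format, OF _ conjI] uT'(3)[rule_format]
  obtain C where C: "C > 0" and "\<forall>n. \<exists>J::(complex^'n) set. finite J \<and>
     (\<forall>z. \<exists>x\<in>J. norm z ^ n \<le> 2 * norm (herm z x) ^ n) \<and>
     (\<forall>z. (\<Sum>x\<in>J. norm (herm z x) ^ n) \<le> C * norm z ^ n)"
    using peak_family[where 'n = 'n] by (elim exE conjE) (rule that)
  then obtain J :: "nat \<Rightarrow> (complex^'n) set" where J: "\<And>n. finite (J n)"
     "\<And>n z. \<exists>x\<in>J n. norm z ^ n \<le> 2 * norm (herm z x) ^ n"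
     "\<And>n z. (\<Sum>x\<in>J n. norm (herm z x) ^ n) \<le> C * norm z ^ n"
    by metis
  define h where "h p z = of_real (u (fst p)) * herm z (snd p) ^ fst p" for p :: "nat \<times> (complex^'n)" and z
  define I where "I N = Sigma (T \<inter> {..<N}) J" for N
  have nh: "norm (h (n, x) z) = u n * norm (herm z x) ^ n" for n x z
    using uT(1)[of n] by (simp add: h_def norm_mult norm_power)
  have "(\<Sum>p\<in>I N. norm (h p z)) \<le> (13 * C + 48) * \<omega> (norm z)" for N z
  proof -
    have "(\<Sum>p\<in>I N. norm (h p z)) = (\<Sum>n\<in>T \<inter> {..<N}. \<Sum>x\<in>J n. norm (h (n, x) z))"
      unfolding I_def by (subst sum.Sigma) (auto simp: J)
    also have "\<dots> = (\<Sum>n\<in>T \<inter> {..<N}. u n * (\<Sum>x\<in>J n. norm (herm z x) ^ n))"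
      by (simp add: nh sum_distrib_left)
    also have "\<dots> \<le> (\<Sum>n\<in>T \<inter> {..<N}. u n * (C * norm z ^ n))"
      using uT(1) by (intro sum_mono mult_left_mono J) (auto intro: less_imp_le)
    also have "\<dots> = C * (\<Sum>n\<in>T \<inter> {..<N}. u n * norm z ^ n)" by (simp add: sum_distrib_left mult_ac)
    also have "\<dots> \<le> C * (13 * \<omega> (norm z))" using C by (intro mult_left_mono uT) auto
    also have "\<dots> \<le> (13 * C + 48) * \<omega> (norm z)"
      using weight_function_pos[OF w, of "norm z"] by (simp add: algebra_simps)
    finally show ?thesis .
  qed
  moreover have "\<exists>N. \<exists>p\<in>I N. assoc_weight \<omega> (norm z) \<le> (13 * C + 48) * norm (h p z)" for z
  proof -
    obtain n where n: "n \<in> T" "assoc_weight \<omega> (norm z) \<le> 24 * (u n * norm z ^ n)"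
      using uT(3)[of "norm z"] by auto
    obtain x where x: "x \<in> J n" "norm z ^ n \<le> 2 * norm (herm z x) ^ n" using J(2) by blast
    have "24 * (u n * norm z ^ n) \<le> 24 * (u n * (2 * norm (herm z x) ^ n))"
      using x uT(1)[of n] by (intro mult_left_mono) auto
    also have "\<dots> = 48 * norm (h (n, x) z)" by (simp add: nh)
    also have "\<dots> \<le> (13 * C + 48) * norm (h (n, x) z)" using C by (intro mult_right_mono) auto
    finally show ?thesis using n x
      by (intro exI[of _ "Suc n"] bexI[of _ "(n, x)"]) (auto simp: I_def)
  qed
  moreover have "entire (h p)" for p
    unfolding h_def by (intro entire_mult entire_const entire_power entire_herm)
  moreover have "finite (I N) \<and> I N \<subseteq> I (Suc N)" for N
    by (auto simp: I_def J)
  ultimately show ?thesis using C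
    by (intro exI[of _ h] exI[of _ I] exI[of _ "13 * C + 48"]) auto
qed

section \<open>Local mean value estimates\<close>

lemma powr_le_imp_le:
  fixes a b p :: real
  assumes "a powr p \<le> b powr p" "0 \<le> a" "0 \<le> b" "0 < p"
  shows "a \<le> b"
  using assms powr_less_mono2[of p b a] by (meson not_le)

text \<open>Cauchy's estimate bounds the derivative on the smaller ball, and the mean value
  inequality integrates it.\<close>

lemma entire_diff_norm_le:
  fixes F :: "complex^'n \<Rightarrow> complex"
  assumes F: "entire F" and s: "s > 0" and M: "\<And>y. dist x0 y \<le> 2 * s \<Longrightarrow> norm (F y) \<le> M"
    and x: "dist x0 x \<le> s"
  shows "norm (F x - F x0) \<le> M / s * dist x0 x"
proof -
  have "norm (F x - F x0) \<le> M / s * norm (x - x0)"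
  proof (rule differentiable_bound[where S = "cball x0 s" and f' = "cderiv F"])
    show "(F has_derivative cderiv F y) (at y within cball x0 s)" for y
      using entire_has_derivative[OF F] has_derivative_at_withinI by blast
    show "onorm (cderiv F y) \<le> M / s" if "y \<in> cball x0 s" for y
    proof (rule onorm_le)
      fix v
      have "norm (F w) \<le> M" if "dist y w \<le> s" for w
        using that \<open>y \<in> cball x0 s\<close> dist_triangle[of x0 w y] by (intro M) simp
      then show "norm (cderiv F y v) \<le> M / s * norm v"
        using cderiv_norm_le[OF F s, of y M v] by simp
    qed
  qed (use s x in auto)
  then show ?thesis by (simp add: dist_norm norm_minus_commute)
qed

text \<open>
  At a maximum point \<open>x\<close> of \<open>(r - |w - z|)\<^sup>D |F w|\<^sup>p\<close> the function is of size \<open>O(|F x|)\<close> on a ball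
  comparable with the distance to the sphere, so Cauchy's estimate keeps \<open>|F|\<close> above \<open>|F x| / 2\<close> on
  a fixed proportion of it. This needs no subharmonicity and treats all exponents \<open>p\<close> at once.
\<close>

proposition local_mean_value:
  fixes p :: real
  assumes p: "p > 0"
  shows "\<exists>C>0. \<forall>(F :: complex^'n \<Rightarrow> complex) z r. entire F \<longrightarrow> 0 < r \<longrightarrow>
     ennreal (norm (F z) powr p * r ^ DIM(complex^'n)) \<le>
     ennreal C * (\<integral>\<^sup>+w. indicator (ball z r) w * ennreal (norm (F w) powr p) \<partial>lborel)"
proof -
  define D where "D = DIM(complex^'n)"
  define v where "v = unit_ball_vol (real D)"
  have v: "v > 0" by (simp add: v_def)
  have vol: "emeasure lborel (ball (x::complex^'n) r) = ennreal (v * r ^ D)" if "r \<ge> 0" for x r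
    using emeasure_ball[of r x] that by (simp add: v_def D_def)
  \<comment> \<open>On the ball of radius s around x the distance to the sphere at most halves, so
    maximality gives |F y| ^ p \<le> 2 ^ D * |F x| ^ p, that is |F y| \<le> A * |F x|.\<close>
  define A where "A = 2 powr (real D / p)"
  have A: "A \<ge> 1" unfolding A_def using p by (intro ge_one_powr_ge_zero) auto
  have Ap: "A powr p = 2 ^ D" using p by (simp add: A_def powr_powr powr_realpow)
  \<comment> \<open>With slope A * |F x| / (s / 2) the function varies by at most |F x| / 2 over the
    distance c * s.\<close>
  define c where "c = 1 / (4 * A)"
  have c: "0 < c" "c \<le> 1/2" using A by (auto simp: c_def field_simps)
  define C where "C = 2 powr p * (2 / c) ^ D / v"
  have C: "C > 0" using v c by (simp add: C_def)
  have "ennreal (norm (F z) powr p * r ^ D) \<le>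
     ennreal C * (\<integral>\<^sup>+w. indicator (ball z r) w * ennreal (norm (F w) powr p) \<partial>lborel)"
    if F: "entire F" and r: "0 < r" for F :: "complex^'n \<Rightarrow> complex" and z r
  proof (cases "F z = 0")
    case True
    then show ?thesis by simp
  next
    case False
    define a where "a x = (r - dist z x) ^ D * norm (F x) powr p" for x
    have "continuous_on (cball z r) a" unfolding a_def
      using p by (intro continuous_intros continuous_on_powr' entire_continuous_on[OF F]) auto
    then obtain x where x: "x \<in> cball z r" "\<And>y. y \<in> cball z r \<Longrightarrow> a y \<le> a x"
      using continuous_attains_sup[of "cball z r" a] r by auto
    have az: "a z = r ^ D * norm (F z) powr p" by (simp add: a_def)
    also have "\<dots> > 0" using r False by simp
    finally have "a x > 0" using x(2)[of z] r by simp
    then have "r - dist z x \<noteq> 0" "F x \<noteq> 0"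
      using DIM_positive[where 'a = "complex^'n"] p unfolding a_def D_def by (auto simp: zero_power)
    then have xr: "dist z x < r" "F x \<noteq> 0" using x(1) by auto
    define s where "s = (r - dist z x) / 2"
    have s: "s > 0" using xr by (simp add: s_def)
    have s2: "r - dist z x = 2 * s" by (simp add: s_def)
    have bound: "norm (F y) \<le> A * norm (F x)" if "dist x y \<le> s" for y
    proof -
      have t: "dist z y \<le> dist z x + dist x y" by (rule dist_triangle)
      then have sy: "s \<le> r - dist z y" using that s2 by linarith
      then have "s ^ D * norm (F y) powr p \<le> a y" unfolding a_def
        using s sy by (intro mult_right_mono power_mono) auto
      also have "\<dots> \<le> a x" using sy s by (intro x(2)) simp
      also have "\<dots> = s ^ D * (2 ^ D * norm (F x) powr p)"
        unfolding a_def s2 by (simp add: power_mult_distrib)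
      finally have "norm (F y) powr p \<le> 2 ^ D * norm (F x) powr p" using s by simp
      also have "\<dots> = (A * norm (F x)) powr p" using A by (simp add: powr_mult Ap)
      finally have q: "norm (F y) powr p \<le> (A * norm (F x)) powr p" .
      show ?thesis by (rule powr_le_imp_le[OF q]) (use A p in auto)
    qed
    have half: "norm (F x) / 2 \<le> norm (F y)" if "dist x y < c * s" for y
    proof -
      have cs: "c * s \<le> s / 2" using c s mult_right_mono[of c "1/2" s] by simp
      have "dist x y \<le> s / 2" using that cs by linarith
      then have "norm (F y - F x) \<le> A * norm (F x) / (s / 2) * dist x y"
        using s by (intro entire_diff_norm_le[OF F]) (auto intro: bound)
      also have "\<dots> \<le> A * norm (F x) / (s / 2) * (c * s)"
        using A s that by (intro mult_left_mono) auto
      also have "\<dots> = norm (F x) / 2" using A s by (simp add: c_def field_simps)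
      finally show ?thesis using norm_triangle_ineq3[of "F y" "F x"] by linarith
    qed
    have sub: "ball x (c * s) \<subseteq> ball z r"
    proof
      fix y assume "y \<in> ball x (c * s)"
      then have "dist x y < c * s" by simp
      moreover have "c * s \<le> s" using c s by simp
      moreover have "dist z x + 2 * s = r" using s2 by linarith
      ultimately have "dist z y < r" using dist_triangle[of z y x] s by linarith
      then show "y \<in> ball z r" by simp
    qed
    have "norm (F z) powr p * r ^ D \<le> a x" using x(2)[of z] r az by (simp add: mult.commute)
    also have "\<dots> = (2 * s) ^ D * norm (F x) powr p" unfolding a_def s2 ..
    also have "\<dots> = C * ((norm (F x) / 2) powr p * (v * (c * s) ^ D))"
      using v c by (simp add: C_def powr_divide power_mult_distrib power_divide)
    finally have "ennreal (norm (F z) powr p * r ^ D) \<le>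
        ennreal C * (ennreal ((norm (F x) / 2) powr p) * ennreal (v * (c * s) ^ D))"
      using C v c s by (simp flip: ennreal_mult)
    also have "ennreal ((norm (F x) / 2) powr p) * ennreal (v * (c * s) ^ D) =
        (\<integral>\<^sup>+w. ennreal ((norm (F x) / 2) powr p) * indicator (ball x (c * s)) w \<partial>lborel)"
      using c s by (simp add: nn_integral_cmult_indicator vol)
    also have "\<dots> \<le> (\<integral>\<^sup>+w. indicator (ball z r) w * ennreal (norm (F w) powr p) \<partial>lborel)"
      using half sub p by (intro nn_integral_mono) (auto simp: indicator_def intro!: ennreal_leI powr_mono2)
    finally show ?thesis by (simp add: mult_left_mono)
  qed
  then show ?thesis using C unfolding D_def by blast
qed

definition rad :: "'a::real_normed_vector \<Rightarrow> real" where
  "rad z = 1 / (1 + norm z)"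

lemma rad_pos: "0 < rad z"
  unfolding rad_def by (intro divide_pos_pos add_pos_nonneg) auto

lemma rad_le_1: "rad z \<le> 1"
  by (simp add: rad_def field_simps add_pos_nonneg)

text \<open>The squared norms differ by at most rad z * (2 * |z| + 1), and 3 = 2 + 1 because rad z *
  |z| \<le> 1 and rad z \<le> 1.\<close>

lemma norm_near:
  fixes z w :: "'a::real_normed_vector"
  assumes "dist z w \<le> rad z"
  shows "1 + norm w \<le> 2 * (1 + norm z)" "1 + norm z \<le> 2 * (1 + norm w)"
    "rad z \<le> 2 * rad w" "rad w \<le> 2 * rad z"
    "(norm w)\<^sup>2 \<le> (norm z)\<^sup>2 + 3" "(norm z)\<^sup>2 \<le> (norm w)\<^sup>2 + 3"
proof -
  have d: "\<bar>norm w - norm z\<bar> \<le> rad z"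
    using assms norm_triangle_ineq3[of w z] by (simp add: dist_norm norm_minus_commute)
  then have d1: "\<bar>norm w - norm z\<bar> \<le> 1" using rad_le_1[of z] by linarith
  have d2: "norm w \<le> norm z + 1" "norm z \<le> norm w + 1" using d1 by (auto simp: abs_le_iff)
  show 1: "1 + norm w \<le> 2 * (1 + norm z)"
    using add_mono[OF d2(1) norm_ge_zero[of z]] by simp
  show 2: "1 + norm z \<le> 2 * (1 + norm w)"
    using add_mono[OF d2(2) norm_ge_zero[of w]] by simp
  have "0 < 1 + norm z" "0 < 1 + norm w" by (simp_all add: add_pos_nonneg)
  with 1 2 show "rad z \<le> 2 * rad w" "rad w \<le> 2 * rad z"
    by (simp_all add: rad_def field_simps)
  have "rad z * norm z \<le> 1" by (simp add: rad_def field_simps add_pos_nonneg)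
  have "\<bar>(norm w)\<^sup>2 - (norm z)\<^sup>2\<bar> = \<bar>norm w - norm z\<bar> * (norm w + norm z)"
    by (simp add: power2_eq_square square_diff_square_factored abs_mult mult.commute)
  also have "\<dots> \<le> rad z * (2 * norm z + 1)"
    using d d1 rad_pos[of z] by (intro mult_mono) auto
  also have "\<dots> \<le> 3" using \<open>rad z * norm z \<le> 1\<close> rad_le_1[of z] by (simp add: algebra_simps)
  finally show "(norm w)\<^sup>2 \<le> (norm z)\<^sup>2 + 3" "(norm z)\<^sup>2 \<le> (norm w)\<^sup>2 + 3" by linarith+
qed

text \<open>Tonelli's theorem in the form of a Schur test with a single integral condition; both
  integral estimates below reduce to it.\<close>

lemma nn_integral_kernel_le:
  fixes k :: "'a::euclidean_space \<Rightarrow> 'a \<Rightarrow> ennreal"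
  assumes k: "(\<lambda>p. k (fst p) (snd p)) \<in> borel_measurable borel" and m: "\<Phi> \<in> borel_measurable borel"
    and f: "\<And>z. f z \<le> (\<integral>\<^sup>+y. k z y * \<Phi> y \<partial>lborel)"
    and b: "\<And>y. (\<integral>\<^sup>+z. k z y \<partial>lborel) * \<Phi> y \<le> \<Psi> y"
  shows "(\<integral>\<^sup>+z. f z \<partial>lborel) \<le> (\<integral>\<^sup>+y. \<Psi> y \<partial>lborel)"
proof -
  have k'[measurable]: "(\<lambda>p. k (fst p) (snd p)) \<in> borel_measurable (borel \<Otimes>\<^sub>M borel)"
    using k by (simp add: borel_prod)
  note m[measurable]
  have k1[measurable]: "(\<lambda>z. k z y) \<in> borel_measurable borel" for y
    using measurable_compose[OF measurable_Pair2'[of y] k'] by simp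
  have "(\<integral>\<^sup>+z. f z \<partial>lborel) \<le> (\<integral>\<^sup>+z. \<integral>\<^sup>+y. k z y * \<Phi> y \<partial>lborel \<partial>lborel)"
    by (intro nn_integral_mono f)
  also have "\<dots> = (\<integral>\<^sup>+y. \<integral>\<^sup>+z. k z y * \<Phi> y \<partial>lborel \<partial>lborel)"
    by (rule lborel_pair.Fubini'[symmetric]) (simp add: case_prod_unfold)
  also have "\<dots> = (\<integral>\<^sup>+y. (\<integral>\<^sup>+z. k z y \<partial>lborel) * \<Phi> y \<partial>lborel)"
    by (intro nn_integral_cong nn_integral_multc) simp
  also have "\<dots> \<le> (\<integral>\<^sup>+y. \<Psi> y \<partial>lborel)"
    by (intro nn_integral_mono b)
  finally show ?thesis .
qed

lemma entire_borel_measurable: "entire F \<Longrightarrow> F \<in> borel_measurable borel"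
  by (rule borel_measurable_continuous_onI[OF entire_continuous_on])

lemma ennreal_mult3: "0 \<le> a \<Longrightarrow> 0 \<le> b \<Longrightarrow> 0 \<le> c \<Longrightarrow> ennreal a * (ennreal b * ennreal c) = ennreal (a * (b * c))"
  by (simp add: ennreal_mult)

lemma nn_integral_ball_cmult:
  fixes F :: "complex^'n \<Rightarrow> complex"
  assumes "entire F"
  shows "a * (b * (\<integral>\<^sup>+y. indicator (ball w r) y * ennreal (norm (F y) powr p) \<partial>lborel)) =
    (\<integral>\<^sup>+y. a * (b * (indicator (ball w r) y * ennreal (norm (F y) powr p))) \<partial>lborel)"
proof -
  have "(\<lambda>y. norm (F y) powr p) \<in> borel_measurable borel"
    using entire_borel_measurable[OF assms] by measurable
  from measurable_compose[OF this measurable_ennreal]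
  have m: "(\<lambda>y. indicator (ball w r) y * ennreal (norm (F y) powr p)) \<in> borel_measurable lborel"
    by (intro borel_measurable_times_ennreal borel_measurable_indicator) auto
  then have m': "(\<lambda>y. b * (indicator (ball w r) y * ennreal (norm (F y) powr p))) \<in> borel_measurable lborel"
    by simp
  show ?thesis unfolding nn_integral_cmult[OF m'] nn_integral_cmult[OF m] ..
qed

section \<open>A Littlewood--Paley formula for Fock spaces\<close>

text \<open>Cauchy's estimate with radius rad z / 2 produces the factor |z| * (1 + |z|), which is
  where the square in the density comes from. Half the radius is kept so that a further ball around
  w remains within rad z of z.\<close>

lemma radial_derivative_norm_le:
  fixes F :: "complex^'n \<Rightarrow> complex"
  assumes F: "entire F"
  shows "\<exists>w. dist z w \<le> rad z / 2 \<and> norm (cderiv F z z) \<le> 2 * (1 + norm z)\<^sup>2 * norm (F w)"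
proof -
  have r: "rad z > 0" by (rule rad_pos)
  obtain w where w: "w \<in> cball z (rad z / 2)" "\<And>y. y \<in> cball z (rad z / 2) \<Longrightarrow> norm (F y) \<le> norm (F w)"
    using continuous_attains_sup[of "cball z (rad z / 2)" "\<lambda>y. norm (F y)"] r
      continuous_on_norm[OF entire_continuous_on[OF F]] by auto
  have "norm (cderiv F z z) \<le> norm (F w) * norm z / (rad z / 2)"
    using r w by (intro cderiv_norm_le[OF F]) auto
  also have "\<dots> = 2 * (norm z * (1 + norm z)) * norm (F w)" by (simp add: rad_def)
  also have "\<dots> \<le> 2 * (1 + norm z)\<^sup>2 * norm (F w)"
    by (intro mult_right_mono) (auto simp: power2_eq_square algebra_simps)
  finally show ?thesis using w by auto
qed

text \<open>The p-th power at the maximum point of Cauchy's estimate is at most a mean over a ball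
  near z. There the Gaussian and \<open>rad\<close> are constant up to factors, so exchanging the
  integrals costs only the volume of a ball of radius comparable with \<open>rad y\<close>, which
  cancels the normalisation of the mean.\<close>

proposition radial_derivative_Lp_bound:
  fixes p \<beta> :: real
  assumes p: "p > 0" and b: "\<beta> \<ge> 0"
  shows "\<exists>C>0. \<forall>F :: complex^'n \<Rightarrow> complex. entire F \<longrightarrow>
     (\<integral>\<^sup>+z. ennreal ((norm (cderiv F z z) / (1 + norm z)\<^sup>2 * exp (- \<beta> * (norm z)\<^sup>2)) powr p) \<partial>lborel)
     \<le> ennreal C * (\<integral>\<^sup>+z. ennreal (norm (F z) powr p * exp (- (p * \<beta>) * (norm z)\<^sup>2)) \<partial>lborel)"
proof -
  define D where "D = DIM(complex^'n)"
  obtain C0 where C0: "C0 > 0" "\<And>(F :: complex^'n \<Rightarrow> complex) z r. entire F \<Longrightarrow> 0 < r \<Longrightarrow>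
     ennreal (norm (F z) powr p * r ^ D) \<le>
     ennreal C0 * (\<integral>\<^sup>+w. indicator (ball z r) w * ennreal (norm (F w) powr p) \<partial>lborel)"
    using local_mean_value[OF p, where 'n = 'n] unfolding D_def by blast
  define v where "v = unit_ball_vol (real D)"
  have v: "v > 0" by (simp add: v_def)
  have vol: "emeasure lborel (ball (x::complex^'n) r) = ennreal (v * r ^ D)" if "r \<ge> 0" for x r
    using emeasure_ball[of r x] that by (simp add: v_def D_def)
  \<comment> \<open>The factors come from Cauchy's estimate, the mean value, the change of the
    Gaussian, and rad y / 4 \<le> rad z / 2 in dimension D.\<close>
  define C1 where "C1 = 2 powr p * C0 * exp (3 * (p * \<beta>)) * 4 ^ D"
  have C1: "C1 > 0" using C0 by (simp add: C1_def)
  define C where "C = C1 * (v * 2 ^ D)"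
  have "(\<integral>\<^sup>+z. ennreal ((norm (cderiv F z z) / (1 + norm z)\<^sup>2 * exp (- \<beta> * (norm z)\<^sup>2)) powr p) \<partial>lborel)
     \<le> ennreal C * (\<integral>\<^sup>+z. ennreal (norm (F z) powr p * exp (- (p * \<beta>) * (norm z)\<^sup>2)) \<partial>lborel)"
    if F: "entire F" for F :: "complex^'n \<Rightarrow> complex"
  proof -
    define E where "E y = norm (F y) powr p * exp (- (p * \<beta>) * (norm y)\<^sup>2)" for y
    have E0: "E y \<ge> 0" for y by (simp add: E_def)
    have Em[measurable]: "E \<in> borel_measurable borel"
      unfolding E_def using entire_borel_measurable[OF F] by measurable
    \<comment> \<open>The radius is expressed through the second variable so that, for fixed y, the
      kernel is the indicator of a ball in z.\<close>
    define k where "k z y = (indicator {q. dist (fst q) (snd q) < 2 * rad (snd q)} (z, y) :: ennreal)"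
      for z y :: "complex^'n"
    define \<Phi> where "\<Phi> y = ennreal (C1 / rad y ^ D * E y)" for y
    have "(\<integral>\<^sup>+z. ennreal ((norm (cderiv F z z) / (1 + norm z)\<^sup>2 * exp (- \<beta> * (norm z)\<^sup>2)) powr p) \<partial>lborel)
       \<le> (\<integral>\<^sup>+y. ennreal C * ennreal (E y) \<partial>lborel)"
    proof (rule nn_integral_kernel_le[where k = k and \<Phi> = \<Phi>])
      have "open {q::(complex^'n) \<times> (complex^'n). dist (fst q) (snd q) < 2 * rad (snd q)}"
        unfolding rad_def
        by (intro open_Collect_less continuous_intros) (auto simp: add_nonneg_eq_0_iff)
      then show "(\<lambda>q. k (fst q) (snd q)) \<in> borel_measurable borel" unfolding k_def by simp
      show "\<Phi> \<in> borel_measurable borel" unfolding \<Phi>_def rad_def by measurable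
      show "(\<integral>\<^sup>+z. k z y \<partial>lborel) * \<Phi> y \<le> ennreal C * ennreal (E y)" for y
      proof -
        have "(\<integral>\<^sup>+z. k z y \<partial>lborel) = (\<integral>\<^sup>+z. indicator (ball y (2 * rad y)) z \<partial>lborel)"
          by (intro nn_integral_cong) (auto simp: k_def indicator_def dist_commute)
        also have "\<dots> = ennreal (v * (2 * rad y) ^ D)"
          using rad_pos[of y] by (simp add: vol)
        finally have ky: "(\<integral>\<^sup>+z. k z y \<partial>lborel) = ennreal (v * (2 * rad y) ^ D)" .
        have "(\<integral>\<^sup>+z. k z y \<partial>lborel) * \<Phi> y = ennreal (v * (2 * rad y) ^ D * (C1 / rad y ^ D * E y))"
          unfolding \<Phi>_def ky using v rad_pos[of y] C1 E0[of y] by (intro ennreal_mult[symmetric]) auto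
        also have "v * (2 * rad y) ^ D * (C1 / rad y ^ D * E y) = C * E y"
          using rad_pos[of y] by (simp add: C_def power_mult_distrib)
        finally show ?thesis using C1 v E0[of y] by (simp add: C_def ennreal_mult)
      qed
      fix z :: "complex^'n"
      have r: "rad z > 0" by (rule rad_pos)
      obtain w where w: "dist z w \<le> rad z / 2" "norm (cderiv F z z) \<le> 2 * (1 + norm z)\<^sup>2 * norm (F w)"
        using radial_derivative_norm_le[OF F] by blast
      define Q where "Q = 2 powr p * exp (- (p * \<beta>) * (norm z)\<^sup>2) / (rad z / 2) ^ D"
      have Q: "Q \<ge> 0" using r by (simp add: Q_def)
      have "1 + norm z > 0" by (simp add: add_pos_nonneg)
      then have zp: "0 < (1 + norm z)\<^sup>2" by simp
      have "(norm (cderiv F z z) / (1 + norm z)\<^sup>2 * exp (- \<beta> * (norm z)\<^sup>2)) powr p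
          \<le> (2 * norm (F w) * exp (- \<beta> * (norm z)\<^sup>2)) powr p"
        using w zp p by (intro powr_mono2 mult_right_mono) (auto simp: divide_le_eq mult_ac)
      also have "\<dots> = (2 powr p * exp (- (p * \<beta>) * (norm z)\<^sup>2)) * norm (F w) powr p"
        by (simp add: powr_mult exp_powr_real mult_ac)
      also have "\<dots> = Q * (norm (F w) powr p * (rad z / 2) ^ D)"
        using r by (simp add: Q_def)
      finally have "ennreal ((norm (cderiv F z z) / (1 + norm z)\<^sup>2 * exp (- \<beta> * (norm z)\<^sup>2)) powr p)
          \<le> ennreal Q *
             ennreal (norm (F w) powr p * (rad z / 2) ^ D)"
        using r Q by (simp add: ennreal_leI flip: ennreal_mult)
      also have "\<dots> \<le> ennreal Q *
          (ennreal C0 * (\<integral>\<^sup>+y. indicator (ball w (rad z / 2)) y * ennreal (norm (F y) powr p) \<partial>lborel))"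
        using r by (intro mult_left_mono C0 F) auto
      also have "\<dots> = (\<integral>\<^sup>+y. ennreal Q *
          (ennreal C0 * (indicator (ball w (rad z / 2)) y * ennreal (norm (F y) powr p))) \<partial>lborel)"
        by (rule nn_integral_ball_cmult[OF F])
      also have "\<dots> \<le> (\<integral>\<^sup>+y. k z y * \<Phi> y \<partial>lborel)"
      proof (rule nn_integral_mono)
        fix y
        show "ennreal Q *
          (ennreal C0 * (indicator (ball w (rad z / 2)) y * ennreal (norm (F y) powr p))) \<le> k z y * \<Phi> y"
        proof (cases "y \<in> ball w (rad z / 2)")
          case False
          then show ?thesis by simp
        next
          case True
          then have d: "dist z y < rad z" using w(1) dist_triangle[of z y w] by simp
          note near = norm_near[OF less_imp_le[OF d]]
          have "Q * (C0 * norm (F y) powr p)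
              = (2 powr p * C0 * norm (F y) powr p) * (exp (- (p * \<beta>) * (norm z)\<^sup>2) * (1 / (rad z / 2) ^ D))"
            by (simp add: Q_def)
          also have "\<dots> \<le> (2 powr p * C0 * norm (F y) powr p) *
             (exp (3 * (p * \<beta>) - (p * \<beta>) * (norm y)\<^sup>2) * (1 / (rad y / 4) ^ D))"
          proof (intro mult_left_mono mult_mono)
            have "p * \<beta> * (norm y)\<^sup>2 \<le> p * \<beta> * ((norm z)\<^sup>2 + 3)"
              using near p b by (intro mult_left_mono) auto
            then show "exp (- (p * \<beta>) * (norm z)\<^sup>2) \<le> exp (3 * (p * \<beta>) - (p * \<beta>) * (norm y)\<^sup>2)"
              by (simp add: algebra_simps)
            show "1 / (rad z / 2) ^ D \<le> 1 / (rad y / 4) ^ D"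
              using near rad_pos[of y] r by (intro divide_left_mono power_mono) auto
          qed (use C0 r in auto)
          also have "\<dots> = C1 / rad y ^ D * E y"
            by (simp add: C1_def E_def exp_diff exp_minus power_divide field_simps)
          finally have "ennreal (Q * (C0 * norm (F y) powr p)) \<le> \<Phi> y"
            unfolding \<Phi>_def by (rule ennreal_leI)
          moreover have "k z y = 1" using d near by (simp add: k_def)
          moreover have "ennreal Q *
              (ennreal C0 * ennreal (norm (F y) powr p)) =
              ennreal (Q * (C0 * norm (F y) powr p))"
            using C0(1) Q by (intro ennreal_mult3) auto
          ultimately show ?thesis using True by simp
        qed
      qed
      finally show "ennreal ((norm (cderiv F z z) / (1 + norm z)\<^sup>2 * exp (- \<beta> * (norm z)\<^sup>2)) powr p)
          \<le> (\<integral>\<^sup>+y. k z y * \<Phi> y \<partial>lborel)" .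
    qed
    also have "\<dots> = ennreal C * (\<integral>\<^sup>+y. ennreal (E y) \<partial>lborel)"
      by (rule nn_integral_cmult) simp
    finally show ?thesis by (simp add: E_def)
  qed
  moreover have "C > 0" using C1 v by (simp add: C_def)
  ultimately show ?thesis by blast
qed

text \<open>Near the origin G 0 = 0 compensates 1 / t: Cauchy's estimate on the ball of radius 2
  gives |G w| \<le> K * |w| for |w| \<le> 1. Further out the weight (1 + t * |z|) ^ 2 / t is at most
  4 * t * |z| ^ 2, up to a constant the factor that makes the Gaussian integrand an exact
  derivative.\<close>

lemma radial_primitive_norm_le:
  fixes G :: "complex^'n \<Rightarrow> complex"
  assumes G: "entire G" and G0: "G 0 = 0" and b: "\<beta> > 0"
    and near: "\<And>w. norm w \<le> 2 \<Longrightarrow> norm (G w) \<le> K"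
    and far: "\<And>t. 0 \<le> t \<Longrightarrow> t \<le> 1 \<Longrightarrow>
       norm (G (t *\<^sub>R z)) \<le> K * ((1 + t * norm z)\<^sup>2 * exp (\<beta> * (t * norm z)\<^sup>2))"
  shows "norm (integral {0..1} (\<lambda>t. G (t *\<^sub>R z) / of_real t)) \<le> (4 + 2 / \<beta>) * K * exp (\<beta> * (norm z)\<^sup>2)"
proof -
  define x where "x = norm z"
  have x: "x \<ge> 0" by (simp add: x_def)
  have K: "K \<ge> 0" using order_trans[OF norm_ge_zero near[of 0]] by simp
  \<comment> \<open>One majorant for both ranges avoids splitting at t = 1 / x; its two summands
    have an arctangent and an exponential as primitives.\<close>
  define b where "b t = 2 * K * (x / (1 + (t * x)\<^sup>2)) + 4 * K * (t * x\<^sup>2 * exp (\<beta> * (t * x)\<^sup>2))" for t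
  define B where "B t = 2 * K * arctan (t * x) + 2 * K / \<beta> * exp (\<beta> * (t * x)\<^sup>2)" for t
  have bb: "\<beta> * inverse \<beta> = 1" using b by simp
  have "(b has_integral (B 1 - B 0)) {0..1}"
  proof (rule fundamental_theorem_of_calculus)
    fix t :: real
    have ne: "1 + (t * x)\<^sup>2 \<noteq> 0" by (metis add_pos_nonneg less_numeral_extra(1,3) zero_le_power2)
    have "(B has_real_derivative b t) (at t within {0..1})"
      unfolding B_def b_def
      by (auto intro!: derivative_eq_intros simp: power2_eq_square divide_inverse bb mult_ac)
    then show "(B has_vector_derivative b t) (at t within {0..1})"
      by (rule has_real_derivative_iff_has_vector_derivative[THEN iffD1])
  qed simp
  then have bint: "b integrable_on {0..1}" "integral {0..1} b = B 1 - B 0"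
    by (auto simp: has_integral_integral integral_unique has_integral_integrable)
  have Gsmall: "norm (G w) \<le> K * norm w" if "norm w \<le> 1" for w
  proof -
    have "norm (G w - G 0) \<le> K / 1 * dist 0 w"
      using that by (intro entire_diff_norm_le[OF G] near) auto
    then show ?thesis using G0 by simp
  qed
  have "norm (integral {0..1} (\<lambda>t. G (t *\<^sub>R z) / of_real t)) \<le> integral {0..1} b"
  proof (rule integral_norm_bound_integral[OF radial_primitive_integrable[OF G G0] bint(1)])
    fix t :: real assume t: "t \<in> {0..1}"
    have p: "0 < 1 + (t * x)\<^sup>2" by (rule add_pos_nonneg) auto
    have b2: "0 \<le> 4 * K * (t * x\<^sup>2 * exp (\<beta> * (t * x)\<^sup>2))" using K t by simp
    have b1: "0 \<le> 2 * K * (x / (1 + (t * x)\<^sup>2))" using K x p by simp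
    show "norm (G (t *\<^sub>R z) / of_real t) \<le> b t"
    proof (cases "t = 0")
      case True
      then show ?thesis using b1 b2 by (simp add: b_def)
    next
      case False
      then have t0: "t > 0" using t by simp
      have ng: "norm (G (t *\<^sub>R z) / of_real t) = norm (G (t *\<^sub>R z)) / t"
        using t0 by (simp add: norm_divide)
      show ?thesis
      proof (cases "t * x \<le> 1")
        case True
        then have "norm (G (t *\<^sub>R z)) \<le> K * (t * x)"
          using Gsmall[of "t *\<^sub>R z"] t0 by (simp add: x_def)
        then have "norm (G (t *\<^sub>R z)) / t \<le> K * x" using t0 by (simp add: field_simps)
        also have "K * x \<le> 2 * K * (x / (1 + (t * x)\<^sup>2))"
        proof -
          have "(t * x)\<^sup>2 \<le> 1" using True t0 x by (simp add: power_le_one)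
          then have "K * x * (1 + (t * x)\<^sup>2) \<le> K * x * 2" using K x by (intro mult_left_mono) auto
          then show ?thesis using p by (simp add: field_simps)
        qed
        finally show ?thesis using b2 ng by (simp add: b_def)
      next
        case False
        have "(1 + t * x)\<^sup>2 \<le> (2 * (t * x))\<^sup>2" using False by (intro power_mono) auto
        then have "K * ((1 + t * x)\<^sup>2 * exp (\<beta> * (t * x)\<^sup>2)) \<le> K * ((2 * (t * x))\<^sup>2 * exp (\<beta> * (t * x)\<^sup>2))"
          using K by (intro mult_left_mono mult_right_mono) auto
        with far[of t] t have "norm (G (t *\<^sub>R z)) \<le> K * ((2 * (t * x))\<^sup>2 * exp (\<beta> * (t * x)\<^sup>2))"
          by (simp add: x_def)
        also have "\<dots> = 4 * K * (t * x\<^sup>2 * exp (\<beta> * (t * x)\<^sup>2)) * t"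
          by (simp add: power2_eq_square)
        finally have "norm (G (t *\<^sub>R z)) / t \<le> 4 * K * (t * x\<^sup>2 * exp (\<beta> * (t * x)\<^sup>2))"
          using t0 by (simp add: pos_divide_le_eq)
        then show ?thesis using b1 ng by (simp add: b_def)
      qed
    qed
  qed
  also have "\<dots> = 2 * K * arctan x + 2 * K / \<beta> * exp (\<beta> * x\<^sup>2) - 2 * K / \<beta>"
    by (simp add: bint B_def)
  also have "\<dots> \<le> 4 * K * exp (\<beta> * x\<^sup>2) + 2 * K / \<beta> * exp (\<beta> * x\<^sup>2)"
  proof -
    have "arctan x \<le> 2" using arctan_ubound[of x] pi_less_4 by linarith
    then have "2 * K * arctan x \<le> 2 * K * 2" using K by (intro mult_left_mono) auto
    also have "\<dots> \<le> 4 * K * exp (\<beta> * x\<^sup>2)"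
      using K b mult_left_mono[of 1 "exp (\<beta> * x\<^sup>2)" "4 * K"] by simp
    moreover have "2 * K / \<beta> \<ge> 0" using K b by simp
    ultimately show ?thesis by linarith
  qed
  also have "\<dots> = (4 + 2 / \<beta>) * K * exp (\<beta> * (norm z)\<^sup>2)"
    by (simp add: x_def algebra_simps)
  finally show ?thesis .
qed

section \<open>Coverings by balls and Gaussian integrals\<close>

lemma nn_integral_cover_balls:
  fixes x :: "nat \<Rightarrow> 'a::euclidean_space"
  assumes cov: "\<And>z. f z \<noteq> 0 \<Longrightarrow> \<exists>k. z \<in> cball (x k) (\<rho> k) \<and> f z \<le> ennreal (b k)"
    and nn: "\<And>k. 0 \<le> \<rho> k" "\<And>k. 0 \<le> b k"
    and c: "\<And>k. b k * (unit_ball_vol (real DIM('a)) * \<rho> k ^ DIM('a)) \<le> c k" "summable c"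
  shows "(\<integral>\<^sup>+z. f z \<partial>lborel) \<le> ennreal (suminf c)"
proof -
  have "(\<integral>\<^sup>+z. f z \<partial>lborel) \<le> (\<integral>\<^sup>+z. (\<Sum>k. ennreal (b k) * indicator (cball (x k) (\<rho> k)) z) \<partial>lborel)"
  proof (rule nn_integral_mono)
    fix z
    show "f z \<le> (\<Sum>k. ennreal (b k) * indicator (cball (x k) (\<rho> k)) z)"
    proof (cases "f z = 0")
      case False
      then obtain k where k: "z \<in> cball (x k) (\<rho> k)" "f z \<le> ennreal (b k)" using cov by blast
      have "f z \<le> (\<Sum>j\<in>{k}. ennreal (b j) * indicator (cball (x j) (\<rho> j)) z)" using k by simp
      also have "\<dots> \<le> (\<Sum>k. ennreal (b k) * indicator (cball (x k) (\<rho> k)) z)"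
        by (rule sum_le_suminf) (auto intro: summableI)
      finally show ?thesis .
    qed simp
  qed
  also have "\<dots> = (\<Sum>k. \<integral>\<^sup>+z. ennreal (b k) * indicator (cball (x k) (\<rho> k)) z \<partial>lborel)"
    by (intro nn_integral_suminf borel_measurable_times_ennreal borel_measurable_indicator) auto
  also have "\<dots> = (\<Sum>k. ennreal (b k * (unit_ball_vol (real DIM('a)) * \<rho> k ^ DIM('a))))"
    using nn by (simp add: nn_integral_cmult_indicator emeasure_cball ennreal_mult)
  also have "\<dots> \<le> (\<Sum>k. ennreal (c k))"
    using c(1) by (intro suminf_le ennreal_leI summableI)
  also have "\<dots> = ennreal (suminf c)"
  proof (rule suminf_ennreal2[OF _ c(2)])
    show "0 \<le> c k" for k
      by (rule order_trans[OF _ c(1)]) (use nn in \<open>auto intro!: mult_nonneg_nonneg\<close>)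
  qed
  finally show ?thesis .
qed

text \<open>Concentric balls of radius k + 1 with k the integer part of |z|; k \<le> k ^ 2 \<le> |z|
  ^ 2 makes the decay exponential in k.\<close>

lemma nn_integral_gaussian_finite:
  fixes c :: real
  assumes c: "c > 0"
  shows "\<exists>M. (\<integral>\<^sup>+z. ennreal (exp (- c * (norm z)\<^sup>2)) \<partial>(lborel :: 'a::euclidean_space measure)) \<le> ennreal M"
proof -
  define v where "v = unit_ball_vol (real DIM('a))"
  let ?c = "\<lambda>k. v * ((1 * real k + 1) ^ DIM('a) * exp (- c * real k))"
  have "(\<integral>\<^sup>+z. ennreal (exp (- c * (norm z)\<^sup>2)) \<partial>(lborel :: 'a measure)) \<le> ennreal (suminf ?c)"
  proof (rule nn_integral_cover_balls[where x = "\<lambda>_. 0" and \<rho> = "\<lambda>k. real k + 1" and b = "\<lambda>k. exp (- c * real k)"])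
    fix z :: 'a
    define k where "k = nat \<lfloor>norm z\<rfloor>"
    have "real k = of_int \<lfloor>norm z\<rfloor>" unfolding k_def by simp
    then have k: "real k \<le> norm z" "norm z \<le> real k + 1" by linarith+
    have "real k \<le> (real k)\<^sup>2" by (cases k) (auto simp: power2_eq_square)
    also have "\<dots> \<le> (norm z)\<^sup>2" using k by (intro power_mono) auto
    finally have "exp (- c * (norm z)\<^sup>2) \<le> exp (- c * real k)" using c by simp
    then show "\<exists>k. z \<in> cball 0 (real k + 1) \<and> ennreal (exp (- c * (norm z)\<^sup>2)) \<le> ennreal (exp (- c * real k))"
      using k by (intro exI[of _ k]) (auto intro: ennreal_leI)
  next
    show "summable ?c" using c by (intro summable_mult summable_poly_times_exp) auto
  qed (auto simp: v_def)
  then show ?thesis by blast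
qed

text \<open>
  The points \<open>z\<close> whose segment \<open>[0, z]\<close> passes within \<open>rad\<close> of \<open>y\<close> form a thin cone with vertex
  near \<open>y\<close>. It is covered by the balls of radius \<open>5 s rad y\<close> around \<open>s y\<close>,
  \<open>s = 1 + k (rad y)\<^sup>2\<close>; consecutive balls lose a factor in the Gaussian weight.
\<close>

definition shadow :: "((complex^'n) \<times> (complex^'n)) set" where
  "shadow = {q. norm (snd q) < 5} \<union> (\<Union>t\<in>{0..1}. {q. dist (t *\<^sub>R fst q) (snd q) < rad (t *\<^sub>R fst q)})"

lemma open_shadow: "open (shadow :: ((complex^'n) \<times> (complex^'n)) set)"
  unfolding shadow_def rad_def
  by (intro open_Un open_UN ballI open_Collect_less continuous_intros)
     (auto simp: add_nonneg_eq_0_iff)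

lemma rad_norm_le_1: "rad y * norm y \<le> 1"
  by (simp add: rad_def field_simps add_pos_nonneg)

text \<open>With s = 1 / t the point z lies within 2 * s * rad y of s * y. Rounding s down to a
  multiple of (rad y) ^ 2 above 1 moves the centre by at most rad y, and s \<le> 2 * sk, whence 5 =
  2 * 2 + 1. This step size changes the squared norm of s * y by an amount bounded below, so each k
  costs at least 1/2 in the exponent.\<close>

lemma shadow_covered:
  fixes y z :: "complex^'n"
  assumes zy: "(z, y) \<in> shadow" and y: "5 \<le> norm y"
  shows "\<exists>k. dist ((1 + real k * (rad y)\<^sup>2) *\<^sub>R y) z \<le> 5 * ((1 + real k * (rad y)\<^sup>2) * rad y) \<and>
           (norm y)\<^sup>2 - 10 + real k / 2 \<le> (norm z)\<^sup>2"
proof -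
  define \<eta> where "\<eta> = rad y"
  have e: "0 < \<eta>" "\<eta> \<le> 1" "\<eta> * norm y \<le> 1"
    by (simp_all add: \<eta>_def rad_pos rad_le_1 rad_norm_le_1)
  have e2: "0 < \<eta>\<^sup>2" "\<eta>\<^sup>2 \<le> 1" using e by (auto simp: power_le_one)
  obtain t where t: "0 \<le> t" "t \<le> 1" "dist (t *\<^sub>R z) y < rad (t *\<^sub>R z)"
    using zy y by (auto simp: shadow_def)
  have "t \<noteq> 0"
  proof
    assume "t = 0"
    then have "norm y < 1" using t(3) by (simp add: rad_def)
    then show False using y by simp
  qed
  then have t0: "t > 0" using t by simp
  define s where "s = 1 / t"
  have s: "s \<ge> 1" using t t0 by (simp add: s_def)
  have rt: "rad (t *\<^sub>R z) \<le> 2 * \<eta>" using norm_near(3)[OF less_imp_le[OF t(3)]] by (simp add: \<eta>_def)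
  have "z - s *\<^sub>R y = s *\<^sub>R (t *\<^sub>R z - y)" using t0 by (simp add: s_def scaleR_diff_right)
  then have "dist (s *\<^sub>R y) z = s * dist (t *\<^sub>R z) y"
    using s by (simp add: dist_norm norm_minus_commute)
  also have "\<dots> \<le> s * (2 * \<eta>)" using t(3) rt s by (intro mult_left_mono) auto
  finally have d1: "dist (s *\<^sub>R y) z \<le> 2 * (s * \<eta>)" by simp
  \<comment> \<open>The number of full steps of length \<open>\<eta>\<^sup>2\<close> from 1 to
    s.\<close>
  define k where "k = nat \<lfloor>(s - 1) / \<eta>\<^sup>2\<rfloor>"
  have "0 \<le> \<lfloor>(s - 1) / \<eta>\<^sup>2\<rfloor>" using s e2 by simp
  then have "real k = of_int \<lfloor>(s - 1) / \<eta>\<^sup>2\<rfloor>" unfolding k_def by (rule of_nat_nat)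
  then have "real k \<le> (s - 1) / \<eta>\<^sup>2" "(s - 1) / \<eta>\<^sup>2 \<le> real k + 1" by linarith+
  then have k: "real k * \<eta>\<^sup>2 \<le> s - 1" "s - 1 \<le> (real k + 1) * \<eta>\<^sup>2"
    using e2 by (simp_all add: pos_le_divide_eq pos_divide_le_eq)
  define sk where "sk = 1 + real k * \<eta>\<^sup>2"
  have sk: "1 \<le> sk" "sk \<le> s" "s \<le> sk + \<eta>\<^sup>2" "s \<le> 2 * sk"
  proof -
    have kk: "0 \<le> real k * \<eta>\<^sup>2" by simp
    have k2: "(real k + 1) * \<eta>\<^sup>2 = real k * \<eta>\<^sup>2 + \<eta>\<^sup>2" by (simp add: algebra_simps)
    show 1: "1 \<le> sk" "sk \<le> s" "s \<le> sk + \<eta>\<^sup>2"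
      unfolding sk_def using k kk unfolding k2 by linarith+
    show "s \<le> 2 * sk" using 1 e2(2) by linarith
  qed
  have "dist (sk *\<^sub>R y) (s *\<^sub>R y) = (s - sk) * norm y"
    using sk by (simp add: dist_norm scaleR_diff_left[symmetric])
  also have "\<dots> \<le> \<eta>\<^sup>2 * norm y" using sk by (intro mult_right_mono) auto
  also have "\<dots> = \<eta> * (\<eta> * norm y)" by (simp add: power2_eq_square)
  also have "\<dots> \<le> \<eta> * 1" using e by (intro mult_left_mono) auto
  also have "\<dots> \<le> sk * \<eta>" using sk e by simp
  finally have d2: "dist (sk *\<^sub>R y) (s *\<^sub>R y) \<le> sk * \<eta>" .
  have "s * \<eta> \<le> (2 * sk) * \<eta>" using sk e by (intro mult_right_mono) auto
  then have d: "dist (sk *\<^sub>R y) z \<le> 5 * (sk * \<eta>)"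
    using d1 d2 dist_triangle[of "sk *\<^sub>R y" z "s *\<^sub>R y"] by linarith
  have "norm (sk *\<^sub>R y) - norm z \<le> 5 * (sk * \<eta>)"
    using d norm_triangle_ineq2[of "sk *\<^sub>R y" z] by (simp add: dist_norm)
  then have "sk * (norm y - 5 * \<eta>) \<le> norm z" using sk by (simp add: algebra_simps)
  moreover have "0 \<le> sk * (norm y - 5 * \<eta>)" using sk y e by (intro mult_nonneg_nonneg) auto
  ultimately have "(sk * (norm y - 5 * \<eta>))\<^sup>2 \<le> (norm z)\<^sup>2" by (rule power_mono)
  moreover have "sk\<^sup>2 * ((norm y)\<^sup>2 - 10) \<le> (sk * (norm y - 5 * \<eta>))\<^sup>2"
  proof -
    have "(norm y - 5 * \<eta>)\<^sup>2 = (norm y)\<^sup>2 - 10 * (\<eta> * norm y) + 25 * \<eta>\<^sup>2"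
      by (simp add: power2_eq_square algebra_simps)
    then have "(norm y)\<^sup>2 - 10 \<le> (norm y - 5 * \<eta>)\<^sup>2" using e e2 by linarith
    then show ?thesis unfolding power_mult_distrib by (intro mult_left_mono) auto
  qed
  moreover have "(norm y)\<^sup>2 - 10 + real k / 2 \<le> sk\<^sup>2 * ((norm y)\<^sup>2 - 10)"
  proof -
    define Q where "Q = (norm y)\<^sup>2 - 10"
    have yy: "5 * norm y \<le> (norm y)\<^sup>2" using y unfolding power2_eq_square by (intro mult_right_mono) auto
    \<comment> \<open>This is where |y| \<ge> 5 gives room; multiplied by
      \<open>\<eta>\<^sup>2\<close> the right side becomes 1 / 4.\<close>
    have "Q \<ge> (1 + norm y)\<^sup>2 / 4"
    proof -
      have "(1 + norm y)\<^sup>2 = 1 + 2 * norm y + (norm y)\<^sup>2" by (simp add: power2_sum)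
      then show ?thesis unfolding Q_def using yy y by linarith
    qed
    then have "\<eta>\<^sup>2 * Q \<ge> \<eta>\<^sup>2 * ((1 + norm y)\<^sup>2 / 4)" using e2 by (intro mult_left_mono) auto
    moreover have "\<eta>\<^sup>2 * (1 + norm y)\<^sup>2 = 1"
    proof -
      have "1 + norm y \<noteq> 0" using y by linarith
      then have "\<eta> * (1 + norm y) = 1" by (simp add: \<eta>_def rad_def)
      then show ?thesis by (simp flip: power_mult_distrib)
    qed
    ultimately have q: "\<eta>\<^sup>2 * Q \<ge> 1 / 4" by simp
    have Q0: "Q \<ge> 0" unfolding Q_def using yy y by linarith
    have "sk\<^sup>2 = 1 + 2 * (real k * \<eta>\<^sup>2) + (real k * \<eta>\<^sup>2)\<^sup>2" by (simp add: sk_def power2_sum)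
    then have "1 + 2 * (real k * \<eta>\<^sup>2) \<le> sk\<^sup>2" by simp
    then have "(1 + 2 * (real k * \<eta>\<^sup>2)) * Q \<le> sk\<^sup>2 * Q" using Q0 by (rule mult_right_mono)
    moreover have "(1 + 2 * (real k * \<eta>\<^sup>2)) * Q = Q + 2 * (real k * (\<eta>\<^sup>2 * Q))" by (simp add: algebra_simps)
    moreover have "real k * (1 / 4) \<le> real k * (\<eta>\<^sup>2 * Q)" using q by (intro mult_left_mono) auto
    ultimately have "Q + real k / 2 \<le> sk\<^sup>2 * Q" by linarith
    then show ?thesis by (simp add: Q_def)
  qed
  ultimately have "(norm y)\<^sup>2 - 10 + real k / 2 \<le> (norm z)\<^sup>2" by linarith
  then show ?thesis using d unfolding sk_def \<eta>_def by (intro exI[of _ k]) blast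
qed

text \<open>Seen from y, the whole cone has at most the Gaussian mass, up to a constant, of one ball
  of radius \<open>rad y\<close> around y: the volumes of the covering balls grow polynomially in k
  while the weight decays exponentially.\<close>

lemma shadow_gaussian_le:
  fixes c :: real
  assumes c: "c > 0"
  shows "\<exists>M>0. \<forall>y::complex^'n.
     (\<integral>\<^sup>+z. indicator shadow (z, y) * ennreal (exp (- c * (norm z)\<^sup>2)) \<partial>lborel)
     \<le> ennreal (M * rad y ^ DIM(complex^'n) * exp (- c * (norm y)\<^sup>2))"
proof -
  define D where "D = DIM(complex^'n)"
  define v where "v = unit_ball_vol (real D)"
  have v: "v > 0" by (simp add: v_def)
  define S where "S = (\<Sum>k. (1 * real k + 1) ^ D * exp (- (c / 2) * real k))"
  have sum: "summable (\<lambda>k. (1 * real k + 1) ^ D * exp (- (c / 2) * real k))"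
    using c by (intro summable_poly_times_exp) auto
  have S: "S \<ge> 0" unfolding S_def by (intro suminf_nonneg sum) auto
  obtain M0' where M0': "(\<integral>\<^sup>+z. ennreal (exp (- c * (norm z)\<^sup>2)) \<partial>(lborel :: (complex^'n) measure)) \<le> ennreal M0'"
    using nn_integral_gaussian_finite[OF c] by blast
  define M0 where "M0 = max M0' 0"
  have M0: "(\<integral>\<^sup>+z. ennreal (exp (- c * (norm z)\<^sup>2)) \<partial>(lborel :: (complex^'n) measure)) \<le> ennreal M0" "M0 \<ge> 0"
    using order_trans[OF M0' ennreal_leI[of M0' M0]] by (auto simp: M0_def)
  define M1 where "M1 = exp (10 * c) * v * 5 ^ D * S"
  define M2 where "M2 = M0 * 6 ^ D * exp (25 * c)"
  have M: "M1 \<ge> 0" "M2 \<ge> 0" using S v M0 by (auto simp: M1_def M2_def)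
  have "(\<integral>\<^sup>+z. indicator shadow (z, y) * ennreal (exp (- c * (norm z)\<^sup>2)) \<partial>lborel)
     \<le> ennreal ((M1 + M2 + 1) * rad y ^ D * exp (- c * (norm y)\<^sup>2))" (is "?I \<le> _") for y :: "complex^'n"
  proof (cases "norm y < 5")
    case True
    \<comment> \<open>For |y| < 5 the cone is all of space, and the full Gaussian integral suffices:
      rad y \<ge> 1/6 and |y| ^ 2 \<le> 25 give the factors of \<open>M2\<close>.\<close>
    have "?I \<le> (\<integral>\<^sup>+z. ennreal (exp (- c * (norm z)\<^sup>2)) \<partial>(lborel :: (complex^'n) measure))"
      by (intro nn_integral_mono) (auto simp: indicator_def)
    also have "\<dots> \<le> ennreal M0" by (rule M0)
    also have "\<dots> \<le> ennreal ((M1 + M2 + 1) * rad y ^ D * exp (- c * (norm y)\<^sup>2))"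
    proof (rule ennreal_leI)
      have "1 / 6 \<le> rad y" using True by (simp add: rad_def field_simps add_pos_nonneg)
      then have "(1 / 6) ^ D \<le> rad y ^ D" by (intro power_mono) auto
      moreover have "(norm y)\<^sup>2 \<le> 5\<^sup>2" using True by (intro power_mono) auto
      then have "exp (- (25 * c)) \<le> exp (- c * (norm y)\<^sup>2)" using c by simp
      ultimately have "(1 / 6) ^ D * exp (- (25 * c)) \<le> rad y ^ D * exp (- c * (norm y)\<^sup>2)"
        using less_imp_le[OF rad_pos[of y]] by (intro mult_mono zero_le_power) auto
      then have "M2 * ((1 / 6) ^ D * exp (- (25 * c))) \<le> M2 * (rad y ^ D * exp (- c * (norm y)\<^sup>2))"
        using M by (intro mult_left_mono)
      also have "\<dots> \<le> (M1 + M2 + 1) * (rad y ^ D * exp (- c * (norm y)\<^sup>2))"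
        using M rad_pos[of y] by (intro mult_right_mono) auto
      finally show "M0 \<le> (M1 + M2 + 1) * rad y ^ D * exp (- c * (norm y)\<^sup>2)"
        by (simp add: M2_def power_divide exp_minus field_simps)
    qed
    finally show ?thesis .
  next
    case False
    then have y: "5 \<le> norm y" by simp
    define \<eta> where "\<eta> = rad y"
    have e: "0 < \<eta>" "\<eta> \<le> 1" by (simp_all add: \<eta>_def rad_pos rad_le_1)
    define sk where "sk k = 1 + real k * \<eta>\<^sup>2" for k
    have sk: "0 \<le> sk k" "sk k \<le> 1 * real k + 1" for k
      using e mult_left_mono[of "\<eta>\<^sup>2" 1 "real k"] by (auto simp: sk_def power_le_one)
    define A where "A = exp (10 * c) * exp (- c * (norm y)\<^sup>2)"
    have A: "A > 0" by (simp add: A_def)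
    let ?b = "\<lambda>k. A * exp (- (c / 2) * real k)"
    let ?c = "\<lambda>k. A * v * 5 ^ D * \<eta> ^ D * ((1 * real k + 1) ^ D * exp (- (c / 2) * real k))"
    have "?I \<le> ennreal (suminf ?c)"
    proof (rule nn_integral_cover_balls[where x = "\<lambda>k. sk k *\<^sub>R y" and \<rho> = "\<lambda>k. 5 * (sk k * \<eta>)" and b = ?b])
      fix z :: "complex^'n"
      assume "indicator shadow (z, y) * ennreal (exp (- c * (norm z)\<^sup>2)) \<noteq> 0"
      then have "(z, y) \<in> shadow" by (auto simp: indicator_def split: if_splits)
      then obtain k where k: "dist (sk k *\<^sub>R y) z \<le> 5 * (sk k * \<eta>)"
        "(norm y)\<^sup>2 - 10 + real k / 2 \<le> (norm z)\<^sup>2"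
        using shadow_covered[OF _ y, of z] unfolding sk_def \<eta>_def by blast
      have "c * ((norm y)\<^sup>2 - 10 + real k / 2) \<le> c * (norm z)\<^sup>2" using k c by (intro mult_left_mono) auto
      then have "exp (- c * (norm z)\<^sup>2) \<le> ?b k"
        unfolding A_def exp_add[symmetric] by (simp add: algebra_simps)
      then have "indicator shadow (z, y) * ennreal (exp (- c * (norm z)\<^sup>2)) \<le> ennreal (?b k)"
        by (auto simp: indicator_def intro: ennreal_leI)
      then show "\<exists>k. z \<in> cball (sk k *\<^sub>R y) (5 * (sk k * \<eta>)) \<and>
          indicator shadow (z, y) * ennreal (exp (- c * (norm z)\<^sup>2)) \<le> ennreal (?b k)"
        using k(1) by (intro exI[of _ k]) simp
    next
      fix k
      have "?b k * (v * (5 * (sk k * \<eta>)) ^ D) = A * v * 5 ^ D * \<eta> ^ D * (sk k ^ D * exp (- (c / 2) * real k))"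
        by (simp add: power_mult_distrib)
      also have "\<dots> \<le> ?c k"
        using sk[of k] A v e by (intro mult_left_mono mult_right_mono power_mono) auto
      finally show "?b k * (unit_ball_vol (real DIM(complex^'n)) * (5 * (sk k * \<eta>)) ^ DIM(complex^'n)) \<le> ?c k"
        by (simp only: v_def D_def)
    next
      show "summable ?c" by (intro summable_mult sum)
    qed (use sk e A in auto)
    also have "suminf ?c = A * v * 5 ^ D * \<eta> ^ D * S"
      unfolding S_def by (rule suminf_mult[OF sum])
    also have "\<dots> = M1 * (\<eta> ^ D * exp (- c * (norm y)\<^sup>2))" by (simp add: M1_def A_def)
    also have "ennreal \<dots> \<le> ennreal ((M1 + M2 + 1) * (\<eta> ^ D * exp (- c * (norm y)\<^sup>2)))"
      using M e by (intro ennreal_leI mult_right_mono) auto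
    finally show ?thesis by (simp add: \<eta>_def mult.assoc)
  qed
  then show ?thesis using M unfolding D_def by (intro exI[of _ "M1 + M2 + 1"]) auto
qed

text \<open>The primitive at z is controlled by the maximum of the weighted \<open>G\<close> over
  the segment and a ball around 0; a mean value at the maximum point w replaces it by an integral
  over y near w. All such y have z in their shadow, whose Gaussian mass compensates the
  mean.\<close>

proposition radial_primitive_Lp_bound:
  fixes p \<alpha> :: real
  assumes p: "p > 0" and a: "\<alpha> > 0"
  shows "\<exists>C>0. \<forall>G :: complex^'n \<Rightarrow> complex. entire G \<longrightarrow> G 0 = 0 \<longrightarrow>
     (\<integral>\<^sup>+z. ennreal (norm (integral {0..1} (\<lambda>t. G (t *\<^sub>R z) / of_real t)) powr p *
                    exp (- (p * (\<alpha> / 2)) * (norm z)\<^sup>2)) \<partial>lborel)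
     \<le> ennreal C * (\<integral>\<^sup>+z. ennreal ((norm (G z) / (1 + norm z)\<^sup>2 * exp (- (\<alpha> / 2) * (norm z)\<^sup>2)) powr p) \<partial>lborel)"
proof -
  define D where "D = DIM(complex^'n)"
  \<comment> \<open>Half of the exponent \<alpha> / 2 is spent on the pointwise bound of the
    primitive; the remainder exp (- c * |z| ^ 2) is the weight integrated over the shadow.\<close>
  define \<beta> where "\<beta> = \<alpha> / 4"
  define c where "c = p * \<beta>"
  have b: "\<beta> > 0" and c: "c > 0" using a p by (auto simp: \<beta>_def c_def)
  obtain C0 where C0: "C0 > 0" "\<And>(F :: complex^'n \<Rightarrow> complex) z r. entire F \<Longrightarrow> 0 < r \<Longrightarrow>
     ennreal (norm (F z) powr p * r ^ D) \<le>
     ennreal C0 * (\<integral>\<^sup>+w. indicator (ball z r) w * ennreal (norm (F w) powr p) \<partial>lborel)"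
    using local_mean_value[OF p, where 'n = 'n] unfolding D_def by blast
  obtain M where M: "M > 0" "\<And>y::complex^'n.
     (\<integral>\<^sup>+z. indicator shadow (z, y) * ennreal (exp (- c * (norm z)\<^sup>2)) \<partial>lborel)
     \<le> ennreal (M * rad y ^ D * exp (- c * (norm y)\<^sup>2))"
    using shadow_gaussian_le[OF c, where 'n = 'n] unfolding D_def by blast
  define L where "L = (4 + 2 / \<beta>) * (9 * exp (4 * \<beta>))"
  have L: "L > 0" using b by (simp add: L_def add_pos_pos)
  define C1 where "C1 = L powr p * C0 * exp (3 * c) * 4 powr p * 2 ^ D"
  have C1: "C1 > 0" using C0 L by (simp add: C1_def)
  have "(\<integral>\<^sup>+z. ennreal (norm (integral {0..1} (\<lambda>t. G (t *\<^sub>R z) / of_real t)) powr p *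
                    exp (- (p * (\<alpha> / 2)) * (norm z)\<^sup>2)) \<partial>lborel)
     \<le> ennreal (M * C1) * (\<integral>\<^sup>+z. ennreal ((norm (G z) / (1 + norm z)\<^sup>2 * exp (- (\<alpha> / 2) * (norm z)\<^sup>2)) powr p) \<partial>lborel)"
    if G: "entire G" and G0: "G 0 = 0" for G :: "complex^'n \<Rightarrow> complex"
  proof -
    have Gm: "G \<in> borel_measurable borel" by (rule entire_borel_measurable[OF G])
    define W where "W y = (1 + norm y)\<^sup>2" for y :: "complex^'n"
    have W: "W y > 0" for y unfolding W_def by (intro zero_less_power add_pos_nonneg) auto
    define E where "E y = norm (G y) powr p / W y powr p * exp (- c * (norm y)\<^sup>2)" for y
    have E0: "E y \<ge> 0" for y by (simp add: E_def)
    have Em: "E \<in> borel_measurable borel" unfolding E_def W_def using Gm by measurable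
    define \<Phi> where "\<Phi> y = ennreal (C1 / rad y ^ D * E y)" for y
    define k where "k z y = indicator shadow (z, y) * ennreal (exp (- c * (norm z)\<^sup>2))" for z y :: "complex^'n"
    define T where "T y = (norm (G y) / (1 + norm y)\<^sup>2 * exp (- (\<alpha> / 2) * (norm y)\<^sup>2)) powr p" for y
    have Tm: "(\<lambda>y. ennreal (T y)) \<in> borel_measurable borel" unfolding T_def using Gm by measurable
    have "(\<integral>\<^sup>+z. ennreal (norm (integral {0..1} (\<lambda>t. G (t *\<^sub>R z) / of_real t)) powr p *
                    exp (- (p * (\<alpha> / 2)) * (norm z)\<^sup>2)) \<partial>lborel) \<le> (\<integral>\<^sup>+y. ennreal (M * C1) * ennreal (T y) \<partial>lborel)"
    proof (rule nn_integral_kernel_le[where k = k and \<Phi> = \<Phi>])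
      have "(\<lambda>q. indicator shadow q * ennreal (exp (- c * (norm (fst q))\<^sup>2)) :: ennreal)
          \<in> borel_measurable (borel :: ((complex^'n) \<times> (complex^'n)) measure)"
      proof (intro borel_measurable_times_ennreal borel_measurable_indicator)
        show "shadow \<in> sets (borel :: ((complex^'n) \<times> (complex^'n)) measure)"
          using open_shadow by (rule borel_open)
        have "continuous_on UNIV (\<lambda>q::(complex^'n) \<times> (complex^'n). exp (- c * (norm (fst q))\<^sup>2))"
          by (intro continuous_intros)
        then show "(\<lambda>q::(complex^'n) \<times> (complex^'n). ennreal (exp (- c * (norm (fst q))\<^sup>2))) \<in> borel_measurable borel"
          by (intro measurable_compose[OF borel_measurable_continuous_onI measurable_ennreal])
      qed
      then show "(\<lambda>q. k (fst q) (snd q)) \<in> borel_measurable borel" by (simp add: k_def)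
      show "\<Phi> \<in> borel_measurable borel" unfolding \<Phi>_def rad_def using Em by measurable
      show "(\<integral>\<^sup>+z. k z y \<partial>lborel) * \<Phi> y \<le> ennreal (M * C1) * ennreal (T y)" for y
      proof -
        have "(\<integral>\<^sup>+z. k z y \<partial>lborel) * \<Phi> y \<le>
            ennreal (M * rad y ^ D * exp (- c * (norm y)\<^sup>2)) * ennreal (C1 / rad y ^ D * E y)"
          unfolding k_def \<Phi>_def by (intro mult_right_mono M) auto
        also have "\<dots> = ennreal (M * rad y ^ D * exp (- c * (norm y)\<^sup>2) * (C1 / rad y ^ D * E y))"
          using M(1) rad_pos[of y] C1 E0[of y] by (intro ennreal_mult[symmetric]) auto
        also have "M * rad y ^ D * exp (- c * (norm y)\<^sup>2) * (C1 / rad y ^ D * E y) =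
            M * C1 * (exp (- c * (norm y)\<^sup>2) * E y)"
          using rad_pos[of y] by simp
        also have "exp (- c * (norm y)\<^sup>2) * E y = T y"
        proof -
          have "T y = (norm (G y) / W y) powr p * exp (p * (- (\<alpha> / 2) * (norm y)\<^sup>2))"
            unfolding T_def W_def[symmetric] using W[of y]
            by (subst powr_mult) (simp_all add: exp_powr_real mult.commute[of p])
          also have "(norm (G y) / W y) powr p = norm (G y) powr p / W y powr p"
            using W[of y] by (simp add: powr_divide)
          also have "exp (p * (- (\<alpha> / 2) * (norm y)\<^sup>2)) = exp (- c * (norm y)\<^sup>2) * exp (- c * (norm y)\<^sup>2)"
            by (simp add: exp_add[symmetric] c_def \<beta>_def algebra_simps)
          finally show ?thesis by (simp add: E_def)
        qed
        also have "ennreal (M * C1 * T y) = ennreal (M * C1) * ennreal (T y)"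
          using M(1) C1 by (intro ennreal_mult) (auto simp: T_def)
        finally show ?thesis .
      qed
      fix z :: "complex^'n"
      define m where "m w = norm (G w) / W w * exp (- \<beta> * (norm w)\<^sup>2)" for w
      \<comment> \<open>The segment supplies the bound along the ray, and the ball of radius 2 the
        bound near the origin that \<open>radial_primitive_norm_le\<close> asks for.\<close>
      define Z where "Z = cball 0 2 \<union> (\<lambda>t. t *\<^sub>R z) ` {0..1}"
      have "compact Z" unfolding Z_def
        by (intro compact_Un compact_cball compact_continuous_image continuous_intros) auto
      moreover have "Z \<noteq> {}" by (auto simp: Z_def)
      moreover have "continuous_on Z m" unfolding m_def
        using W by (auto simp: W_def less_le intro!: continuous_intros entire_continuous_on[OF G])
      ultimately obtain w where w: "w \<in> Z" "\<And>x. x \<in> Z \<Longrightarrow> m x \<le> m w"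
        using continuous_attains_sup[of Z m] by blast
      have m0: "m x \<ge> 0" for x using W[of x] by (simp add: m_def)
      have Gx: "norm (G x) = m x * (W x * exp (\<beta> * (norm x)\<^sup>2))" for x
        using W[of x] by (simp add: m_def exp_minus)
      have e1: "1 \<le> 9 * exp (4 * \<beta>)" using b one_le_exp_iff[of "4 * \<beta>"] by linarith
      \<comment> \<open>The factor 9 * exp (4 * \<beta>) is a bound for
        \<open>W x * exp (\<beta> * (norm x)\<^sup>2)\<close> when |x| \<le> 2.\<close>
      have Fz: "norm (integral {0..1} (\<lambda>t. G (t *\<^sub>R z) / of_real t)) \<le>
          (4 + 2 / \<beta>) * (9 * exp (4 * \<beta>) * m w) * exp (\<beta> * (norm z)\<^sup>2)"
      proof (rule radial_primitive_norm_le[OF G G0 b])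
        fix x :: "complex^'n" assume x: "norm x \<le> 2"
        have "W x \<le> 3\<^sup>2" unfolding W_def using x by (intro power_mono) auto
        moreover have "(norm x)\<^sup>2 \<le> 2\<^sup>2" using x by (intro power_mono) auto
        ultimately have "W x * exp (\<beta> * (norm x)\<^sup>2) \<le> 9 * exp (4 * \<beta>)"
          using b by (intro mult_mono) auto
        moreover have "m x \<le> m w" using x by (intro w) (simp add: Z_def)
        ultimately have "m x * (W x * exp (\<beta> * (norm x)\<^sup>2)) \<le> m w * (9 * exp (4 * \<beta>))"
          using m0 W[of x] by (intro mult_mono[where a = "m x"]) simp_all
        then show "norm (G x) \<le> 9 * exp (4 * \<beta>) * m w" by (simp add: Gx mult.commute)
      next
        fix t :: real assume t: "0 \<le> t" "t \<le> 1"
        define x where "x = t *\<^sub>R z"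
        have nx: "norm x = t * norm z" using t by (simp add: x_def)
        have "m x \<le> m w" using t by (intro w) (auto simp: Z_def x_def)
        also have "m w \<le> 9 * exp (4 * \<beta>) * m w" using mult_right_mono[OF e1 m0[of w]] by simp
        finally have "m x * (W x * exp (\<beta> * (norm x)\<^sup>2)) \<le> 9 * exp (4 * \<beta>) * m w * (W x * exp (\<beta> * (norm x)\<^sup>2))"
          using W[of x] by (intro mult_right_mono) auto
        then have "norm (G x) \<le> 9 * exp (4 * \<beta>) * m w * (W x * exp (\<beta> * (norm x)\<^sup>2))"
          by (simp only: Gx)
        then show "norm (G (t *\<^sub>R z)) \<le> 9 * exp (4 * \<beta>) * m w *
            ((1 + t * norm z)\<^sup>2 * exp (\<beta> * (t * norm z)\<^sup>2))"
          unfolding W_def nx unfolding x_def .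
      qed
      let ?F = "norm (integral {0..1} (\<lambda>t. G (t *\<^sub>R z) / of_real t))"
      define r where "r = rad w"
      have r: "r > 0" by (simp add: r_def rad_pos)
      define Q where "Q = L powr p * exp (- c * (norm w)\<^sup>2) / (W w powr p * r ^ D)"
      have Q: "Q \<ge> 0" using r by (simp add: Q_def)
      have "?F powr p \<le> (L * m w * exp (\<beta> * (norm z)\<^sup>2)) powr p"
        using Fz p by (intro powr_mono2) (auto simp: L_def mult_ac)
      also have "\<dots> = L powr p * m w powr p * exp (c * (norm z)\<^sup>2)"
        using L m0 by (simp add: powr_mult exp_powr_real c_def mult_ac)
      finally have "?F powr p * exp (- (p * (\<alpha> / 2)) * (norm z)\<^sup>2) \<le>
          L powr p * m w powr p * exp (c * (norm z)\<^sup>2) * exp (- (p * (\<alpha> / 2)) * (norm z)\<^sup>2)"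
        by (intro mult_right_mono) auto
      also have "\<dots> = L powr p * m w powr p * (exp (c * (norm z)\<^sup>2) * exp (- (p * (\<alpha> / 2)) * (norm z)\<^sup>2))"
        by simp
      also have "exp (c * (norm z)\<^sup>2) * exp (- (p * (\<alpha> / 2)) * (norm z)\<^sup>2) = exp (- c * (norm z)\<^sup>2)"
        by (simp add: exp_add[symmetric] c_def \<beta>_def algebra_simps)
      also have "m w powr p = norm (G w) powr p / W w powr p * exp (- c * (norm w)\<^sup>2)"
        using W[of w] by (simp add: m_def powr_mult powr_divide exp_powr_real c_def mult_ac)
      also have "L powr p * (norm (G w) powr p / W w powr p * exp (- c * (norm w)\<^sup>2)) * exp (- c * (norm z)\<^sup>2)
          = (exp (- c * (norm z)\<^sup>2) * Q) * (norm (G w) powr p * r ^ D)"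
        using r by (simp add: Q_def)
      finally have "ennreal (?F powr p * exp (- (p * (\<alpha> / 2)) * (norm z)\<^sup>2)) \<le>
          ennreal ((exp (- c * (norm z)\<^sup>2) * Q)
             * (norm (G w) powr p * r ^ D))"
        by (rule ennreal_leI)
      also have "\<dots> = ennreal (exp (- c * (norm z)\<^sup>2) * Q)
             * ennreal (norm (G w) powr p * r ^ D)"
        using r Q by (intro ennreal_mult) auto
      also have "\<dots> \<le> ennreal (exp (- c * (norm z)\<^sup>2) * Q)
             * (ennreal C0 * (\<integral>\<^sup>+y. indicator (ball w r) y * ennreal (norm (G y) powr p) \<partial>lborel))"
        by (intro mult_left_mono C0 G r) auto
      also have "\<dots> = (\<integral>\<^sup>+y. ennreal (exp (- c * (norm z)\<^sup>2) * Q)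
             * (ennreal C0 * (indicator (ball w r) y * ennreal (norm (G y) powr p))) \<partial>lborel)"
        by (rule nn_integral_ball_cmult[OF G])
      also have "\<dots> \<le> (\<integral>\<^sup>+y. k z y * \<Phi> y \<partial>lborel)"
      proof (rule nn_integral_mono)
        fix y
        show "ennreal (exp (- c * (norm z)\<^sup>2) * Q)
             * (ennreal C0 * (indicator (ball w r) y * ennreal (norm (G y) powr p))) \<le> k z y * \<Phi> y"
        proof (cases "y \<in> ball w r")
          case False
          then show ?thesis by simp
        next
          case True
          then have d: "dist w y < rad w" by (simp add: r_def)
          note near = norm_near[OF less_imp_le[OF d]]
          have "norm y \<le> norm w + dist w y" using norm_triangle_sub[of y w] by (simp add: dist_norm norm_minus_commute)
          then have "norm y < norm w + 1" using d rad_le_1[of w] by linarith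
          \<comment> \<open>If w is in the ball of radius 2, then |y| < 3 and the first part of
            \<open>shadow\<close> applies; if w is on the segment, the second.\<close>
          then have sh: "(z, y) \<in> shadow"
            using w(1) d by (auto simp: Z_def shadow_def)
          have "Q * (C0 * norm (G y) powr p)
            = L powr p * C0 * norm (G y) powr p * (exp (- c * (norm w)\<^sup>2) * (1 / W w powr p * (1 / r ^ D)))"
            by (simp add: Q_def)
          also have "\<dots> \<le> L powr p * C0 * norm (G y) powr p *
             (exp (3 * c - c * (norm y)\<^sup>2) * (1 / (W y / 4) powr p * (1 / (rad y / 2) ^ D)))"
          proof (intro mult_left_mono mult_mono)
            have "c * (norm y)\<^sup>2 \<le> c * ((norm w)\<^sup>2 + 3)"
              using near c by (intro mult_left_mono) auto
            then show "exp (- c * (norm w)\<^sup>2) \<le> exp (3 * c - c * (norm y)\<^sup>2)"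
              by (simp add: algebra_simps)
            have "W y \<le> (2 * (1 + norm w))\<^sup>2" unfolding W_def using near by (intro power_mono) auto
            also have "(2 * (1 + norm w))\<^sup>2 = 4 * W w" unfolding W_def power_mult_distrib by simp
            finally have "W y / 4 \<le> W w" by simp
            then show "1 / W w powr p \<le> 1 / (W y / 4) powr p"
              using W[of y] W[of w] p by (intro divide_left_mono powr_mono2 mult_pos_pos) auto
            show "1 / r ^ D \<le> 1 / (rad y / 2) ^ D"
              using near rad_pos[of y] r unfolding r_def by (intro divide_left_mono power_mono) auto
          qed (use C0 r in auto)
          also have "\<dots> = C1 / rad y ^ D * E y"
            using W[of y] by (simp add: C1_def E_def exp_diff exp_minus power_divide powr_divide field_simps)
          finally have "ennreal (Q * (C0 * norm (G y) powr p)) \<le> \<Phi> y"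
            unfolding \<Phi>_def by (rule ennreal_leI)
          then have "ennreal (exp (- c * (norm z)\<^sup>2)) *
             ennreal (Q * (C0 * norm (G y) powr p)) \<le> k z y * \<Phi> y"
            using sh by (simp add: k_def mult_left_mono)
          moreover have "ennreal (exp (- c * (norm z)\<^sup>2) * Q)
             * (ennreal C0 * ennreal (norm (G y) powr p)) = ennreal (exp (- c * (norm z)\<^sup>2)) *
             ennreal (Q * (C0 * norm (G y) powr p))"
            using C0(1) Q by (subst ennreal_mult3; simp add: ennreal_mult[symmetric] mult.assoc)
          ultimately show ?thesis using True by simp
        qed
      qed
      finally show "ennreal (?F powr p * exp (- (p * (\<alpha> / 2)) * (norm z)\<^sup>2)) \<le> (\<integral>\<^sup>+y. k z y * \<Phi> y \<partial>lborel)" .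
    qed
    also have "\<dots> = ennreal (M * C1) * (\<integral>\<^sup>+y. ennreal (T y) \<partial>lborel)"
      using Tm by (intro nn_integral_cmult) simp
    finally show ?thesis by (simp add: T_def)
  qed
  moreover have "M * C1 > 0" using C1 M by simp
  ultimately show ?thesis by blast
qed

section \<open>Growth spaces and the associated weight\<close>

lemma assoc_weight_set_bdd:
  assumes "0 \<le> r"
  shows "bdd_above {norm (f (complex_of_real r) :: complex) | f. f holomorphic_on UNIV \<and> (\<forall>w. norm (f w) \<le> \<omega> (norm w))}"
proof (rule bdd_aboveI)
  fix x assume "x \<in> {norm (f (complex_of_real r) :: complex) | f. f holomorphic_on UNIV \<and> (\<forall>w. norm (f w) \<le> \<omega> (norm w))}"
  then obtain f :: "complex \<Rightarrow> complex" where "x = norm (f (complex_of_real r))" "\<And>w. norm (f w) \<le> \<omega> (norm w)" by auto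
  then have "x \<le> \<omega> (norm (complex_of_real r))" by blast
  then show "x \<le> \<omega> r" using assms by simp
qed

lemma assoc_weight_upper:
  assumes "0 \<le> r" "f holomorphic_on UNIV" "\<And>w. norm (f w) \<le> \<omega> (norm w)"
  shows "norm (f (complex_of_real r)) \<le> assoc_weight \<omega> r"
  unfolding assoc_weight_def using assms by (intro cSup_upper assoc_weight_set_bdd) auto

lemma assoc_weight_nonneg:
  assumes "weight_function \<omega>" "0 \<le> r"
  shows "0 \<le> assoc_weight \<omega> r"
  using assoc_weight_upper[of r "\<lambda>_. 0" \<omega>] assms weight_function_pos[OF assms(1)]
  by (simp add: less_imp_le)

text \<open>As a supremum of continuous functions the associated weight is lower semicontinuous.\<close>

lemma assoc_weight_norm_measurable:
  fixes \<phi> :: "'a::real_normed_vector \<Rightarrow> 'b::real_normed_vector"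
  assumes w: "weight_function \<omega>" and p: "continuous_on UNIV \<phi>"
  shows "(\<lambda>z. assoc_weight \<omega> (norm (\<phi> z))) \<in> borel_measurable borel"
  unfolding borel_measurable_iff_greater
proof
  fix a
  let ?F = "{f. f holomorphic_on UNIV \<and> (\<forall>w::complex. norm (f w :: complex) \<le> \<omega> (norm w))}"
  have "(\<lambda>_. 0) \<in> ?F" using weight_function_pos[OF w] by (auto simp: less_imp_le)
  then have ne: "{norm (f (complex_of_real r) :: complex) | f. f holomorphic_on UNIV \<and> (\<forall>w. norm (f w) \<le> \<omega> (norm w))} \<noteq> {}" for r
    by blast
  have "{z \<in> space borel. a < assoc_weight \<omega> (norm (\<phi> z))} =
      (\<Union>f\<in>?F. {z. a < norm (f (complex_of_real (norm (\<phi> z))))})"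
    unfolding assoc_weight_def by (subst less_cSup_iff[OF ne assoc_weight_set_bdd]) auto
  also have "open \<dots>"
  proof (intro open_UN ballI open_Collect_less continuous_intros)
    fix f assume "f \<in> ?F"
    then have f: "continuous_on UNIV f" by (auto intro: holomorphic_on_imp_continuous_on)
    show "continuous_on UNIV (\<lambda>z. f (complex_of_real (norm (\<phi> z))))"
      by (rule continuous_on_compose2[OF f]) (auto intro!: continuous_intros p)
  qed
  finally show "{z \<in> space borel. a < assoc_weight \<omega> (norm (\<phi> z))} \<in> sets borel"
    using borel_open by metis
qed

lemma growth_space_bound:
  fixes f :: "complex^'n \<Rightarrow> complex"
  assumes w: "weight_function \<omega>" and f: "f \<in> growth_space \<omega>"
  shows "norm (f z) \<le> growth_norm \<omega> f * \<omega> (norm z)" and "0 \<le> growth_norm \<omega> f"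
proof -
  have le: "norm (f z) / \<omega> (norm z) \<le> growth_norm \<omega> f" for z
    unfolding growth_norm_def using f by (intro cSUP_upper) (auto simp: growth_space_def)
  have pos: "\<omega> (norm z) > 0" for z :: "complex^'n" by (rule weight_function_pos[OF w]) simp
  show "norm (f z) \<le> growth_norm \<omega> f * \<omega> (norm z)"
    using le[of z] pos[of z] by (simp add: field_simps)
  have "0 \<le> norm (f 0) / \<omega> (norm (0::complex^'n))" using pos[of 0] by simp
  then show "0 \<le> growth_norm \<omega> f" using le order_trans by blast
qed

lemma growth_spaceI:
  assumes w: "weight_function \<omega>" and f: "entire f" and b: "\<And>z. norm (f z) \<le> C * \<omega> (norm z)"
  shows "f \<in> growth_space \<omega>" and "growth_norm \<omega> f \<le> C"
proof -
  have le: "norm (f z) / \<omega> (norm z) \<le> C" for z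
    using b[of z] weight_function_pos[OF w, of "norm z"] by (simp add: field_simps)
  show "f \<in> growth_space \<omega>" using f le by (auto simp: growth_space_def intro!: bdd_aboveI)
  show "growth_norm \<omega> f \<le> C" unfolding growth_norm_def using le by (intro cSUP_least) auto
qed

text \<open>Restricting \<open>f\<close> to the complex line through z and dividing by its norm
  gives a competitor in one variable; this is how the one-variable associated weight controls
  functions of several variables.\<close>

lemma growth_space_assoc_bound:
  fixes f :: "complex^'n \<Rightarrow> complex"
  assumes w: "weight_function \<omega>" and f: "f \<in> growth_space \<omega>"
  shows "norm (f z) \<le> growth_norm \<omega> f * assoc_weight \<omega> (norm z)"
proof (cases "growth_norm \<omega> f = 0")
  case True
  then show ?thesis using growth_space_bound(1)[OF w f, of z] by simp
next
  case False
  define N where "N = growth_norm \<omega> f"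
  have N: "N > 0" using False growth_space_bound(2)[OF w f] by (simp add: N_def)
  have ent: "entire f" using f by (simp add: growth_space_def)
  obtain u :: "complex^'n" where u: "norm u = 1" "z = norm z *\<^sub>R u"
  proof (cases "z = 0")
    case True
    then show thesis using exists_unit that by auto
  next
    case False
    then show thesis using that[of "(1 / norm z) *\<^sub>R z"] by simp
  qed
  define h where "h c = f (c *s u) / of_real N" for c
  have "norm (h (complex_of_real (norm z))) \<le> assoc_weight \<omega> (norm z)"
  proof (rule assoc_weight_upper)
    show "h holomorphic_on UNIV" unfolding h_def
      using N by (intro holomorphic_intros entire_line_holomorphic[OF ent]) auto
    show "norm (h c) \<le> \<omega> (norm c)" for c
    proof -
      have "norm (f (c *s u)) \<le> N * \<omega> (norm c)"
        using growth_space_bound(1)[OF w f, of "c *s u"] u by (simp add: N_def norm_vec_scale)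
      then show ?thesis using N by (simp add: h_def norm_divide field_simps)
    qed
  qed simp
  also have "h (complex_of_real (norm z)) = f z / of_real N"
    using u(2) by (simp add: h_def of_real_scale_vec)
  finally show ?thesis using N by (simp add: norm_divide N_def[symmetric] field_simps)
qed

section \<open>The Volterra type operator\<close>

lemma volterra_kernel:
  assumes "entire g" "entire_map \<phi>" "entire f"
  shows "entire (\<lambda>z. f (\<phi> z) * radial_deriv g z)"
    and "f (\<phi> 0) * radial_deriv g 0 = 0"
proof -
  show "entire (\<lambda>z. f (\<phi> z) * radial_deriv g z)"
    by (rule entire_mult[OF entire_compose[OF assms(3,2)] entire_radial_deriv[OF assms(1)]])
  show "f (\<phi> 0) * radial_deriv g 0 = 0" by (simp add: radial_deriv_def)
qed

lemma volterra_entire: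
  assumes "entire g" "entire_map \<phi>" "entire f"
  shows "entire (volterra g \<phi> f)"
    and "cderiv (volterra g \<phi> f) z z = f (\<phi> z) * radial_deriv g z"
  using radial_primitive[OF volterra_kernel[OF assms]]
  by (simp_all add: volterra_def[abs_def])

lemma volterra_linear:
  assumes "entire g" "entire_map \<phi>" "entire f" "entire h"
  shows "volterra g \<phi> (\<lambda>z. a * f z + b * h z) = (\<lambda>z. a * volterra g \<phi> f z + b * volterra g \<phi> h z)"
proof
  fix z
  let ?k = "\<lambda>f t. f (\<phi> (t *\<^sub>R z)) * radial_deriv g (t *\<^sub>R z) / of_real t"
  have int: "?k f integrable_on {0..1}" if "entire f" for f
    using radial_primitive_integrable[OF volterra_kernel[OF assms(1,2) that]] .
  have "volterra g \<phi> (\<lambda>z. a * f z + b * h z) z = integral {0..1} (\<lambda>t. a * ?k f t + b * ?k h t)"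
    unfolding volterra_def by (intro integral_cong) (simp add: add_divide_distrib distrib_right mult.assoc)
  also have "\<dots> = integral {0..1} (\<lambda>t. a * ?k f t) + integral {0..1} (\<lambda>t. b * ?k h t)"
    using assms by (intro integral_add integrable_on_mult_right int)
  also have "\<dots> = a * volterra g \<phi> f z + b * volterra g \<phi> h z"
    unfolding volterra_def by (simp only: integral_mult_right)
  finally show "volterra g \<phi> (\<lambda>z. a * f z + b * h z) z = a * volterra g \<phi> f z + b * volterra g \<phi> h z" .
qed

text \<open>The factor of (ii) that does not involve \<omega>. Multiplied by |f o \<phi>| it is the
  weighted size of the radial derivative of the image of \<open>f\<close>, to which both integral
  estimates apply.\<close>

definition volterra_density :: "real \<Rightarrow> (complex^'n \<Rightarrow> complex) \<Rightarrow> complex^'n \<Rightarrow> real" where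
  "volterra_density \<alpha> g z = norm (radial_deriv g z) / (1 + norm z)\<^sup>2 * exp (- (\<alpha> / 2) * (norm z)\<^sup>2)"

lemma volterra_density_nonneg: "0 \<le> volterra_density \<alpha> g z"
  by (simp add: volterra_density_def)

lemma volterra_density_measurable:
  assumes "entire g" shows "volterra_density \<alpha> g \<in> borel_measurable borel"
  unfolding volterra_density_def
  using entire_borel_measurable[OF entire_radial_deriv[OF assms]] by measurable

lemma norm_times_volterra_density:
  "norm c * volterra_density \<alpha> g z =
     norm (c * radial_deriv g z) / (1 + norm z)\<^sup>2 * exp (- (\<alpha> / 2) * (norm z)\<^sup>2)"
  by (simp add: volterra_density_def norm_mult)

text \<open>Pair each subset A without i with A extended by i: the two sums differ by
  \<open>a i\<close>, so one of them has norm at least |a i| / 2. There are 2 ^ card I / 2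
  pairs.\<close>

lemma sum_Pow_powr_ge:
  fixes a :: "'i \<Rightarrow> complex"
  assumes I: "finite I" and i: "i \<in> I" and p: "p > 0"
  shows "2 ^ card I / 2 * (norm (a i) / 2) powr p \<le> (\<Sum>A\<in>Pow I. norm (\<Sum>j\<in>A. a j) powr p)"
proof -
  define J where "J = I - {i}"
  have J: "finite J" "i \<notin> J" "I = insert i J" using I i by (auto simp: J_def)
  let ?s = "\<lambda>A. norm (\<Sum>j\<in>A. a j) powr p"
  have "(\<Sum>A\<in>Pow I. ?s A) = (\<Sum>A\<in>Pow J. ?s A) + (\<Sum>A\<in>insert i ` Pow J. ?s A)"
    unfolding J(3) Pow_insert using J by (intro sum.union_disjoint) auto
  also have "(\<Sum>A\<in>insert i ` Pow J. ?s A) = (\<Sum>A\<in>Pow J. ?s (insert i A))"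
    using J by (intro sum.reindex_cong[where l = "insert i"]) (auto simp: inj_on_def)
  also have "(\<Sum>A\<in>Pow J. ?s A) + \<dots> = (\<Sum>A\<in>Pow J. ?s A + ?s (insert i A))"
    by (rule sum.distrib[symmetric])
  also have "\<dots> \<ge> (\<Sum>A\<in>Pow J. (norm (a i) / 2) powr p)"
  proof (rule sum_mono)
    fix A assume "A \<in> Pow J"
    then have A: "finite A" "i \<notin> A" using J finite_subset by auto
    have "a i = (\<Sum>j\<in>insert i A. a j) - (\<Sum>j\<in>A. a j)" using A by simp
    then have "norm (a i) \<le> norm (\<Sum>j\<in>insert i A. a j) + norm (\<Sum>j\<in>A. a j)"
      by (metis norm_triangle_ineq4)
    then consider "norm (a i) / 2 \<le> norm (\<Sum>j\<in>A. a j)" | "norm (a i) / 2 \<le> norm (\<Sum>j\<in>insert i A. a j)"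
      by linarith
    then show "(norm (a i) / 2) powr p \<le> ?s A + ?s (insert i A)"
    proof cases
      case 1
      then have "(norm (a i) / 2) powr p \<le> ?s A" using p by (intro powr_mono2) auto
      then show ?thesis by (simp add: add_increasing2)
    next
      case 2
      then have "(norm (a i) / 2) powr p \<le> ?s (insert i A)" using p by (intro powr_mono2) auto
      then show ?thesis by (simp add: add_increasing)
    qed
  qed
  finally show ?thesis using J by (simp add: card_Pow)
qed

context
  fixes \<omega> :: "real \<Rightarrow> real" and g :: "complex^'n \<Rightarrow> complex"
    and \<phi> :: "complex^'n \<Rightarrow> complex^'n" and \<alpha> :: real
  assumes w: "weight_function \<omega>" and g: "entire g" and phi: "entire_map \<phi>" and a: "\<alpha> > 0"
begin

private abbreviation "H \<equiv> \<lambda>z. volterra_density \<alpha> g z * assoc_weight \<omega> (norm (\<phi> z))"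

lemma volterra_density_assoc_measurable: "H \<in> borel_measurable borel"
  by (intro borel_measurable_times volterra_density_measurable g assoc_weight_norm_measurable w
        entire_map_continuous_on phi)

lemma volterra_density_assoc_nonneg: "0 \<le> H z"
  using assoc_weight_nonneg[OF w, of "norm (\<phi> z)"] volterra_density_nonneg[of \<alpha> g z] by simp

lemma growth_volterra_density_le:
  assumes "f \<in> growth_space \<omega>"
  shows "norm (f (\<phi> z)) * volterra_density \<alpha> g z \<le> growth_norm \<omega> f * H z"
  using mult_right_mono[OF growth_space_assoc_bound[OF w assms, of "\<phi> z"] volterra_density_nonneg[of \<alpha> g z]]
  by (simp add: mult_ac)

lemma bounded_operator_volterra_iff:
  "bounded_operator (growth_space \<omega>) (growth_norm \<omega>) (fock_space \<alpha> q) (fock_norm \<alpha> q) (volterra g \<phi>) \<longleftrightarrow>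
     (\<forall>f\<in>growth_space \<omega>. volterra g \<phi> f \<in> fock_space \<alpha> q) \<and>
     (\<exists>C. \<forall>f\<in>growth_space \<omega>. fock_norm \<alpha> q (volterra g \<phi> f) \<le> C * growth_norm \<omega> f)"
  using volterra_linear[OF g phi] unfolding bounded_operator_def growth_space_def by auto

section \<open>The exponent infinity: pointwise estimates\<close>

lemma volterra_bounded_infinity:
  assumes K: "AE z in lebesgue. \<bar>H z\<bar> \<le> K"
  shows "bounded_operator (growth_space \<omega>) (growth_norm \<omega>) (fock_space \<alpha> \<infinity>) (fock_norm \<alpha> \<infinity>) (volterra g \<phi>)"
proof -
  define L where "L = (4 + 2 / (\<alpha> / 2)) * (9 * exp (4 * (\<alpha> / 2)))"
  define K' where "K' = max K 0"
  have key: "norm (volterra g \<phi> f z) * exp (- (\<alpha> / 2) * (norm z)\<^sup>2) \<le> L * K' * growth_norm \<omega> f"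
    if f: "f \<in> growth_space \<omega>" for f z
  proof -
    define N where "N = growth_norm \<omega> f"
    have N: "N \<ge> 0" unfolding N_def by (rule growth_space_bound(2)[OF w f])
    have ef: "entire f" using f by (simp add: growth_space_def)
    define G where "G = (\<lambda>z. f (\<phi> z) * radial_deriv g z)"
    have G: "entire G" "G 0 = 0" using volterra_kernel[OF g phi ef] by (simp_all add: G_def)
    define P where "P x = (1 + norm x)\<^sup>2 * exp (\<alpha> / 2 * (norm x)\<^sup>2)" for x :: "complex^'n"
    have Ppos: "P x > 0" for x
      unfolding P_def by (intro mult_pos_pos zero_less_power add_pos_nonneg) auto
    have Gx: "norm (f (\<phi> x)) * volterra_density \<alpha> g x = norm (G x) / P x" for x
      unfolding norm_times_volterra_density by (simp add: G_def P_def exp_minus field_simps)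
    have all: "norm (G x) \<le> N * K' * P x" for x
    proof -
      \<comment> \<open>\<open>H\<close> is known only almost everywhere and need not be continuous,
        but for each f the resulting inequality between continuous functions defines a closed set,
        so it holds everywhere.\<close>
      have "closed {x. norm (G x) \<le> N * K' * P x}"
        unfolding P_def using entire_continuous_on[OF G(1)]
        by (intro closed_Collect_le continuous_intros) auto
      moreover have "AE x \<in> UNIV in lebesgue. x \<in> {x. norm (G x) \<le> N * K' * P x}"
      proof (rule AE_mp[OF K], rule AE_I2, intro impI)
        fix x assume "\<bar>H x\<bar> \<le> K"
        then have "H x \<le> K'" by (simp add: K'_def)
        then have "N * H x \<le> N * K'" using N by (rule mult_left_mono)
        then have "norm (G x) / P x \<le> N * K'"
          using growth_volterra_density_le[OF f, of x] by (simp add: Gx N_def)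
        then show "x \<in> {x. norm (G x) \<le> N * K' * P x}" using Ppos[of x] by (simp add: pos_divide_le_eq)
      qed
      ultimately have "x \<in> {x. norm (G x) \<le> N * K' * P x}"
        using mem_closed_if_AE_lebesgue_open[OF open_UNIV] by blast
      then show ?thesis by simp
    qed
    have e1: "1 \<le> 9 * exp (4 * (\<alpha> / 2))" using a one_le_exp_iff[of "4 * (\<alpha> / 2)"] by linarith
    have NK: "N * K' \<ge> 0" using N by (simp add: K'_def)
    have "norm (volterra g \<phi> f z) \<le> (4 + 2 / (\<alpha> / 2)) * (N * K' * (9 * exp (4 * (\<alpha> / 2)))) * exp (\<alpha> / 2 * (norm z)\<^sup>2)"
      unfolding volterra_def G_def[unfolded fun_eq_iff, rule_format, symmetric]
    proof (rule radial_primitive_norm_le[OF G])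
      show "\<alpha> / 2 > 0" using a by simp
      fix x :: "complex^'n" assume x: "norm x \<le> 2"
      have "(1 + norm x)\<^sup>2 \<le> 3\<^sup>2" using x by (intro power_mono) auto
      moreover have "(norm x)\<^sup>2 \<le> 2\<^sup>2" using x by (intro power_mono) auto
      ultimately have "P x \<le> 9 * exp (4 * (\<alpha> / 2))"
        unfolding P_def using a by (intro mult_mono) auto
      then show "norm (G x) \<le> N * K' * (9 * exp (4 * (\<alpha> / 2)))"
        using order_trans[OF all[of x] mult_left_mono[OF _ NK]] by blast
    next
      fix t :: real assume t: "0 \<le> t" "t \<le> 1"
      have "norm (G (t *\<^sub>R z)) \<le> N * K' * P (t *\<^sub>R z)" by (rule all)
      also have "\<dots> \<le> N * K' * (9 * exp (4 * (\<alpha> / 2))) * P (t *\<^sub>R z)"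
        using mult_left_mono[OF e1 NK] Ppos[of "t *\<^sub>R z"] by (intro mult_right_mono) auto
      also have "P (t *\<^sub>R z) = (1 + t * norm z)\<^sup>2 * exp (\<alpha> / 2 * (t * norm z)\<^sup>2)"
        using t by (simp add: P_def)
      finally show "norm (G (t *\<^sub>R z)) \<le> N * K' * (9 * exp (4 * (\<alpha> / 2))) *
          ((1 + t * norm z)\<^sup>2 * exp (\<alpha> / 2 * (t * norm z)\<^sup>2))" .
    qed
    also have "\<dots> = L * K' * N * exp (\<alpha> / 2 * (norm z)\<^sup>2)" by (simp add: L_def)
    finally have "norm (volterra g \<phi> f z) * exp (- (\<alpha> / 2) * (norm z)\<^sup>2) \<le>
        L * K' * N * exp (\<alpha> / 2 * (norm z)\<^sup>2) * exp (- (\<alpha> / 2) * (norm z)\<^sup>2)"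
      by (intro mult_right_mono) auto
    also have "\<dots> = L * K' * N" by (simp add: exp_minus)
    finally show ?thesis by (simp add: N_def)
  qed
  have "volterra g \<phi> f \<in> fock_space \<alpha> \<infinity>" if f: "f \<in> growth_space \<omega>" for f
  proof -
    have "entire f" using f by (simp add: growth_space_def)
    moreover have "bdd_above (range (\<lambda>z. norm (volterra g \<phi> f z) * exp (- (\<alpha> / 2) * (norm z)\<^sup>2)))"
      using key[OF f] by (intro bdd_aboveI[of _ "L * K' * growth_norm \<omega> f"]) auto
    ultimately show ?thesis using volterra_entire(1)[OF g phi] by (simp add: fock_space_def)
  qed
  moreover have "fock_norm \<alpha> \<infinity> (volterra g \<phi> f) \<le> L * K' * growth_norm \<omega> f" if f: "f \<in> growth_space \<omega>" for f
    unfolding fock_norm_def using key[OF f] by (auto intro: cSUP_least)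
  ultimately show ?thesis unfolding bounded_operator_volterra_iff by blast
qed

lemma volterra_density_bounded_infinity:
  assumes B: "bounded_operator (growth_space \<omega>) (growth_norm \<omega>) (fock_space \<alpha> \<infinity>) (fock_norm \<alpha> \<infinity>) (volterra g \<phi>)"
  shows "\<exists>K. \<forall>z. \<bar>H z\<bar> \<le> K"
proof -
  obtain C where C: "\<And>f. f \<in> growth_space \<omega> \<Longrightarrow> volterra g \<phi> f \<in> fock_space \<alpha> \<infinity>"
    "\<And>f. f \<in> growth_space \<omega> \<Longrightarrow> fock_norm \<alpha> \<infinity> (volterra g \<phi> f) \<le> C * growth_norm \<omega> f"
    using B unfolding bounded_operator_volterra_iff by blast
  obtain h :: "nat \<times> (complex^'n) \<Rightarrow> complex^'n \<Rightarrow> complex" and I :: "nat \<Rightarrow> (nat \<times> (complex^'n)) set" and C0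
    where C0: "C0 > 0" and h: "\<forall>p. entire (h p)" and I: "\<forall>N. finite (I N) \<and> I N \<subseteq> I (Suc N)"
    and upper: "\<forall>N z. (\<Sum>p\<in>I N. norm (h p z)) \<le> C0 * \<omega> (norm z)"
    and lower: "\<forall>z. \<exists>N. \<exists>p\<in>I N. assoc_weight \<omega> (norm z) \<le> C0 * norm (h p z)"
    using growth_test_family[OF w, where 'n = 'n] by (elim exE conjE) (rule that)
  define R where "R = \<bar>C\<bar> * C0"
  have R: "R \<ge> 0" using C0 by (simp add: R_def)
  have "\<bar>H z\<bar> \<le> C0 * (2 * R * exp (3 * (\<alpha> / 2)))" for z
  proof -
    obtain N p where p: "p \<in> I N" "assoc_weight \<omega> (norm (\<phi> z)) \<le> C0 * norm (h p (\<phi> z))"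
      using lower by blast
    have eh: "entire (h p)" by (rule spec[OF h])
    have "norm (h p x) \<le> C0 * \<omega> (norm x)" for x
      using member_le_sum[OF p(1), of "\<lambda>p. norm (h p x)"] I spec[OF spec[OF upper, of N], of x] by auto
    from growth_spaceI[OF w eh this]
    have gs: "h p \<in> growth_space \<omega>" "growth_norm \<omega> (h p) \<le> C0" by auto
    have "fock_norm \<alpha> \<infinity> (volterra g \<phi> (h p)) \<le> C * growth_norm \<omega> (h p)" by (rule C(2)[OF gs(1)])
    also have "\<dots> \<le> \<bar>C\<bar> * growth_norm \<omega> (h p)"
      using growth_space_bound(2)[OF w gs(1)] by (intro mult_right_mono) auto
    also have "\<dots> \<le> R" unfolding R_def using gs by (intro mult_left_mono) auto
    finally have n: "fock_norm \<alpha> \<infinity> (volterra g \<phi> (h p)) \<le> R" .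
    have Vx: "norm (volterra g \<phi> (h p) x) \<le> R * exp (\<alpha> / 2 * (norm x)\<^sup>2)" for x
    proof -
      have "norm (volterra g \<phi> (h p) x) * exp (- (\<alpha> / 2) * (norm x)\<^sup>2) \<le> fock_norm \<alpha> \<infinity> (volterra g \<phi> (h p))"
        using C(1)[OF gs(1)] by (auto simp: fock_norm_def fock_space_def intro: cSUP_upper)
      with n have "norm (volterra g \<phi> (h p) x) * exp (- (\<alpha> / 2) * (norm x)\<^sup>2) \<le> R" by linarith
      then show ?thesis by (simp add: exp_minus field_simps)
    qed
    obtain x where x: "dist z x \<le> rad z / 2"
      "norm (cderiv (volterra g \<phi> (h p)) z z) \<le> 2 * (1 + norm z)\<^sup>2 * norm (volterra g \<phi> (h p) x)"
      using radial_derivative_norm_le[OF volterra_entire(1)[OF g phi eh]] by blast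
    \<comment> \<open>Within this distance the Gaussian changes by at most exp (3 * (\<alpha> /
      2)).\<close>
    have "dist z x \<le> rad z" using x(1) rad_pos[of z] by linarith
    then have "(norm x)\<^sup>2 \<le> (norm z)\<^sup>2 + 3" by (rule norm_near)
    then have "\<alpha> / 2 * (norm x)\<^sup>2 \<le> \<alpha> / 2 * ((norm z)\<^sup>2 + 3)" using a by (intro mult_left_mono) auto
    then have ex: "exp (\<alpha> / 2 * (norm x)\<^sup>2) \<le> exp (3 * (\<alpha> / 2)) * exp (\<alpha> / 2 * (norm z)\<^sup>2)"
      by (simp add: exp_add[symmetric] algebra_simps)
    have "norm (h p (\<phi> z) * radial_deriv g z) \<le> 2 * (1 + norm z)\<^sup>2 * norm (volterra g \<phi> (h p) x)"
      using x(2) by (simp only: volterra_entire(2)[OF g phi eh])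
    also have "\<dots> \<le> 2 * (1 + norm z)\<^sup>2 * (R * (exp (3 * (\<alpha> / 2)) * exp (\<alpha> / 2 * (norm z)\<^sup>2)))"
      using order_trans[OF Vx[of x] mult_left_mono[OF ex R]] by (intro mult_left_mono) auto
    finally have *: "norm (h p (\<phi> z) * radial_deriv g z) \<le>
        (1 + norm z)\<^sup>2 * (2 * R * exp (3 * (\<alpha> / 2)) * exp (\<alpha> / 2 * (norm z)\<^sup>2))"
      by (simp add: mult_ac)
    have zp: "(1 + norm z)\<^sup>2 > 0" by (intro zero_less_power add_pos_nonneg) auto
    have "norm (h p (\<phi> z) * radial_deriv g z) / (1 + norm z)\<^sup>2 \<le>
        2 * R * exp (3 * (\<alpha> / 2)) * exp (\<alpha> / 2 * (norm z)\<^sup>2)"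
      using * zp by (simp only: pos_divide_le_eq mult.commute[of "(1 + norm z)\<^sup>2"])
    then have "norm (h p (\<phi> z)) * volterra_density \<alpha> g z \<le>
        2 * R * exp (3 * (\<alpha> / 2)) * exp (\<alpha> / 2 * (norm z)\<^sup>2) * exp (- (\<alpha> / 2) * (norm z)\<^sup>2)"
      unfolding norm_times_volterra_density by (intro mult_right_mono) auto
    also have "\<dots> = 2 * R * exp (3 * (\<alpha> / 2))" by (simp add: exp_minus)
    finally have "C0 * (norm (h p (\<phi> z)) * volterra_density \<alpha> g z) \<le> C0 * (2 * R * exp (3 * (\<alpha> / 2)))"
      using C0 by (intro mult_left_mono) auto
    moreover have "H z \<le> volterra_density \<alpha> g z * (C0 * norm (h p (\<phi> z)))"
      using p(2) volterra_density_nonneg by (rule mult_left_mono)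
    ultimately have "H z \<le> C0 * (2 * R * exp (3 * (\<alpha> / 2)))" by (simp add: mult_ac)
    then show ?thesis using volterra_density_assoc_nonneg[of z] by linarith
  qed
  then show ?thesis by blast
qed

section \<open>Finite exponents: integral estimates\<close>

lemma fock_integral_eq:
  "fock_integral \<alpha> p f = ennreal ((\<alpha> * p / (2 * pi)) ^ CARD('n)) *
     (\<integral>\<^sup>+z. ennreal (norm (f z) powr p * exp (- (p * (\<alpha> / 2)) * (norm z)\<^sup>2)) \<partial>lborel)"
  for f :: "complex^'n \<Rightarrow> complex"
  unfolding fock_integral_def nn_integral_completion by (simp add: mult.commute)

text \<open>The associated weight bounds f o \<phi> pointwise, and
  \<open>radial_primitive_Lp_bound\<close> passes from the radial derivative to the image
  function.\<close>

lemma volterra_bounded_finite: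
  assumes q: "0 < q" "q \<noteq> \<infinity>"
    and fin: "(\<integral>\<^sup>+z. ennreal (H z powr enn2real q) \<partial>lborel) < \<infinity>"
  shows "bounded_operator (growth_space \<omega>) (growth_norm \<omega>) (fock_space \<alpha> q) (fock_norm \<alpha> q) (volterra g \<phi>)"
proof -
  define p where "p = enn2real q"
  have p: "p > 0" using q by (auto simp: p_def enn2real_positive_iff less_top)
  define K where "K = (\<alpha> * p / (2 * pi)) ^ CARD('n)"
  have K: "K \<ge> 0" using a p by (simp add: K_def)
  obtain C where C: "C > 0" "\<And>G :: complex^'n \<Rightarrow> complex. entire G \<Longrightarrow> G 0 = 0 \<Longrightarrow>
     (\<integral>\<^sup>+z. ennreal (norm (integral {0..1} (\<lambda>t. G (t *\<^sub>R z) / of_real t)) powr p *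
                    exp (- (p * (\<alpha> / 2)) * (norm z)\<^sup>2)) \<partial>lborel)
     \<le> ennreal C * (\<integral>\<^sup>+z. ennreal ((norm (G z) / (1 + norm z)\<^sup>2 * exp (- (\<alpha> / 2) * (norm z)\<^sup>2)) powr p) \<partial>lborel)"
    using radial_primitive_Lp_bound[OF p a, where 'n = 'n] by blast
  obtain B where B: "B \<ge> 0" "(\<integral>\<^sup>+z. ennreal (H z powr p) \<partial>lborel) = ennreal B"
    using fin unfolding p_def by (cases "\<integral>\<^sup>+z. ennreal (H z powr enn2real q) \<partial>lborel") auto
  have key: "fock_integral \<alpha> p (volterra g \<phi> f) \<le> ennreal (K * C * B * growth_norm \<omega> f powr p)"
    if f: "f \<in> growth_space \<omega>" for f
  proof -
    define N where "N = growth_norm \<omega> f"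
    have N: "N \<ge> 0" unfolding N_def by (rule growth_space_bound(2)[OF w f])
    have ef: "entire f" using f by (simp add: growth_space_def)
    have "(\<integral>\<^sup>+z. ennreal (norm (volterra g \<phi> f z) powr p * exp (- (p * (\<alpha> / 2)) * (norm z)\<^sup>2)) \<partial>lborel)
      \<le> ennreal C * (\<integral>\<^sup>+z. ennreal ((norm (f (\<phi> z) * radial_deriv g z) / (1 + norm z)\<^sup>2 *
            exp (- (\<alpha> / 2) * (norm z)\<^sup>2)) powr p) \<partial>lborel)"
      unfolding volterra_def by (rule C(2)[OF volterra_kernel[OF g phi ef]])
    also have "(\<integral>\<^sup>+z. ennreal ((norm (f (\<phi> z) * radial_deriv g z) / (1 + norm z)\<^sup>2 *
            exp (- (\<alpha> / 2) * (norm z)\<^sup>2)) powr p) \<partial>lborel) \<le> (\<integral>\<^sup>+z. ennreal (N powr p) * ennreal (H z powr p) \<partial>lborel)"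
    proof (rule nn_integral_mono)
      fix z
      have "(norm (f (\<phi> z)) * volterra_density \<alpha> g z) powr p \<le> (N * H z) powr p"
        using growth_volterra_density_le[OF f, of z] volterra_density_nonneg[of \<alpha> g z] p
        unfolding N_def by (intro powr_mono2) auto
      also have "\<dots> = N powr p * H z powr p"
        by (rule powr_mult)
      finally show "ennreal ((norm (f (\<phi> z) * radial_deriv g z) / (1 + norm z)\<^sup>2 *
            exp (- (\<alpha> / 2) * (norm z)\<^sup>2)) powr p) \<le> ennreal (N powr p) * ennreal (H z powr p)"
        unfolding norm_times_volterra_density by (simp add: ennreal_leI flip: ennreal_mult)
    qed
    also have "\<dots> = ennreal (N powr p) * ennreal B"
      using volterra_density_assoc_measurable B(2) by (subst nn_integral_cmult) simp_all
    finally have "fock_integral \<alpha> p (volterra g \<phi> f) \<le> ennreal K * (ennreal C * (ennreal (N powr p) * ennreal B))"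
      unfolding fock_integral_eq K_def[symmetric] by (simp add: mult_left_mono)
    also have "\<dots> = ennreal (K * C * B * N powr p)"
      using K C(1) B(1) by (simp add: ennreal_mult[symmetric] mult_ac)
    finally show ?thesis by (simp add: N_def)
  qed
  have "volterra g \<phi> f \<in> fock_space \<alpha> q" if f: "f \<in> growth_space \<omega>" for f
  proof -
    have "fock_integral \<alpha> p (volterra g \<phi> f) < \<infinity>" using key[OF f] by (rule order_le_less_trans) simp
    moreover have "entire f" using f by (simp add: growth_space_def)
    ultimately show ?thesis using q volterra_entire(1)[OF g phi] by (simp add: fock_space_def p_def)
  qed
  moreover have "fock_norm \<alpha> q (volterra g \<phi> f) \<le> (K * C * B) powr (1 / p) * growth_norm \<omega> f"
    if f: "f \<in> growth_space \<omega>" for f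
  proof -
    define N where "N = growth_norm \<omega> f"
    have N: "N \<ge> 0" unfolding N_def by (rule growth_space_bound(2)[OF w f])
    have KCB: "K * C * B \<ge> 0" using K C(1) B(1) by simp
    have "enn2real (fock_integral \<alpha> p (volterra g \<phi> f)) \<le> K * C * B * N powr p"
      unfolding N_def using KCB by (intro enn2real_leI key[OF f]) simp
    then have "enn2real (fock_integral \<alpha> p (volterra g \<phi> f)) powr (1 / p) \<le> (K * C * B * N powr p) powr (1 / p)"
      using p by (intro powr_mono2) auto
    also have "\<dots> = (K * C * B) powr (1 / p) * N"
      using p N KCB by (simp add: powr_mult powr_powr)
    finally show ?thesis using q by (simp add: fock_norm_def p_def N_def)
  qed
  ultimately show ?thesis unfolding bounded_operator_volterra_iff by blast
qed

text \<open>
  Averaging over all subsums of the test family replaces Khinchine's inequality: each subsum is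
  bounded by the weight, while on average it is at least a fixed multiple of each of its terms.
\<close>

lemma volterra_density_integrable_finite:
  assumes q: "0 < q" "q \<noteq> \<infinity>"
    and bd: "bounded_operator (growth_space \<omega>) (growth_norm \<omega>) (fock_space \<alpha> q) (fock_norm \<alpha> q) (volterra g \<phi>)"
  shows "(\<integral>\<^sup>+z. ennreal (H z powr enn2real q) \<partial>lborel) < \<infinity>"
proof -
  define p where "p = enn2real q"
  have p: "p > 0" using q by (auto simp: p_def enn2real_positive_iff less_top)
  define K where "K = (\<alpha> * p / (2 * pi)) ^ CARD('n)"
  have K: "K > 0" using a p by (simp add: K_def)
  obtain C where C: "\<And>f. f \<in> growth_space \<omega> \<Longrightarrow> volterra g \<phi> f \<in> fock_space \<alpha> q"
    "\<And>f. f \<in> growth_space \<omega> \<Longrightarrow> fock_norm \<alpha> q (volterra g \<phi> f) \<le> C * growth_norm \<omega> f"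
    using bd unfolding bounded_operator_volterra_iff by blast
  obtain h :: "nat \<times> (complex^'n) \<Rightarrow> complex^'n \<Rightarrow> complex" and I :: "nat \<Rightarrow> (nat \<times> (complex^'n)) set" and C0
    where C0: "C0 > 0" and h: "\<forall>p. entire (h p)" and I: "\<forall>N. finite (I N) \<and> I N \<subseteq> I (Suc N)"
    and upper: "\<forall>N z. (\<Sum>p\<in>I N. norm (h p z)) \<le> C0 * \<omega> (norm z)"
    and lower: "\<forall>z. \<exists>N. \<exists>p\<in>I N. assoc_weight \<omega> (norm z) \<le> C0 * norm (h p z)"
    using growth_test_family[OF w, where 'n = 'n] by (elim exE conjE) (rule that)
  obtain C1 where C1: "C1 > 0" "\<And>F :: complex^'n \<Rightarrow> complex. entire F \<Longrightarrow>
     (\<integral>\<^sup>+z. ennreal ((norm (cderiv F z z) / (1 + norm z)\<^sup>2 * exp (- (\<alpha> / 2) * (norm z)\<^sup>2)) powr p) \<partial>lborel)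
     \<le> ennreal C1 * (\<integral>\<^sup>+z. ennreal (norm (F z) powr p * exp (- (p * (\<alpha> / 2)) * (norm z)\<^sup>2)) \<partial>lborel)"
    using radial_derivative_Lp_bound[OF p, of "\<alpha> / 2", where 'n = 'n] a by auto
  \<comment> \<open>The factors come from the derivative estimate, the operator bound on test
    functions, and the normalising constant of the Fock integral. The absolute value allows for a
    negative \<open>C\<close>.\<close>
  define R where "R = C1 * ((\<bar>C\<bar> * C0) powr p / K)"
  have R: "R \<ge> 0" using C1(1) K by (simp add: R_def)
  have test: "(\<integral>\<^sup>+z. ennreal ((norm (f (\<phi> z)) * volterra_density \<alpha> g z) powr p) \<partial>lborel) \<le> ennreal R"
    if ef: "entire f" and fb: "\<And>z. norm (f z) \<le> C0 * \<omega> (norm z)" for f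
  proof -
    note gs = growth_spaceI[OF w ef fb]
    have "fock_norm \<alpha> q (volterra g \<phi> f) \<le> C * growth_norm \<omega> f" by (rule C(2)[OF gs(1)])
    also have "\<dots> \<le> \<bar>C\<bar> * growth_norm \<omega> f"
      using growth_space_bound(2)[OF w gs(1)] by (intro mult_right_mono) auto
    also have "\<dots> \<le> \<bar>C\<bar> * C0" using gs by (intro mult_left_mono) auto
    finally have "enn2real (fock_integral \<alpha> p (volterra g \<phi> f)) powr (1 / p) \<le> \<bar>C\<bar> * C0"
      using q by (simp add: fock_norm_def p_def)
    then have "(enn2real (fock_integral \<alpha> p (volterra g \<phi> f)) powr (1 / p)) powr p \<le> (\<bar>C\<bar> * C0) powr p"
      using p by (intro powr_mono2) auto
    then have "enn2real (fock_integral \<alpha> p (volterra g \<phi> f)) \<le> (\<bar>C\<bar> * C0) powr p"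
      using p by (simp add: powr_powr)
    \<comment> \<open>The norm alone does not exclude an infinite integral, since
      \<open>enn2real\<close> sends infinity to 0; membership in the space does.\<close>
    moreover have "fock_integral \<alpha> p (volterra g \<phi> f) < \<infinity>"
      using C(1)[OF gs(1)] q by (simp add: fock_space_def p_def)
    ultimately have fi: "fock_integral \<alpha> p (volterra g \<phi> f) \<le> ennreal ((\<bar>C\<bar> * C0) powr p)"
      by (metis ennreal_enn2real ennreal_leI infinity_ennreal_def)
    let ?J = "\<integral>\<^sup>+z. ennreal (norm (volterra g \<phi> f z) powr p * exp (- (p * (\<alpha> / 2)) * (norm z)\<^sup>2)) \<partial>lborel"
    have "?J = ennreal (1 / K) * (ennreal K * ?J)"
      using K by (simp add: mult.assoc[symmetric] ennreal_mult[symmetric])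
    also have "\<dots> \<le> ennreal (1 / K) * ennreal ((\<bar>C\<bar> * C0) powr p)"
      using fi unfolding fock_integral_eq K_def[symmetric] by (intro mult_left_mono) auto
    also have "\<dots> = ennreal ((\<bar>C\<bar> * C0) powr p / K)" using K by (simp add: ennreal_mult[symmetric])
    finally have "ennreal C1 * ?J \<le> ennreal C1 * ennreal ((\<bar>C\<bar> * C0) powr p / K)" by (intro mult_left_mono) auto
    also have "\<dots> = ennreal R" unfolding R_def using C1(1) K by (intro ennreal_mult[symmetric]) auto
    finally show ?thesis
      using order_trans[OF C1(2)[OF volterra_entire(1)[OF g phi ef]]]
      unfolding volterra_entire(2)[OF g phi ef] norm_times_volterra_density by blast
  qed
  \<comment> \<open>The factors 2 and 2 ^ p undo the averaging bound \<open>sum_Pow_powr_ge\<close>,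
    and \<open>C0\<close> compares the associated weight with a test function.\<close>
  define L where "L = 2 * (2 * C0) powr p"
  have L: "L \<ge> 0" by (simp add: L_def)
  \<comment> \<open>On \<open>Z N\<close> some member of the finite family \<open>I N\<close>
    carries the associated weight. The averaged estimate there does not depend on N, and these sets
    increase to the whole space.\<close>
  define Z where "Z N = (\<Union>i\<in>I N. {z. assoc_weight \<omega> (norm (\<phi> z)) \<le> C0 * norm (h i (\<phi> z))})" for N
  have hm: "(\<lambda>z. norm (h i (\<phi> z))) \<in> borel_measurable borel" for i
    using entire_borel_measurable[OF entire_compose[OF h[rule_format] phi]] by measurable
  have Zm: "Z N \<in> sets borel" for N
  proof -
    have "{z \<in> space borel. assoc_weight \<omega> (norm (\<phi> z)) \<le> C0 * norm (h i (\<phi> z))} \<in> sets borel" for i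
      by (intro borel_measurable_le borel_measurable_times borel_measurable_const hm
            assoc_weight_norm_measurable w entire_map_continuous_on phi)
    then show ?thesis unfolding Z_def using I by (intro sets.finite_UN) auto
  qed
  have Hm: "(\<lambda>z. ennreal (H z powr p)) \<in> borel_measurable borel"
    using volterra_density_assoc_measurable by measurable
  have level: "(\<integral>\<^sup>+z. ennreal (H z powr p) * indicator (Z N) z \<partial>lborel) \<le> ennreal (L * R)" for N
  proof -
    let ?n = "2 ^ card (I N) :: real"
    have fI: "finite (I N)" using I by simp
    define f where "f A z = (\<Sum>i\<in>A. h i z)" for A z
    let ?t = "\<lambda>A z. (norm (f A (\<phi> z)) * volterra_density \<alpha> g z) powr p"
    have fA: "entire (f A)" for A unfolding f_def using h by (intro entire_sum) auto
    have fb: "norm (f A z) \<le> C0 * \<omega> (norm z)" if "A \<in> Pow (I N)" for A z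
    proof -
      have "norm (f A z) \<le> (\<Sum>i\<in>A. norm (h i z))" unfolding f_def by (rule norm_sum)
      also have "\<dots> \<le> (\<Sum>i\<in>I N. norm (h i z))" using that fI by (intro sum_mono2) auto
      finally show ?thesis using upper by (meson order_trans)
    qed
    have tm: "(\<lambda>z. ennreal (?t A z)) \<in> borel_measurable lborel" for A
      using entire_borel_measurable[OF entire_compose[OF fA[of A] phi]] volterra_density_measurable[OF g, of \<alpha>]
      by measurable
    have "ennreal (H z powr p) * indicator (Z N) z \<le> ennreal (L / ?n) * (\<Sum>A\<in>Pow (I N). ennreal (?t A z))" for z
    proof (cases "z \<in> Z N")
      case False
      then show ?thesis by simp
    next
      case True
      then obtain i where i: "i \<in> I N" "assoc_weight \<omega> (norm (\<phi> z)) \<le> C0 * norm (h i (\<phi> z))"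
        by (auto simp: Z_def)
      define d where "d = volterra_density \<alpha> g z"
      have d: "d \<ge> 0" unfolding d_def by (rule volterra_density_nonneg)
      have "H z \<le> d * (C0 * norm (h i (\<phi> z)))" unfolding d_def
        using i(2) volterra_density_nonneg by (rule mult_left_mono)
      also have "\<dots> = d * (2 * C0 * (norm (h i (\<phi> z)) / 2))" by simp
      finally have "H z powr p \<le> (d * (2 * C0 * (norm (h i (\<phi> z)) / 2))) powr p"
        using p volterra_density_assoc_nonneg by (intro powr_mono2) auto
      also have "\<dots> = d powr p * ((2 * C0) powr p * (norm (h i (\<phi> z)) / 2) powr p)"
        using d C0 by (simp only: powr_mult mult_nonneg_nonneg norm_ge_zero divide_nonneg_nonneg less_imp_le zero_le_numeral)
      also have "\<dots> = L / ?n * (d powr p * (?n / 2 * (norm (h i (\<phi> z)) / 2) powr p))"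
        by (simp add: L_def)
      also have "\<dots> \<le> L / ?n * (d powr p * (\<Sum>A\<in>Pow (I N). norm (f A (\<phi> z)) powr p))"
        unfolding f_def using L sum_Pow_powr_ge[OF fI i(1) p] by (intro mult_left_mono) auto
      also have "\<dots> = L / ?n * (\<Sum>A\<in>Pow (I N). ?t A z)"
        using d by (simp add: sum_distrib_left powr_mult d_def[symmetric] mult.commute)
      finally have "ennreal (H z powr p) \<le> ennreal (L / ?n * (\<Sum>A\<in>Pow (I N). ?t A z))"
        by (rule ennreal_leI)
      also have "\<dots> = ennreal (L / ?n) * (\<Sum>A\<in>Pow (I N). ennreal (?t A z))"
      proof -
        have "(\<Sum>A\<in>Pow (I N). ennreal (?t A z)) = ennreal (\<Sum>A\<in>Pow (I N). ?t A z)"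
          by (rule sum_ennreal) simp
        moreover have "ennreal (L / ?n * (\<Sum>A\<in>Pow (I N). ?t A z)) = ennreal (L / ?n) * ennreal (\<Sum>A\<in>Pow (I N). ?t A z)"
          using L by (intro ennreal_mult sum_nonneg) auto
        ultimately show ?thesis by (simp only:)
      qed
      finally show ?thesis using True by simp
    qed
    then have "(\<integral>\<^sup>+z. ennreal (H z powr p) * indicator (Z N) z \<partial>lborel) \<le>
       (\<integral>\<^sup>+z. ennreal (L / ?n) * (\<Sum>A\<in>Pow (I N). ennreal (?t A z)) \<partial>lborel)"
      by (intro nn_integral_mono)
    also have "\<dots> = ennreal (L / ?n) * (\<Sum>A\<in>Pow (I N). \<integral>\<^sup>+z. ennreal (?t A z) \<partial>lborel)"
      by (subst nn_integral_cmult, intro borel_measurable_sum tm, subst nn_integral_sum, rule tm, rule refl)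
    also have "\<dots> \<le> ennreal (L / ?n) * (\<Sum>A\<in>Pow (I N). ennreal R)"
      \<comment> \<open>The 2 ^ card (I N) subsums obey the same bound R, so their number cancels in
        the average.\<close>
      using fA fb by (intro mult_left_mono sum_mono test) auto
    also have "(\<Sum>A\<in>Pow (I N). ennreal R) = ennreal (?n * R)"
      using R fI by (subst sum_ennreal) (auto simp: card_Pow)
    also have "ennreal (L / ?n) * ennreal (?n * R) = ennreal (L / ?n * (?n * R))"
      using L R by (intro ennreal_mult[symmetric]) auto
    also have "L / ?n * (?n * R) = L * R" by simp
    finally show ?thesis .
  qed
  have incZ: "Z N \<subseteq> Z (Suc N)" for N unfolding Z_def using I by blast
  have covZ: "\<exists>N. z \<in> Z N" for z using lower unfolding Z_def by blast
  have "(\<integral>\<^sup>+z. ennreal (H z powr p) \<partial>lborel) =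
      (\<integral>\<^sup>+z. (SUP N. ennreal (H z powr p) * indicator (Z N) z) \<partial>lborel)"
  proof (intro nn_integral_cong antisym)
    fix z
    obtain N where "z \<in> Z N" using covZ by blast
    then show "ennreal (H z powr p) \<le> (SUP N. ennreal (H z powr p) * indicator (Z N) z)"
      by (intro SUP_upper2[of N]) auto
    show "(SUP N. ennreal (H z powr p) * indicator (Z N) z) \<le> ennreal (H z powr p)"
      by (intro SUP_least) (auto simp: indicator_def)
  qed
  also have "\<dots> = (SUP N. \<integral>\<^sup>+z. ennreal (H z powr p) * indicator (Z N) z \<partial>lborel)"
  proof (rule nn_integral_monotone_convergence_SUP)
    show "incseq (\<lambda>N z. ennreal (H z powr p) * indicator (Z N) z)"
      using incZ by (intro incseq_SucI le_funI mult_left_mono) (auto simp: indicator_def)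
    show "(\<lambda>z. ennreal (H z powr p) * indicator (Z N) z) \<in> borel_measurable lborel" for N
      using Hm Zm[of N] by (intro borel_measurable_times_ennreal borel_measurable_indicator) auto
  qed
  also have "\<dots> \<le> ennreal (L * R)" by (intro SUP_least level)
  also have "\<dots> < \<infinity>" by simp
  finally show ?thesis by (simp add: p_def)
qed

end

section \<open>The equivalence, for infinite and finite exponents\<close>

theorem corollary1p3:
  fixes \<omega> :: "real \<Rightarrow> real"
    and g :: "complex ^ 'n \<Rightarrow> complex"
    and \<phi> :: "complex ^ 'n \<Rightarrow> complex ^ 'n"
    and \<alpha> :: real
    and q :: ennreal
  assumes "weight_function \<omega>"
    and "entire g"
    and "entire_map \<phi>"
    and "\<alpha> > 0"
    and "q > 0"
  shows "bounded_operator (growth_space \<omega>) (growth_norm \<omega>) (fock_space \<alpha> q) (fock_norm \<alpha> q)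
           (volterra g \<phi>)
     \<longleftrightarrow> (\<lambda>z. norm (radial_deriv g z) / (1 + norm z)\<^sup>2 * exp (- (\<alpha> / 2) * (norm z)\<^sup>2)
               * assoc_weight \<omega> (norm (\<phi> z))) \<in> Lq_space q"
proof -
  let ?H = "\<lambda>z. volterra_density \<alpha> g z * assoc_weight \<omega> (norm (\<phi> z))"
  have meas: "?H \<in> borel_measurable lebesgue"
    using volterra_density_assoc_measurable[OF assms(1-4)] by (intro measurable_completion) simp
  have abs: "\<bar>?H z\<bar> = ?H z" for z
    using volterra_density_assoc_nonneg[OF assms(1-4), of z] by simp
  have "bounded_operator (growth_space \<omega>) (growth_norm \<omega>) (fock_space \<alpha> q) (fock_norm \<alpha> q) (volterra g \<phi>)
     \<longleftrightarrow> ?H \<in> Lq_space q"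
  proof (cases "q = \<infinity>")
    case True
    have "?H \<in> Lq_space \<infinity> \<longleftrightarrow> (\<exists>K. AE z in lebesgue. \<bar>?H z\<bar> \<le> K)"
      using meas by (simp add: Lq_space_def)
    moreover have "\<exists>K. AE z in lebesgue. \<bar>?H z\<bar> \<le> K" if "\<exists>K. \<forall>z. \<bar>?H z\<bar> \<le> K"
      using that by (elim exE) (intro exI AE_I2, rule spec)
    ultimately show ?thesis
      using volterra_bounded_infinity[OF assms(1-4)] volterra_density_bounded_infinity[OF assms(1-4)]
      unfolding True by blast
  next
    case False
    have "?H \<in> Lq_space q \<longleftrightarrow> (\<integral>\<^sup>+z. ennreal (?H z powr enn2real q) \<partial>lborel) < \<infinity>"
      using meas False by (simp only: Lq_space_def mem_Collect_eq abs nn_integral_completion if_False simp_thms)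
    then show ?thesis
      using volterra_bounded_finite[OF assms(1-5) False] volterra_density_integrable_finite[OF assms(1-5) False]
      by blast
  qed
  then show ?thesis by (simp only: volterra_density_def)
qed

end
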